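(* The theory $\mathbb{S}imple$ of simple MV-algebras is not of presheaf type, i.e. its classifying topos is not equivalent to any topos of presheaves on a small category.
   Context: An MV-algebra is a structure $(A,\oplus,\neg,0)$ such that $(A,\oplus,0)$ is a commutative monoid, $\neg\neg x=x$, $x\oplus\neg 0=\neg 0$ and $\neg(\neg x\oplus y)\oplus y=\neg(\neg y\oplus x)\oplus x$. Write $1=\neg 0$, $nx=x\oplus\cdots\oplus x$ ($n$ times). $\mathbb{MV}$ is the algebraic theory of MV-algebras. A geometric theory is a set of sequents $(\phi\vdash_{\vec x}\psi)$, where $\phi,\psi$ are geometric formulae, i.e. built from atomic formulae using finitary conjunctions, existential quantifications and arbitrary disjunctions; each geometric theory has a classifying topos. $\mathbb{S}imple$ is the geometric theory obtained from $\mathbb{MV}$ by adding the sequent $(\top\vdash_x\bigvee_{n\in\mathbb{N}}(x=0\vee nx=1))$. *)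

theory Defs
  imports Main "HOL-Library.FuncSet" "HOL-Library.Equipollence" "HOL-Library.Infinite_Typeclass"
begin

section \<open>Categories, functors, equivalence\<close>

text \<open>Arrows are accessed through hom-sets, which need not be disjoint; hence composition takes
  the three objects involved: \<open>Cmp C X Y Z g f : X \<rightarrow> Z\<close> for \<open>f : X \<rightarrow> Y\<close> and \<open>g : Y \<rightarrow> Z\<close>.\<close>

record ('o, 'm) cat =
  Ob  :: "'o set"
  Hom :: "'o \<Rightarrow> 'o \<Rightarrow> 'm set"
  Idn :: "'o \<Rightarrow> 'm"
  Cmp :: "'o \<Rightarrow> 'o \<Rightarrow> 'o \<Rightarrow> 'm \<Rightarrow> 'm \<Rightarrow> 'm"

definition category :: "('o, 'm) cat \<Rightarrow> bool" where
  "category C \<longleftrightarrow>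
     (\<forall>X\<in>Ob C. Idn C X \<in> Hom C X X) \<and>
     (\<forall>X\<in>Ob C. \<forall>Y\<in>Ob C. \<forall>Z\<in>Ob C. \<forall>f\<in>Hom C X Y. \<forall>g\<in>Hom C Y Z.
        Cmp C X Y Z g f \<in> Hom C X Z) \<and>
     (\<forall>X\<in>Ob C. \<forall>Y\<in>Ob C. \<forall>f\<in>Hom C X Y.
        Cmp C X X Y f (Idn C X) = f \<and> Cmp C X Y Y (Idn C Y) f = f) \<and>
     (\<forall>W\<in>Ob C. \<forall>X\<in>Ob C. \<forall>Y\<in>Ob C. \<forall>Z\<in>Ob C.
        \<forall>f\<in>Hom C W X. \<forall>g\<in>Hom C X Y. \<forall>h\<in>Hom C Y Z.
        Cmp C W Y Z h (Cmp C W X Y g f) = Cmp C W X Z (Cmp C X Y Z h g) f)"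

definition op_cat :: "('o, 'm) cat \<Rightarrow> ('o, 'm) cat" where
  "op_cat C = \<lparr>Ob = Ob C, Hom = (\<lambda>X Y. Hom C Y X), Idn = Idn C,
     Cmp = (\<lambda>X Y Z g f. Cmp C Z Y X f g)\<rparr>"

definition full_subcat :: "('o, 'm) cat \<Rightarrow> 'o set \<Rightarrow> ('o, 'm) cat" where
  "full_subcat C S = C\<lparr>Ob := Ob C \<inter> S\<rparr>"

definition is_iso :: "('o, 'm) cat \<Rightarrow> 'o \<Rightarrow> 'o \<Rightarrow> 'm \<Rightarrow> bool" where
  "is_iso C X Y f \<longleftrightarrow> f \<in> Hom C X Y \<and>
     (\<exists>g\<in>Hom C Y X. Cmp C X Y X g f = Idn C X \<and> Cmp C Y X Y f g = Idn C Y)"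

record ('o, 'm, 'p, 'n) func =
  fob  :: "'o \<Rightarrow> 'p"
  fmap :: "'o \<Rightarrow> 'o \<Rightarrow> 'm \<Rightarrow> 'n"

definition is_func :: "('o, 'm) cat \<Rightarrow> ('p, 'n) cat \<Rightarrow> ('o, 'm, 'p, 'n) func \<Rightarrow> bool" where
  "is_func C D F \<longleftrightarrow>
     (\<forall>X\<in>Ob C. fob F X \<in> Ob D) \<and>
     (\<forall>X\<in>Ob C. \<forall>Y\<in>Ob C. \<forall>f\<in>Hom C X Y. fmap F X Y f \<in> Hom D (fob F X) (fob F Y)) \<and>
     (\<forall>X\<in>Ob C. fmap F X X (Idn C X) = Idn D (fob F X)) \<and>
     (\<forall>X\<in>Ob C. \<forall>Y\<in>Ob C. \<forall>Z\<in>Ob C. \<forall>f\<in>Hom C X Y. \<forall>g\<in>Hom C Y Z.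
        fmap F X Z (Cmp C X Y Z g f) =
        Cmp D (fob F X) (fob F Y) (fob F Z) (fmap F Y Z g) (fmap F X Y f))"

definition id_func :: "('o, 'm, 'o, 'm) func" where
  "id_func = \<lparr>fob = (\<lambda>X. X), fmap = (\<lambda>X Y f. f)\<rparr>"

definition comp_func ::
  "('p, 'n, 'q, 'k) func \<Rightarrow> ('o, 'm, 'p, 'n) func \<Rightarrow> ('o, 'm, 'q, 'k) func" where
  "comp_func G F = \<lparr>fob = (\<lambda>X. fob G (fob F X)),
     fmap = (\<lambda>X Y f. fmap G (fob F X) (fob F Y) (fmap F X Y f))\<rparr>"

definition nat_trans ::
  "('o, 'm) cat \<Rightarrow> ('p, 'n) cat \<Rightarrow> ('o, 'm, 'p, 'n) func \<Rightarrow> ('o, 'm, 'p, 'n) func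
    \<Rightarrow> ('o \<Rightarrow> 'n) \<Rightarrow> bool" where
  "nat_trans C D F G \<tau> \<longleftrightarrow>
     \<tau> \<in> extensional (Ob C) \<and>
     (\<forall>X\<in>Ob C. \<tau> X \<in> Hom D (fob F X) (fob G X)) \<and>
     (\<forall>X\<in>Ob C. \<forall>Y\<in>Ob C. \<forall>f\<in>Hom C X Y.
        Cmp D (fob F X) (fob F Y) (fob G Y) (\<tau> Y) (fmap F X Y f) =
        Cmp D (fob F X) (fob G X) (fob G Y) (fmap G X Y f) (\<tau> X))"

definition nat_iso ::
  "('o, 'm) cat \<Rightarrow> ('p, 'n) cat \<Rightarrow> ('o, 'm, 'p, 'n) func \<Rightarrow> ('o, 'm, 'p, 'n) func
    \<Rightarrow> ('o \<Rightarrow> 'n) \<Rightarrow> bool" where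
  "nat_iso C D F G \<tau> \<longleftrightarrow>
     nat_trans C D F G \<tau> \<and> (\<forall>X\<in>Ob C. is_iso D (fob F X) (fob G X) (\<tau> X))"

definition equivalent_cats :: "('o, 'm) cat \<Rightarrow> ('p, 'n) cat \<Rightarrow> bool" where
  "equivalent_cats C D \<longleftrightarrow>
     (\<exists>F G \<eta> \<epsilon>. is_func C D F \<and> is_func D C G \<and>
        nat_iso C C id_func (comp_func G F) \<eta> \<and> nat_iso D D (comp_func F G) id_func \<epsilon>)"

text \<open>Functors are not required to be extensional: two functors that differ only outside the
  carrier of their domain are distinct but isomorphic objects of the functor category.\<close>

definition functor_cat ::
  "('o, 'm) cat \<Rightarrow> ('p, 'n) cat \<Rightarrow> (('o, 'm, 'p, 'n) func, 'o \<Rightarrow> 'n) cat" where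
  "functor_cat C D = \<lparr>Ob = {F. is_func C D F},
     Hom = (\<lambda>F G. {\<tau>. nat_trans C D F G \<tau>}),
     Idn = (\<lambda>F. \<lambda>X\<in>Ob C. Idn D (fob F X)),
     Cmp = (\<lambda>F G H \<tau> \<sigma>. \<lambda>X\<in>Ob C. Cmp D (fob F X) (fob G X) (fob H X) (\<tau> X) (\<sigma> X))\<rparr>"


section \<open>Presheaves and sheaves\<close>

text \<open>The type \<open>'u\<close> plays the role of a Grothendieck universe: a set is small if it has fewer
  elements than \<open>'u\<close>. When the cardinality of \<open>'u\<close> is strongly inaccessible, \<open>set_cat\<close> is up to
  equivalence the usual category of small sets. HOL cannot provide such a type, so no closure
  property of \<open>'u\<close> is built into the definitions. Every small category is isomorphic to one whose
  objects and arrows are elements of \<open>'u\<close>.\<close>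

definition small :: "'a set \<Rightarrow> 'u itself \<Rightarrow> bool" where
  "small A _ \<longleftrightarrow> A \<prec> (UNIV :: 'u set)"

definition small_category :: "('u, 'u) cat \<Rightarrow> bool" where
  "small_category C \<longleftrightarrow> category C \<and> small (Ob C) TYPE('u) \<and>
     small (SIGMA (X, Y) : Ob C \<times> Ob C. Hom C X Y) TYPE('u)"

definition set_cat :: "('u set, 'u \<Rightarrow> 'u) cat" where
  "set_cat = \<lparr>Ob = {A. small A TYPE('u)}, Hom = (\<lambda>A B. A \<rightarrow>\<^sub>E B), Idn = (\<lambda>A. \<lambda>a\<in>A. a),
     Cmp = (\<lambda>A B C g f. compose A g f)\<rparr>"

type_synonym ('o, 'm, 'u) presheaf = "('o, 'm, 'u set, 'u \<Rightarrow> 'u) func"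

definition presheaf_cat :: "('o, 'm) cat \<Rightarrow> (('o, 'm, 'u) presheaf, 'o \<Rightarrow> 'u \<Rightarrow> 'u) cat" where
  "presheaf_cat C = functor_cat (op_cat C) set_cat"

text \<open>A sieve on \<open>X\<close> is a set of pairs \<open>(Y, f)\<close> with \<open>f : Y \<rightarrow> X\<close>.\<close>

definition is_sieve :: "('o, 'm) cat \<Rightarrow> 'o \<Rightarrow> ('o \<times> 'm) set \<Rightarrow> bool" where
  "is_sieve C X S \<longleftrightarrow>
     (\<forall>(Y, f)\<in>S. Y \<in> Ob C \<and> f \<in> Hom C Y X \<and>
        (\<forall>Z\<in>Ob C. \<forall>g\<in>Hom C Z Y. (Z, Cmp C Z Y X f g) \<in> S))"

text \<open>A presheaf \<open>P\<close> on \<open>C\<close> is a functor on the opposite category, so restriction along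
  \<open>g : Z \<rightarrow> Y\<close> is \<open>fmap P Y Z g\<close>.\<close>

definition matching_family ::
  "('o, 'm) cat \<Rightarrow> ('o, 'm, 'u) presheaf \<Rightarrow> 'o \<Rightarrow> ('o \<times> 'm) set \<Rightarrow> ('o \<Rightarrow> 'm \<Rightarrow> 'u) \<Rightarrow> bool" where
  "matching_family C P X S x \<longleftrightarrow>
     (\<forall>(Y, f)\<in>S. x Y f \<in> fob P Y \<and>
        (\<forall>Z\<in>Ob C. \<forall>g\<in>Hom C Z Y. fmap P Y Z g (x Y f) = x Z (Cmp C Z Y X f g)))"

definition is_sheaf ::
  "('o, 'm) cat \<Rightarrow> ('o \<Rightarrow> ('o \<times> 'm) set set) \<Rightarrow> ('o, 'm, 'u) presheaf \<Rightarrow> bool" where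
  "is_sheaf C J P \<longleftrightarrow>
     (\<forall>X\<in>Ob C. \<forall>S\<in>J X. \<forall>x. matching_family C P X S x \<longrightarrow>
        (\<exists>!y. y \<in> fob P X \<and> (\<forall>(Y, f)\<in>S. fmap P X Y f y = x Y f)))"

definition sheaf_cat ::
  "('o, 'm) cat \<Rightarrow> ('o \<Rightarrow> ('o \<times> 'm) set set)
    \<Rightarrow> (('o, 'm, 'u) presheaf, 'o \<Rightarrow> 'u \<Rightarrow> 'u) cat" where
  "sheaf_cat C J = full_subcat (presheaf_cat C) {P. is_sheaf C J P}"


section \<open>Geometric logic over the signature of MV-algebras\<close>

datatype tm = Var nat | Zero | Neg tm | Plus tm tm

text \<open>De Bruijn indices: \<open>Ex\<close> binds \<open>Var 0\<close> of its body. \<open>Disj I f\<close> is the disjunction of the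
  family \<open>(f i)\<^sub>i\<^sub>\<in>\<^sub>I\<close>; the values of \<open>f\<close> outside \<open>I\<close> are irrelevant. The index type \<open>'i\<close> is an
  arbitrary infinite type, bounding the size of disjunctions. Since the signature
  is countable, every geometric formula is provably equivalent to a countable disjunction,
  and so the syntactic site depends on \<open>'i\<close> only up to equivalence.\<close>

datatype 'i fm = Eq tm tm | Top | And "'i fm" "'i fm" | Disj "'i set" "'i \<Rightarrow> 'i fm" | Ex "'i fm"

primrec tm_in :: "nat \<Rightarrow> tm \<Rightarrow> bool" where
  "tm_in n (Var k) \<longleftrightarrow> k < n"
| "tm_in n Zero \<longleftrightarrow> True"
| "tm_in n (Neg t) \<longleftrightarrow> tm_in n t"
| "tm_in n (Plus s t) \<longleftrightarrow> tm_in n s \<and> tm_in n t"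

primrec fm_in :: "'i fm \<Rightarrow> nat \<Rightarrow> bool" where
  "fm_in (Eq s t) n \<longleftrightarrow> tm_in n s \<and> tm_in n t"
| "fm_in Top n \<longleftrightarrow> True"
| "fm_in (And \<phi> \<psi>) n \<longleftrightarrow> fm_in \<phi> n \<and> fm_in \<psi> n"
| "fm_in (Disj I f) n \<longleftrightarrow> (\<forall>i\<in>I. fm_in (f i) n)"
| "fm_in (Ex \<phi>) n \<longleftrightarrow> fm_in \<phi> (Suc n)"

primrec tm_subst :: "(nat \<Rightarrow> tm) \<Rightarrow> tm \<Rightarrow> tm" where
  "tm_subst \<sigma> (Var k) = \<sigma> k"
| "tm_subst \<sigma> Zero = Zero"
| "tm_subst \<sigma> (Neg t) = Neg (tm_subst \<sigma> t)"
| "tm_subst \<sigma> (Plus s t) = Plus (tm_subst \<sigma> s) (tm_subst \<sigma> t)"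

definition lift_subst :: "(nat \<Rightarrow> tm) \<Rightarrow> nat \<Rightarrow> tm" where
  "lift_subst \<sigma> = case_nat (Var 0) (\<lambda>k. tm_subst (\<lambda>j. Var (Suc j)) (\<sigma> k))"

primrec fm_subst :: "'i fm \<Rightarrow> (nat \<Rightarrow> tm) \<Rightarrow> 'i fm" where
  "fm_subst (Eq s t) \<sigma> = Eq (tm_subst \<sigma> s) (tm_subst \<sigma> t)"
| "fm_subst Top \<sigma> = Top"
| "fm_subst (And \<phi> \<psi>) \<sigma> = And (fm_subst \<phi> \<sigma>) (fm_subst \<psi> \<sigma>)"
| "fm_subst (Disj I f) \<sigma> = Disj I (\<lambda>i. fm_subst (f i) \<sigma>)"
| "fm_subst (Ex \<phi>) \<sigma> = Ex (fm_subst \<phi> (lift_subst \<sigma>))"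

definition fm_rename :: "(nat \<Rightarrow> nat) \<Rightarrow> 'i fm \<Rightarrow> 'i fm" where
  "fm_rename r \<phi> = fm_subst \<phi> (\<lambda>k. Var (r k))"

definition fm_shift :: "'i fm \<Rightarrow> 'i fm" where
  "fm_shift = fm_rename Suc"

definition fm_inst :: "'i fm \<Rightarrow> tm \<Rightarrow> 'i fm" where
  "fm_inst \<phi> t = fm_subst \<phi> (case_nat t Var)"

definition Conj :: "'i fm list \<Rightarrow> 'i fm" where
  "Conj \<phi>s = foldr And \<phi>s Top"

definition Exs :: "nat \<Rightarrow> 'i fm \<Rightarrow> 'i fm" where
  "Exs m \<phi> = (Ex ^^ m) \<phi>"

text \<open>Disjunctions indexed by natural numbers, through an arbitrary injection of the natural
  numbers into \<open>'i\<close>.\<close>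

definition nat_idx :: "nat \<Rightarrow> 'i::infinite" where
  "nat_idx = (SOME e. inj e)"

definition nDisj :: "nat set \<Rightarrow> (nat \<Rightarrow> 'i::infinite fm) \<Rightarrow> 'i fm" where
  "nDisj K f = Disj (nat_idx ` K) (\<lambda>i. f (inv nat_idx i))"

definition Or :: "'i::infinite fm \<Rightarrow> 'i fm \<Rightarrow> 'i fm" where
  "Or \<phi> \<psi> = nDisj {0, 1} (\<lambda>k. if k = 0 then \<phi> else \<psi>)"

text \<open>The sequent \<open>\<phi> \<turnstile> \<psi>\<close> in the context of the variables \<open>Var 0, \<dots>, Var (n - 1)\<close> is the triple
  \<open>(n, \<phi>, \<psi>)\<close>. A geometric theory is a set of (well-formed) sequents.\<close>

type_synonym 'i geom_theory = "(nat \<times> 'i fm \<times> 'i fm) set"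

inductive prv :: "'i geom_theory \<Rightarrow> nat \<Rightarrow> 'i fm \<Rightarrow> 'i fm \<Rightarrow> bool" for T where
  Axiom: "\<lbrakk>(n, \<phi>, \<psi>) \<in> T; fm_in \<phi> n; fm_in \<psi> n\<rbrakk> \<Longrightarrow> prv T n \<phi> \<psi>"
| Ident: "fm_in \<phi> n \<Longrightarrow> prv T n \<phi> \<phi>"
| Subst: "\<lbrakk>prv T n \<phi> \<psi>; \<forall>k<n. tm_in m (\<sigma> k)\<rbrakk> \<Longrightarrow> prv T m (fm_subst \<phi> \<sigma>) (fm_subst \<psi> \<sigma>)"
| Cut: "\<lbrakk>prv T n \<phi> \<psi>; prv T n \<psi> \<chi>\<rbrakk> \<Longrightarrow> prv T n \<phi> \<chi>"
| EqRefl: "tm_in n t \<Longrightarrow> prv T n Top (Eq t t)"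
| EqSubst: "\<lbrakk>tm_in n s; tm_in n t; fm_in \<phi> (Suc n)\<rbrakk>
    \<Longrightarrow> prv T n (And (Eq s t) (fm_inst \<phi> s)) (fm_inst \<phi> t)"
| TopI: "fm_in \<phi> n \<Longrightarrow> prv T n \<phi> Top"
| AndE1: "\<lbrakk>fm_in \<phi> n; fm_in \<psi> n\<rbrakk> \<Longrightarrow> prv T n (And \<phi> \<psi>) \<phi>"
| AndE2: "\<lbrakk>fm_in \<phi> n; fm_in \<psi> n\<rbrakk> \<Longrightarrow> prv T n (And \<phi> \<psi>) \<psi>"
| AndI: "\<lbrakk>prv T n \<phi> \<psi>; prv T n \<phi> \<chi>\<rbrakk> \<Longrightarrow> prv T n \<phi> (And \<psi> \<chi>)"
| DisjI: "\<lbrakk>fm_in (Disj I f) n; i \<in> I\<rbrakk> \<Longrightarrow> prv T n (f i) (Disj I f)"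
| DisjE: "\<lbrakk>\<forall>i\<in>I. prv T n (f i) \<chi>; fm_in \<chi> n\<rbrakk> \<Longrightarrow> prv T n (Disj I f) \<chi>"
| ExI: "\<lbrakk>prv T n (Ex \<phi>) \<psi>; fm_in \<psi> n\<rbrakk> \<Longrightarrow> prv T (Suc n) \<phi> (fm_shift \<psi>)"
| ExE: "\<lbrakk>prv T (Suc n) \<phi> (fm_shift \<psi>); fm_in \<psi> n\<rbrakk> \<Longrightarrow> prv T n (Ex \<phi>) \<psi>"
| Distrib: "\<lbrakk>fm_in \<phi> n; fm_in (Disj I f) n\<rbrakk>
    \<Longrightarrow> prv T n (And \<phi> (Disj I f)) (Disj I (\<lambda>i. And \<phi> (f i)))"
| Frobenius: "\<lbrakk>fm_in \<phi> n; fm_in (Ex \<psi>) n\<rbrakk>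
    \<Longrightarrow> prv T n (And \<phi> (Ex \<psi>)) (Ex (And (fm_shift \<phi>) \<psi>))"


section \<open>The syntactic site and the classifying topos\<close>

text \<open>The object \<open>(n, \<phi>)\<close> is the formula-in-context \<open>{x\<^sub>0, \<dots>, x\<^sub>n\<^sub>-\<^sub>1. \<phi>}\<close>; as these are taken up to
  renaming of the context, we may use canonical variables.

  An arrow \<open>(n, \<phi>) \<rightarrow> (m, \<psi>)\<close> is represented by a formula \<open>\<theta>(x, y)\<close> in context \<open>m + n\<close>, where
  \<open>y\<close> is \<open>Var 0, \<dots>, Var (m - 1)\<close> and \<open>x\<close> is \<open>Var m, \<dots>, Var (m + n - 1)\<close>, so that \<open>\<exists>y. \<theta>\<close> is
  \<open>Exs m \<theta>\<close>. In the third clause of \<open>functional\<close>, the context is \<open>y, z, x\<close>, and the two formulas are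
  \<open>\<theta>(x, y)\<close> and \<open>\<theta>(x, z)\<close>. In \<open>arr_comp\<close>, the context under the quantifiers is \<open>y, z, x\<close> and
  the formulas are \<open>\<theta>(x, y)\<close> and \<open>\<gamma>(y, z)\<close>.\<close>

definition functional ::
  "'i geom_theory \<Rightarrow> nat \<times> 'i fm \<Rightarrow> nat \<times> 'i fm \<Rightarrow> 'i fm \<Rightarrow> bool" where
  "functional T = (\<lambda>(n, \<phi>) (m, \<psi>) \<theta>.
     fm_in \<theta> (m + n) \<and>
     prv T n \<phi> (Exs m \<theta>) \<and>
     prv T (m + n) \<theta> (And (fm_rename (\<lambda>j. m + j) \<phi>) \<psi>) \<and>
     prv T (m + m + n)
       (And (fm_rename (\<lambda>j. if j < m then j else m + j) \<theta>) (fm_rename (\<lambda>j. m + j) \<theta>))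
       (Conj (map (\<lambda>j. Eq (Var j) (Var (m + j))) [0..<m])))"

definition arr_class ::
  "'i geom_theory \<Rightarrow> nat \<times> 'i fm \<Rightarrow> nat \<times> 'i fm \<Rightarrow> 'i fm \<Rightarrow> 'i fm set" where
  "arr_class T A B \<theta> = {\<theta>'. functional T A B \<theta>' \<and>
     prv T (fst B + fst A) \<theta> \<theta>' \<and> prv T (fst B + fst A) \<theta>' \<theta>}"

definition arr_id :: "nat \<times> 'i fm \<Rightarrow> 'i fm" where
  "arr_id = (\<lambda>(n, \<phi>).
     And (fm_rename (\<lambda>j. n + j) \<phi>) (Conj (map (\<lambda>j. Eq (Var (n + j)) (Var j)) [0..<n])))"

definition arr_comp :: "nat \<Rightarrow> nat \<Rightarrow> 'i fm \<Rightarrow> 'i fm \<Rightarrow> 'i fm" where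
  "arr_comp m k \<gamma> \<theta> = Exs m (And
     (fm_rename (\<lambda>j. if j < m then j else j + k) \<theta>)
     (fm_rename (\<lambda>j. if j < k then m + j else j - k) \<gamma>))"

definition syn_cat :: "'i geom_theory \<Rightarrow> (nat \<times> 'i fm, 'i fm set) cat" where
  "syn_cat T = \<lparr>
     Ob = {(n, \<phi>). fm_in \<phi> n},
     Hom = (\<lambda>A B. {arr_class T A B \<theta> | \<theta>. functional T A B \<theta>}),
     Idn = (\<lambda>A. arr_class T A A (arr_id A)),
     Cmp = (\<lambda>A B C g f. arr_class T A C
       (arr_comp (fst B) (fst C) (SOME \<gamma>. \<gamma> \<in> g) (SOME \<theta>. \<theta> \<in> f)))\<rparr>"

text \<open>The syntactic topology \<open>J\<^sub>T\<close>: a sieve on \<open>{y. \<psi>}\<close> covers iff it contains arrows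
  \<open>[\<theta>\<^sub>i] : {x\<^sub>i. \<phi>\<^sub>i} \<rightarrow> {y. \<psi>}\<close> (\<open>i \<in> I\<close>) such that \<open>\<psi> \<turnstile> \<Or>\<^sub>i \<exists>x\<^sub>i. \<theta>\<^sub>i\<close> is provable. As \<open>Exs\<close> binds the
  innermost variables, \<open>x\<^sub>i\<close> and \<open>y\<close> have to be exchanged in \<open>\<theta>\<^sub>i\<close>.\<close>

definition arr_image :: "nat \<Rightarrow> nat \<Rightarrow> 'i fm \<Rightarrow> 'i fm" where
  "arr_image n m \<theta> = Exs n (fm_rename (\<lambda>j. if j < m then n + j else j - m) \<theta>)"

definition syn_cov ::
  "'i geom_theory \<Rightarrow> nat \<times> 'i fm \<Rightarrow> ((nat \<times> 'i fm) \<times> 'i fm set) set set" where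
  "syn_cov T B = {S. is_sieve (syn_cat T) B S \<and>
     (\<exists>I A \<theta>. (\<forall>i\<in>I. A i \<in> Ob (syn_cat T) \<and> functional T (A i) B (\<theta> i) \<and>
          (A i, arr_class T (A i) B (\<theta> i)) \<in> S) \<and>
        prv T (fst B) (snd B) (Disj I (\<lambda>i. arr_image (fst (A i)) (fst B) (\<theta> i))))}"

definition classifying_topos ::
  "'i geom_theory \<Rightarrow>
    ((nat \<times> 'i fm, 'i fm set, 'u) presheaf, nat \<times> 'i fm \<Rightarrow> 'u \<Rightarrow> 'u) cat" where
  "classifying_topos T = sheaf_cat (syn_cat T) (syn_cov T)"

text \<open>Both toposes are formed relative to the universe \<open>'u\<close>; this is meaningful when the syntactic
  site is small, i.e. when there are fewer formulas than elements of \<open>'u\<close>.\<close>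

definition presheaf_type :: "'u itself \<Rightarrow> 'i geom_theory \<Rightarrow> bool" where
  "presheaf_type _ T \<longleftrightarrow>
     (\<exists>C :: ('u, 'u) cat. small_category C \<and>
        equivalent_cats
          (classifying_topos T :: ((nat \<times> 'i fm, 'i fm set, 'u) presheaf, _) cat)
          (presheaf_cat C :: (('u, 'u, 'u) presheaf, _) cat))"


section \<open>The theories of MV-algebras and of simple MV-algebras\<close>

definition One :: tm where
  "One = Neg Zero"

primrec nmult :: "nat \<Rightarrow> tm \<Rightarrow> tm" where
  "nmult 0 t = Zero"
| "nmult (Suc n) t = Plus t (nmult n t)"

definition MV :: "'i geom_theory" where
  "MV = (let x = Var 0; y = Var 1; z = Var 2 in
    {(3, Top, Eq (Plus x (Plus y z)) (Plus (Plus x y) z)),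
     (2, Top, Eq (Plus x y) (Plus y x)),
     (1, Top, Eq (Plus x Zero) x),
     (1, Top, Eq (Neg (Neg x)) x),
     (1, Top, Eq (Plus x (Neg Zero)) (Neg Zero)),
     (2, Top, Eq (Plus (Neg (Plus (Neg x) y)) y) (Plus (Neg (Plus (Neg y) x)) x))})"

definition Simple :: "'i::infinite geom_theory" where
  "Simple = MV \<union>
    {(1, Top, nDisj UNIV (\<lambda>n. Or (Eq (Var 0) Zero) (Eq (nmult n (Var 0)) One)))}"

end

theory Submission
  imports Defs Complex_Main "HOL-Library.Countable_Set"
begin

text \<open>
  Call an object \<open>X\<close> of a category irreducible if every map from \<open>X\<close> to the target of a countable jointly epic
  family factors through a member of the family. In a category of presheaves jointly epic families are jointly
  surjective, so that representables are irreducible by the Yoneda lemma; and distinct parallel maps differ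
  at some element, that is, on some representable. The property that distinct parallel maps are
  separated by maps from irreducible objects is invariant under equivalence
  (\<open>separated_by_irreducibles_equivalent\<close>, \<open>presheaf_cat_separated_by_irreducibles\<close>), and the proof consists
  in showing that the classifying topos of simple MV-algebras does not have it
  (\<open>not_separated_by_irreducibles\<close>).

  Consider the simple MV-algebra \<open>M\<close> of all numbers \<open>p + q sqrt 2\<close> in \<open>[0, 1]\<close> with rational \<open>p\<close> and \<open>q\<close>. A
  formula-in-context \<open>A\<close> has a set of points, its solutions in \<open>M\<close>, and by soundness every arrow of the syntactic category
  acts on points, and covers are jointly surjective on points. Hence the functions from the points of \<open>A\<close> to \<open>M\<close> form a
  sheaf \<open>F\<close> in \<open>A\<close>, the direct image of \<open>M\<close> under the corresponding point of the topos. Let \<open>V\<close> be the subsheaf generated by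
  the identity function \<open>x\<close> of \<open>M\<close>, which is a section over \<open>{x. Top}\<close>.

  For every term \<open>t\<close> in one variable, the axiom of simple MV-algebras at \<open>t(x)\<close> says that the subsheaves of \<open>V\<close> given by
  \<open>t = 0\<close> and by \<open>n t = 1\<close> for the various \<open>n\<close> are jointly epic (\<open>cases_jointly_epic\<close>). A map from an irreducible object
  to \<open>V\<close> factors through one of them. So if a function \<open>k\<close> from the points of some \<open>A\<close> to \<open>M\<close> is the image of an element of an
  irreducible object, then \<open>t(k)\<close> vanishes everywhere or nowhere. Since terms separate the elements of \<open>M\<close>
  (\<open>separating_term\<close>), \<open>k\<close> is constant.

  On the other hand, for small rational \<open>\<epsilon>\<close> the map \<open>p + q sqrt 2 \<mapsto> p + q sqrt 2 + q \<epsilon>\<close> is additive, fixes 1, and hardly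
  moves finitely many given elements. Therefore it preserves the truth of any given geometric formula at
  given elements once \<open>\<epsilon>\<close> is small enough, and it commutes with the functions in \<open>V\<close>
  (\<open>eventually_sat_shear\<close>, \<open>generated_shear\<close>). If \<open>k\<close> takes the irrational value \<open>sqrt 2 - 1\<close>, then at a nearby point it
  takes the value \<open>sqrt 2 - 1 + \<epsilon>\<close>, so it is not constant. Consequently no such \<open>k\<close> takes the value \<open>sqrt 2 - 1\<close>. The two
  maps from \<open>V\<close> to \<open>F\<close> that compose a function with the characteristic function of this value and with 0 are thus
  not separated by irreducible objects, although they differ at \<open>x\<close>.

  The sheaves involved are small because \<open>M\<close> is countable: there are at most as many functions on points as sets of
  natural numbers, and these are encoded by formulas. The syntactic site enters through few derivations:
  composites of functional formulas are functional, fibre products exist as far as the gluing of functions requires, and the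
  axiom of simple MV-algebras yields a covering sieve.
\<close>

section \<open>Irreducible objects and equivalences of categories\<close>

lemma category_compI:
  "\<lbrakk>category C; X \<in> Ob C; Y \<in> Ob C; Z \<in> Ob C; f \<in> Hom C X Y; g \<in> Hom C Y Z\<rbrakk>
    \<Longrightarrow> Cmp C X Y Z g f \<in> Hom C X Z"
  by (simp add: category_def)

lemma category_idnI: "\<lbrakk>category C; X \<in> Ob C\<rbrakk> \<Longrightarrow> Idn C X \<in> Hom C X X"
  by (simp add: category_def)

lemma category_idn_right:
  "\<lbrakk>category C; X \<in> Ob C; Y \<in> Ob C; f \<in> Hom C X Y\<rbrakk> \<Longrightarrow> Cmp C X X Y f (Idn C X) = f"
  by (simp add: category_def)

lemma category_idn_left:
  "\<lbrakk>category C; X \<in> Ob C; Y \<in> Ob C; f \<in> Hom C X Y\<rbrakk> \<Longrightarrow> Cmp C X Y Y (Idn C Y) f = f"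
  by (simp add: category_def)

lemma category_assoc:
  "\<lbrakk>category C; W \<in> Ob C; X \<in> Ob C; Y \<in> Ob C; Z \<in> Ob C;
    f \<in> Hom C W X; g \<in> Hom C X Y; h \<in> Hom C Y Z\<rbrakk>
    \<Longrightarrow> Cmp C W Y Z h (Cmp C W X Y g f) = Cmp C W X Z (Cmp C X Y Z h g) f"
  by (simp add: category_def)

lemmas category_rules =
  category_compI category_idnI category_idn_right category_idn_left category_assoc

lemma is_funcD:
  assumes "is_func C D F"
  shows func_ob: "X \<in> Ob C \<Longrightarrow> fob F X \<in> Ob D"
    and func_hom: "\<lbrakk>X \<in> Ob C; Y \<in> Ob C; f \<in> Hom C X Y\<rbrakk>
      \<Longrightarrow> fmap F X Y f \<in> Hom D (fob F X) (fob F Y)"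
    and func_idn: "X \<in> Ob C \<Longrightarrow> fmap F X X (Idn C X) = Idn D (fob F X)"
    and func_comp: "\<lbrakk>X \<in> Ob C; Y \<in> Ob C; Z \<in> Ob C; f \<in> Hom C X Y; g \<in> Hom C Y Z\<rbrakk>
      \<Longrightarrow> fmap F X Z (Cmp C X Y Z g f) =
        Cmp D (fob F X) (fob F Y) (fob F Z) (fmap F Y Z g) (fmap F X Y f)"
  using assms by (simp_all add: is_func_def)

definition jointly_epic :: "('o, 'm) cat \<Rightarrow> 'o \<Rightarrow> (nat \<Rightarrow> 'o) \<Rightarrow> (nat \<Rightarrow> 'm) \<Rightarrow> bool" where
  "jointly_epic C V W i \<longleftrightarrow>
     V \<in> Ob C \<and> (\<forall>j. W j \<in> Ob C \<and> i j \<in> Hom C (W j) V) \<and>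
     (\<forall>Z\<in>Ob C. \<forall>p\<in>Hom C V Z. \<forall>q\<in>Hom C V Z.
        (\<forall>j. Cmp C (W j) V Z p (i j) = Cmp C (W j) V Z q (i j)) \<longrightarrow> p = q)"

text \<open>Indecomposable projective objects of a topos have this property. Countable families suffice here,
  because the axiom of simple MV-algebras is a countable disjunction.\<close>

definition irreducible_object :: "('o, 'm) cat \<Rightarrow> 'o \<Rightarrow> bool" where
  "irreducible_object C X \<longleftrightarrow>
     X \<in> Ob C \<and>
     (\<forall>V W i m. jointly_epic C V W i \<longrightarrow> m \<in> Hom C X V \<longrightarrow>
        (\<exists>j. \<exists>g\<in>Hom C X (W j). Cmp C X (W j) V (i j) g = m))"

definition separated_by_irreducibles :: "('o, 'm) cat \<Rightarrow> bool" where
  "separated_by_irreducibles C \<longleftrightarrow>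
     (\<forall>V\<in>Ob C. \<forall>Z\<in>Ob C. \<forall>u\<in>Hom C V Z. \<forall>v\<in>Hom C V Z. u \<noteq> v \<longrightarrow>
        (\<exists>X. irreducible_object C X \<and> (\<exists>m\<in>Hom C X V. Cmp C X V Z u m \<noteq> Cmp C X V Z v m)))"

text \<open>An equivalence of categories with the inverses \<open>\<eta>'\<close> and \<open>\<epsilon>'\<close> of its unit and counit made explicit.\<close>

locale category_equivalence =
  fixes D :: "('o, 'm) cat" and K :: "('p, 'n) cat"
    and F :: "('o, 'm, 'p, 'n) func" and G :: "('p, 'n, 'o, 'm) func"
    and \<eta> \<eta>' :: "'o \<Rightarrow> 'm" and \<epsilon> \<epsilon>' :: "'p \<Rightarrow> 'n"
  assumes D: "category D" and K: "category K"
    and F: "is_func D K F" and G: "is_func K D G"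
    and eta: "\<And>X. X \<in> Ob D \<Longrightarrow> \<eta> X \<in> Hom D X (fob G (fob F X))"
    and eta': "\<And>X. X \<in> Ob D \<Longrightarrow> \<eta>' X \<in> Hom D (fob G (fob F X)) X"
    and eta'_eta: "\<And>X. X \<in> Ob D \<Longrightarrow>
      Cmp D X (fob G (fob F X)) X (\<eta>' X) (\<eta> X) = Idn D X"
    and eta_eta': "\<And>X. X \<in> Ob D \<Longrightarrow>
      Cmp D (fob G (fob F X)) X (fob G (fob F X)) (\<eta> X) (\<eta>' X) = Idn D (fob G (fob F X))"
    and eta_nat: "\<And>X Y f. \<lbrakk>X \<in> Ob D; Y \<in> Ob D; f \<in> Hom D X Y\<rbrakk> \<Longrightarrow>
      Cmp D X Y (fob G (fob F Y)) (\<eta> Y) f =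
      Cmp D X (fob G (fob F X)) (fob G (fob F Y))
        (fmap G (fob F X) (fob F Y) (fmap F X Y f)) (\<eta> X)"
    and eps: "\<And>X. X \<in> Ob K \<Longrightarrow> \<epsilon> X \<in> Hom K (fob F (fob G X)) X"
    and eps': "\<And>X. X \<in> Ob K \<Longrightarrow> \<epsilon>' X \<in> Hom K X (fob F (fob G X))"
    and eps'_eps: "\<And>X. X \<in> Ob K \<Longrightarrow>
      Cmp K (fob F (fob G X)) X (fob F (fob G X)) (\<epsilon>' X) (\<epsilon> X) = Idn K (fob F (fob G X))"
    and eps_eps': "\<And>X. X \<in> Ob K \<Longrightarrow>
      Cmp K X (fob F (fob G X)) X (\<epsilon> X) (\<epsilon>' X) = Idn K X"
    and eps_nat: "\<And>X Y f. \<lbrakk>X \<in> Ob K; Y \<in> Ob K; f \<in> Hom K X Y\<rbrakk> \<Longrightarrow>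
      Cmp K (fob F (fob G X)) (fob F (fob G Y)) Y (\<epsilon> Y)
        (fmap F (fob G X) (fob G Y) (fmap G X Y f)) =
      Cmp K (fob F (fob G X)) X Y f (\<epsilon> X)"

lemma equivalent_cats_obtain:
  assumes "equivalent_cats D K" "category D" "category K"
  obtains F G \<eta> \<eta>' \<epsilon> \<epsilon>' where "category_equivalence D K F G \<eta> \<eta>' \<epsilon> \<epsilon>'"
proof -
  from assms obtain F G \<eta> \<epsilon> where F: "is_func D K F" and G: "is_func K D G"
    and n: "nat_iso D D id_func (comp_func G F) \<eta>" and e: "nat_iso K K (comp_func F G) id_func \<epsilon>"
    by (auto simp: equivalent_cats_def)
  have "\<forall>X\<in>Ob D. \<exists>g. g \<in> Hom D (fob G (fob F X)) X \<and>
      Cmp D X (fob G (fob F X)) X g (\<eta> X) = Idn D X \<and>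
      Cmp D (fob G (fob F X)) X (fob G (fob F X)) (\<eta> X) g = Idn D (fob G (fob F X))"
    using n by (auto simp: nat_iso_def is_iso_def id_func_def comp_func_def Bex_def)
  then obtain \<eta>' where n': "\<forall>X\<in>Ob D. \<eta>' X \<in> Hom D (fob G (fob F X)) X \<and>
      Cmp D X (fob G (fob F X)) X (\<eta>' X) (\<eta> X) = Idn D X \<and>
      Cmp D (fob G (fob F X)) X (fob G (fob F X)) (\<eta> X) (\<eta>' X) = Idn D (fob G (fob F X))"
    by metis
  have "\<forall>X\<in>Ob K. \<exists>g. g \<in> Hom K X (fob F (fob G X)) \<and>
      Cmp K (fob F (fob G X)) X (fob F (fob G X)) g (\<epsilon> X) = Idn K (fob F (fob G X)) \<and>
      Cmp K X (fob F (fob G X)) X (\<epsilon> X) g = Idn K X"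
    using e by (auto simp: nat_iso_def is_iso_def id_func_def comp_func_def Bex_def)
  then obtain \<epsilon>' where e': "\<forall>X\<in>Ob K. \<epsilon>' X \<in> Hom K X (fob F (fob G X)) \<and>
      Cmp K (fob F (fob G X)) X (fob F (fob G X)) (\<epsilon>' X) (\<epsilon> X) = Idn K (fob F (fob G X)) \<and>
      Cmp K X (fob F (fob G X)) X (\<epsilon> X) (\<epsilon>' X) = Idn K X"
    by metis
  have "category_equivalence D K F G \<eta> \<eta>' \<epsilon> \<epsilon>'"
    using assms(2,3) F G n e n' e'
    by unfold_locales (auto simp: nat_iso_def nat_trans_def id_func_def comp_func_def)
  then show ?thesis by (rule that)
qed

context category_equivalence
begin

lemmas D_rules = category_rules[OF D]
lemmas K_rules = category_rules[OF K]
lemmas F_rules = is_funcD[OF F]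
lemmas G_rules = is_funcD[OF G]

lemma F_faithful:
  assumes ob: "X \<in> Ob D" "Y \<in> Ob D" and u: "u \<in> Hom D X Y" and v: "v \<in> Hom D X Y"
    and eq: "fmap F X Y u = fmap F X Y v"
  shows "u = v"
proof -
  have "w = Cmp D X (fob G (fob F Y)) Y (\<eta>' Y)
      (Cmp D X (fob G (fob F X)) (fob G (fob F Y))
        (fmap G (fob F X) (fob F Y) (fmap F X Y w)) (\<eta> X))" if w: "w \<in> Hom D X Y" for w
    using ob w by (simp add: eta_nat[symmetric] D_rules F_rules G_rules eta eta' eta'_eta)
  from this[OF u] this[OF v] eq show ?thesis by metis
qed

lemma G_faithful:
  assumes ob: "X \<in> Ob K" "Y \<in> Ob K" and u: "u \<in> Hom K X Y" and v: "v \<in> Hom K X Y"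
    and eq: "fmap G X Y u = fmap G X Y v"
  shows "u = v"
proof -
  have "w = Cmp K X (fob F (fob G X)) Y
      (Cmp K (fob F (fob G X)) (fob F (fob G Y)) Y (\<epsilon> Y)
        (fmap F (fob G X) (fob G Y) (fmap G X Y w))) (\<epsilon>' X)" if w: "w \<in> Hom K X Y" for w
    using ob w
    by (simp add: eps_nat category_assoc[OF K, symmetric] K_rules(1-4) F_rules G_rules eps eps' eps_eps')
  from this[OF u] this[OF v] eq show ?thesis by metis
qed

text \<open>A map out of \<open>F V\<close> is determined by its transpose, obtained by applying \<open>G\<close> and composing with the
  unit \<open>\<eta> V\<close>; the transposes are maps out of \<open>V\<close>, to which the hypothesis applies.\<close>

lemma F_jointly_epic:
  assumes je: "jointly_epic D V W i"
  shows "jointly_epic K (fob F V) (\<lambda>j. fob F (W j)) (\<lambda>j. fmap F (W j) V (i j))"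
  unfolding jointly_epic_def
proof (intro conjI allI ballI impI)
  have V: "V \<in> Ob D" and W: "\<And>j. W j \<in> Ob D" and i: "\<And>j. i j \<in> Hom D (W j) V"
    using je by (auto simp: jointly_epic_def)
  show "fob F V \<in> Ob K" and "fob F (W j) \<in> Ob K"
    and "fmap F (W j) V (i j) \<in> Hom K (fob F (W j)) (fob F V)" for j
    using V W i by (auto simp: F_rules)
  fix Z p q
  assume Z: "Z \<in> Ob K" and p: "p \<in> Hom K (fob F V) Z" and q: "q \<in> Hom K (fob F V) Z"
    and eq: "\<forall>j. Cmp K (fob F (W j)) (fob F V) Z p (fmap F (W j) V (i j)) =
      Cmp K (fob F (W j)) (fob F V) Z q (fmap F (W j) V (i j))"
  let ?a = "\<lambda>r. Cmp D V (fob G (fob F V)) (fob G Z) (fmap G (fob F V) Z r) (\<eta> V)"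
  have a: "?a r \<in> Hom D V (fob G Z)" if "r \<in> Hom K (fob F V) Z" for r
    using that V Z by (simp add: D_rules F_rules G_rules eta)
  have ai: "Cmp D (W j) V (fob G Z) (?a r) (i j) =
      Cmp D (W j) (fob G (fob F (W j))) (fob G Z)
        (fmap G (fob F (W j)) Z (Cmp K (fob F (W j)) (fob F V) Z r (fmap F (W j) V (i j))))
        (\<eta> (W j))" if "r \<in> Hom K (fob F V) Z" for r j
  proof -
    have "Cmp D (W j) V (fob G Z) (?a r) (i j) =
        Cmp D (W j) (fob G (fob F V)) (fob G Z) (fmap G (fob F V) Z r)
          (Cmp D (W j) V (fob G (fob F V)) (\<eta> V) (i j))"
      using that V W i Z by (simp add: category_assoc[OF D] F_rules G_rules eta)
    also have "\<dots> = Cmp D (W j) (fob G (fob F V)) (fob G Z) (fmap G (fob F V) Z r)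
       (Cmp D (W j) (fob G (fob F (W j))) (fob G (fob F V))
        (fmap G (fob F (W j)) (fob F V) (fmap F (W j) V (i j))) (\<eta> (W j)))"
      using V W i by (simp add: eta_nat)
    finally show ?thesis
      using that V W i Z by (simp add: category_assoc[OF D] F_rules G_rules eta)
  qed
  have "?a p = ?a q"
    using je a[OF p] a[OF q] ai[OF p] ai[OF q] eq G_rules(1)[OF Z] by (simp add: jointly_epic_def)
  moreover have "fmap G (fob F V) Z r = Cmp D (fob G (fob F V)) V (fob G Z) (?a r) (\<eta>' V)"
    if "r \<in> Hom K (fob F V) Z" for r
    using that V Z
    by (simp add: category_assoc[OF D, symmetric] D_rules(1-4) F_rules G_rules eta eta' eta_eta')
  ultimately have "fmap G (fob F V) Z p = fmap G (fob F V) Z q"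
    using p q by metis
  then show "p = q"
    using G_faithful[OF _ Z p q] V by (simp add: F_rules)
qed

text \<open>A map \<open>m : G X \<rightarrow> V\<close> is turned into \<open>F m \<circ> \<epsilon>' X : X \<rightarrow> F V\<close>, which factors because \<open>X\<close> is irreducible and
  \<open>F\<close> preserves jointly epic families; the factorization is carried back by \<open>G\<close> and the unit.\<close>

lemma G_irreducible:
  assumes X: "irreducible_object K X"
  shows "irreducible_object D (fob G X)"
  unfolding irreducible_object_def
proof (intro conjI allI impI)
  have XK: "X \<in> Ob K" using X by (simp add: irreducible_object_def)
  show GX: "fob G X \<in> Ob D" using XK by (simp add: G_rules)
  fix V W i m
  assume je: "jointly_epic D V W i" and m: "m \<in> Hom D (fob G X) V"
  have V: "V \<in> Ob D" and W: "\<And>j. W j \<in> Ob D" and i: "\<And>j. i j \<in> Hom D (W j) V"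
    using je by (auto simp: jointly_epic_def)
  \<comment> \<open>No triangle identity relates \<open>\<eta>\<close> and \<open>\<epsilon>\<close>; the automorphism \<open>k\<close> of \<open>G X\<close> is its defect.\<close>
  define k where "k = Cmp D (fob G X) (fob G (fob F (fob G X))) (fob G X)
    (fmap G (fob F (fob G X)) X (\<epsilon> X)) (\<eta> (fob G X))"
  have k: "k \<in> Hom D (fob G X) (fob G X)"
    unfolding k_def using XK by (simp add: D_rules F_rules G_rules eta eps)
  let ?m = "Cmp K X (fob F (fob G X)) (fob F V) (fmap F (fob G X) V m) (\<epsilon>' X)"
  have "?m \<in> Hom K X (fob F V)"
    using XK V m by (simp add: K_rules F_rules G_rules eps')
  then obtain j g where g: "g \<in> Hom K X (fob F (W j))"
    and gm: "Cmp K X (fob F (W j)) (fob F V) (fmap F (W j) V (i j)) g = ?m"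
    using X F_jointly_epic[OF je] unfolding irreducible_object_def by blast
  define g' where "g' = Cmp D (fob G X) (fob G (fob F (W j))) (W j) (\<eta>' (W j))
    (fmap G X (fob F (W j)) g)"
  have Gg: "fmap G X (fob F (W j)) g \<in> Hom D (fob G X) (fob G (fob F (W j)))"
    using g XK W by (simp add: F_rules G_rules)
  have g': "g' \<in> Hom D (fob G X) (W j)"
    unfolding g'_def using Gg XK W by (simp add: D_rules F_rules G_rules eta')
  have obs: "fob G (fob F V) \<in> Ob D" "fob G (fob F (W j)) \<in> Ob D" "fob F (fob G X) \<in> Ob K"
    "fob G (fob F (fob G X)) \<in> Ob D" "fob F V \<in> Ob K" "fob F (W j) \<in> Ob K"
    using V W XK by (simp_all add: F_rules G_rules)
  have eta'_nat: "Cmp D (fob G (fob F (W j))) (W j) V (i j) (\<eta>' (W j)) =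
      Cmp D (fob G (fob F (W j))) (fob G (fob F V)) V (\<eta>' V)
        (fmap G (fob F (W j)) (fob F V) (fmap F (W j) V (i j)))"
  proof -
    let ?Fi = "fmap G (fob F (W j)) (fob F V) (fmap F (W j) V (i j))"
    have Fi: "?Fi \<in> Hom D (fob G (fob F (W j))) (fob G (fob F V))"
      using V W i by (simp add: F_rules G_rules)
    have "Cmp D (fob G (fob F (W j))) (W j) V (i j) (\<eta>' (W j)) =
      Cmp D (fob G (fob F (W j))) (W j) V (Cmp D (W j) (fob G (fob F V)) V (\<eta>' V)
         (Cmp D (W j) V (fob G (fob F V)) (\<eta> V) (i j))) (\<eta>' (W j))"
      using V W i obs by (simp add: D_rules eta eta' eta'_eta)
    also have "\<dots> = Cmp D (fob G (fob F (W j))) (W j) V (Cmp D (W j) (fob G (fob F V)) V (\<eta>' V)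
         (Cmp D (W j) (fob G (fob F (W j))) (fob G (fob F V)) ?Fi (\<eta> (W j)))) (\<eta>' (W j))"
      using V W i by (simp add: eta_nat)
    also have "\<dots> = Cmp D (fob G (fob F (W j))) (fob G (fob F V)) V (\<eta>' V) ?Fi"
      using V W Fi obs
      by (simp add: category_assoc[OF D, symmetric] D_rules(1-4) eta eta' eta_eta')
    finally show ?thesis .
  qed
  have "Cmp D (fob G X) (W j) V (i j) g' =
      Cmp D (fob G X) (fob G (fob F V)) V (\<eta>' V) (fmap G X (fob F V)
        (Cmp K X (fob F (W j)) (fob F V) (fmap F (W j) V (i j)) g))"
    unfolding g'_def using V W i Gg g XK GX obs
    by (simp add: category_assoc[OF D] eta'_nat F_rules G_rules eta')
  also have "\<dots> = Cmp D (fob G X) (fob G (fob F V)) V (\<eta>' V)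
     (Cmp D (fob G X) (fob G (fob F (fob G X))) (fob G (fob F V))
       (fmap G (fob F (fob G X)) (fob F V) (fmap F (fob G X) V m))
       (fmap G X (fob F (fob G X)) (\<epsilon>' X)))"
    using V m XK GX obs by (simp add: gm F_rules G_rules eps')
  finally have ig: "Cmp D (fob G X) (W j) V (i j) g' = \<dots>" .
  have inv: "Cmp D (fob G X) (fob G X) (fob G (fob F (fob G X)))
      (fmap G X (fob F (fob G X)) (\<epsilon>' X)) k = \<eta> (fob G X)"
    unfolding k_def using XK GX obs
    by (simp add: category_assoc[OF D] G_rules(2) eps eps' eta G_rules(4)[symmetric] eps'_eps
        G_rules(3) D_rules(4))
  have "Cmp D (fob G X) (W j) V (i j) (Cmp D (fob G X) (fob G X) (W j) g' k) =
      Cmp D (fob G X) (fob G X) V (Cmp D (fob G X) (W j) V (i j) g') k"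
    using V W i g' k GX by (simp add: category_assoc[OF D])
  also have "\<dots> = Cmp D (fob G X) (fob G (fob F V)) V (\<eta>' V)
     (Cmp D (fob G X) (fob G (fob F (fob G X))) (fob G (fob F V))
       (fmap G (fob F (fob G X)) (fob F V) (fmap F (fob G X) V m)) (\<eta> (fob G X)))"
    using V m k GX XK obs
    by (simp add: ig category_assoc[OF D, symmetric] inv D_rules(1) F_rules G_rules eps' eta')
  also have "\<dots> = m"
    using V m GX obs by (simp add: eta_nat[symmetric] D_rules eta eta' eta'_eta)
  finally show "\<exists>j. \<exists>g\<in>Hom D (fob G X) (W j). Cmp D (fob G X) (W j) V (i j) g = m"
    using g' k W GX D_rules(1) by blast
qed

text \<open>Distinct maps stay distinct under \<open>F\<close>, are separated there by some irreducible \<open>X\<close>, and hence by the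
  irreducible object \<open>G X\<close>.\<close>

lemma separated_transfer:
  assumes "separated_by_irreducibles K"
  shows "separated_by_irreducibles D"
  unfolding separated_by_irreducibles_def
proof (intro ballI impI)
  fix V Z u v
  assume V: "V \<in> Ob D" and Z: "Z \<in> Ob D" and u: "u \<in> Hom D V Z" and v: "v \<in> Hom D V Z"
    and "u \<noteq> v"
  then have "fmap F V Z u \<noteq> fmap F V Z v" using F_faithful by blast
  then obtain X m where X: "irreducible_object K X" and m: "m \<in> Hom K X (fob F V)"
    and ne: "Cmp K X (fob F V) (fob F Z) (fmap F V Z u) m \<noteq>
      Cmp K X (fob F V) (fob F Z) (fmap F V Z v) m"
    using assms V Z u v F_rules unfolding separated_by_irreducibles_def by meson
  have XK: "X \<in> Ob K" using X by (simp add: irreducible_object_def)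
  have obs: "fob G X \<in> Ob D" "fob G (fob F V) \<in> Ob D" "fob G (fob F Z) \<in> Ob D"
     "fob F V \<in> Ob K" "fob F Z \<in> Ob K"
    using V Z XK by (simp_all add: F_rules G_rules)
  have Gm: "fmap G X (fob F V) m \<in> Hom D (fob G X) (fob G (fob F V))"
    using m XK obs by (simp add: G_rules)
  let ?m = "Cmp D (fob G X) (fob G (fob F V)) V (\<eta>' V) (fmap G X (fob F V) m)"
  have m': "?m \<in> Hom D (fob G X) V"
    using Gm V obs by (simp add: D_rules eta')
  have eq: "fmap G X (fob F Z) (Cmp K X (fob F V) (fob F Z) (fmap F V Z w) m) =
      Cmp D (fob G X) Z (fob G (fob F Z)) (\<eta> Z) (Cmp D (fob G X) V Z w ?m)"
    if w: "w \<in> Hom D V Z" for w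
  proof -
    have Fw: "fmap G (fob F V) (fob F Z) (fmap F V Z w) \<in>
        Hom D (fob G (fob F V)) (fob G (fob F Z))"
      using w V Z by (simp add: F_rules G_rules)
    have "Cmp D (fob G X) Z (fob G (fob F Z)) (\<eta> Z) (Cmp D (fob G X) V Z w ?m) =
        Cmp D (fob G X) V (fob G (fob F Z)) (Cmp D V Z (fob G (fob F Z)) (\<eta> Z) w) ?m"
      using w V Z obs m' by (simp add: category_assoc[OF D] eta)
    also have "\<dots> = Cmp D (fob G X) (fob G (fob F V)) (fob G (fob F Z))
       (fmap G (fob F V) (fob F Z) (fmap F V Z w))
       (Cmp D (fob G X) (fob G (fob F V)) (fob G (fob F V))
         (Cmp D (fob G (fob F V)) V (fob G (fob F V)) (\<eta> V) (\<eta>' V)) (fmap G X (fob F V) m))"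
      using w V Z obs Fw m' Gm
      by (simp add: eta_nat[OF V Z w] category_assoc[OF D, symmetric] D_rules(1) eta eta')
    also have "\<dots> = Cmp D (fob G X) (fob G (fob F V)) (fob G (fob F Z))
       (fmap G (fob F V) (fob F Z) (fmap F V Z w)) (fmap G X (fob F V) m)"
      using V Gm obs by (simp add: eta_eta' D_rules)
    finally show ?thesis using w V Z XK m obs by (simp add: F_rules G_rules)
  qed
  have "Cmp D (fob G X) V Z u ?m \<noteq> Cmp D (fob G X) V Z v ?m"
  proof
    assume "Cmp D (fob G X) V Z u ?m = Cmp D (fob G X) V Z v ?m"
    then have "fmap G X (fob F Z) (Cmp K X (fob F V) (fob F Z) (fmap F V Z u) m) =
      fmap G X (fob F Z) (Cmp K X (fob F V) (fob F Z) (fmap F V Z v) m)"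
      using eq[OF u] eq[OF v] by simp
    then show False
      using ne G_faithful[OF XK obs(5)] m u v V Z XK obs by (simp add: K_rules F_rules)
  qed
  then show "\<exists>X. irreducible_object D X \<and>
      (\<exists>m\<in>Hom D X V. Cmp D X V Z u m \<noteq> Cmp D X V Z v m)"
    using G_irreducible[OF X] m' by blast
qed

end

lemma separated_by_irreducibles_equivalent:
  assumes "equivalent_cats D K" "category D" "category K" "separated_by_irreducibles K"
  shows "separated_by_irreducibles D"
  using assms equivalent_cats_obtain category_equivalence.separated_transfer by metis

section \<open>Presheaves are separated by irreducible objects\<close>

lemma category_set_cat: "category (set_cat :: ('u set, 'u \<Rightarrow> 'u) cat)"
  unfolding category_def set_cat_def
  by (auto simp: PiE_iff compose_def fun_eq_iff extensional_def restrict_def)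

lemma category_functor_cat:
  assumes D: "category D"
  shows "category (functor_cat C D)"
proof -
  note D_rules = category_rules[OF D]
  have idn: "nat_trans C D F F (\<lambda>X\<in>Ob C. Idn D (fob F X))" if "is_func C D F" for F
    using that by (simp add: nat_trans_def is_funcD D_rules)
  have comp: "nat_trans C D F H
      (\<lambda>X\<in>Ob C. Cmp D (fob F X) (fob G X) (fob H X) (\<tau> X) (\<sigma> X))"
    if "is_func C D F" "is_func C D G" "is_func C D H" and s: "nat_trans C D F G \<sigma>"
      and t: "nat_trans C D G H \<tau>" for F G H \<sigma> \<tau>
    unfolding nat_trans_def
  proof (intro conjI ballI)
    note fs = that(1-3)[THEN func_ob] that(1-3)[THEN func_hom]
    have sh: "\<And>X. X \<in> Ob C \<Longrightarrow> \<sigma> X \<in> Hom D (fob F X) (fob G X)"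
      and th: "\<And>X. X \<in> Ob C \<Longrightarrow> \<tau> X \<in> Hom D (fob G X) (fob H X)"
      using s t by (auto simp: nat_trans_def)
    fix X assume X: "X \<in> Ob C"
    then show "(\<lambda>X\<in>Ob C. Cmp D (fob F X) (fob G X) (fob H X) (\<tau> X) (\<sigma> X)) X
      \<in> Hom D (fob F X) (fob H X)"
      by (simp add: D_rules fs sh th)
    fix Y f assume Y: "Y \<in> Ob C" and f: "f \<in> Hom C X Y"
    have "Cmp D (fob F X) (fob F Y) (fob H Y)
        (Cmp D (fob F Y) (fob G Y) (fob H Y) (\<tau> Y) (\<sigma> Y)) (fmap F X Y f) =
       Cmp D (fob F X) (fob G Y) (fob H Y) (\<tau> Y)
        (Cmp D (fob F X) (fob F Y) (fob G Y) (\<sigma> Y) (fmap F X Y f))"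
      using X Y f by (simp add: category_assoc[OF D] fs sh th)
    also have "\<dots> = Cmp D (fob F X) (fob G Y) (fob H Y) (\<tau> Y)
        (Cmp D (fob F X) (fob G X) (fob G Y) (fmap G X Y f) (\<sigma> X))"
      using s X Y f by (simp add: nat_trans_def)
    also have "\<dots> = Cmp D (fob F X) (fob G X) (fob H Y)
        (Cmp D (fob G X) (fob G Y) (fob H Y) (\<tau> Y) (fmap G X Y f)) (\<sigma> X)"
      using X Y f by (simp add: category_assoc[OF D] fs sh th)
    also have "\<dots> = Cmp D (fob F X) (fob G X) (fob H Y)
        (Cmp D (fob G X) (fob H X) (fob H Y) (fmap H X Y f) (\<tau> X)) (\<sigma> X)"
      using t X Y f by (simp add: nat_trans_def)
    also have "\<dots> = Cmp D (fob F X) (fob H X) (fob H Y) (fmap H X Y f)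
        (Cmp D (fob F X) (fob G X) (fob H X) (\<tau> X) (\<sigma> X))"
      using X Y f by (simp add: category_assoc[OF D] fs sh th)
    finally show "Cmp D (fob F X) (fob F Y) (fob H Y)
        ((\<lambda>X\<in>Ob C. Cmp D (fob F X) (fob G X) (fob H X) (\<tau> X) (\<sigma> X)) Y) (fmap F X Y f) =
      Cmp D (fob F X) (fob H X) (fob H Y) (fmap H X Y f)
        ((\<lambda>X\<in>Ob C. Cmp D (fob F X) (fob G X) (fob H X) (\<tau> X) (\<sigma> X)) X)"
      using X Y by simp
  qed simp
  have ext: "\<tau> = (\<lambda>X\<in>Ob C. \<tau> X)" if "nat_trans C D F G \<tau>" for F G \<tau>
    using that by (auto simp: nat_trans_def extensional_restrict)
  have mem: "\<tau> X \<in> Hom D (fob F X) (fob G X)" if "nat_trans C D F G \<tau>" "X \<in> Ob C" for F G \<tau> X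
    using that by (auto simp: nat_trans_def)
  have cong: "(\<lambda>X\<in>Ob C. h X) = \<tau>" if "nat_trans C D F G \<tau>" "\<And>X. X \<in> Ob C \<Longrightarrow> h X = \<tau> X" for F G \<tau> h
    using that by (auto simp: nat_trans_def extensional_def restrict_def)
  show ?thesis
    unfolding category_def functor_cat_def
    apply (simp add: idn comp)
    apply (intro conjI allI impI)
    subgoal by (rule cong, assumption) (simp add: D_rules func_ob mem)
    subgoal by (rule cong, assumption) (simp add: D_rules func_ob mem)
    subgoal by (rule restrict_ext) (simp add: category_assoc[OF D] func_ob mem)
    done
qed

lemma category_full_subcat: "category C \<Longrightarrow> category (full_subcat C S)"
  by (simp add: category_def full_subcat_def)

lemma category_presheaf_cat: "category (presheaf_cat C)"
  unfolding presheaf_cat_def by (intro category_functor_cat category_set_cat)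

lemma category_sheaf_cat: "category (sheaf_cat C J)"
  unfolding sheaf_cat_def by (intro category_full_subcat category_presheaf_cat)

lemma presheafI:
  fixes P :: "('o, 'm, 'u) presheaf"
  assumes "\<And>X. X \<in> Ob C \<Longrightarrow> small (fob P X) TYPE('u)"
    and "\<And>X Y f. \<lbrakk>X \<in> Ob C; Y \<in> Ob C; f \<in> Hom C Y X\<rbrakk> \<Longrightarrow> fmap P X Y f \<in> fob P X \<rightarrow>\<^sub>E fob P Y"
    and "\<And>X a. \<lbrakk>X \<in> Ob C; a \<in> fob P X\<rbrakk> \<Longrightarrow> fmap P X X (Idn C X) a = a"
    and "\<And>X Y Z f g a. \<lbrakk>X \<in> Ob C; Y \<in> Ob C; Z \<in> Ob C; f \<in> Hom C Y X; g \<in> Hom C Z Y; a \<in> fob P X\<rbrakk>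
      \<Longrightarrow> fmap P X Z (Cmp C Z Y X f g) a = fmap P Y Z g (fmap P X Y f a)"
    and comp: "\<And>X Y Z f g. \<lbrakk>X \<in> Ob C; Y \<in> Ob C; Z \<in> Ob C; f \<in> Hom C Y X; g \<in> Hom C Z Y\<rbrakk>
      \<Longrightarrow> Cmp C Z Y X f g \<in> Hom C Z X"
    and idn: "\<And>X. X \<in> Ob C \<Longrightarrow> Idn C X \<in> Hom C X X"
  shows "P \<in> Ob (presheaf_cat C)"
proof -
  have "fmap P X X (Idn C X) = (\<lambda>a\<in>fob P X. a)" if "X \<in> Ob C" for X
  proof -
    have "fmap P X X (Idn C X) \<in> extensional (fob P X)"
      using assms(2)[OF that that idn[OF that]] by (simp add: PiE_iff)
    then show ?thesis using assms(3)[OF that] by (auto simp: extensional_def fun_eq_iff)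
  qed
  moreover have "fmap P X Z (Cmp C Z Y X f g) = compose (fob P X) (fmap P Y Z g) (fmap P X Y f)"
    if *: "X \<in> Ob C" "Y \<in> Ob C" "Z \<in> Ob C" "f \<in> Hom C Y X" "g \<in> Hom C Z Y" for X Y Z f g
  proof -
    have "fmap P X Z (Cmp C Z Y X f g) \<in> fob P X \<rightarrow>\<^sub>E fob P Z"
      using assms(2) * comp by blast
    then show ?thesis using assms(4)[OF *]
      by (auto simp: PiE_iff extensional_def fun_eq_iff compose_def restrict_def)
  qed
  ultimately show ?thesis
    using assms(1,2) by (simp add: presheaf_cat_def functor_cat_def is_func_def op_cat_def set_cat_def)
qed

lemma presheafD:
  fixes P :: "('o, 'm, 'u) presheaf"
  assumes "P \<in> Ob (presheaf_cat C)"
  shows presheaf_small: "X \<in> Ob C \<Longrightarrow> small (fob P X) TYPE('u)"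
    and presheaf_restr_PiE: "\<lbrakk>X \<in> Ob C; Y \<in> Ob C; f \<in> Hom C Y X\<rbrakk>
      \<Longrightarrow> fmap P X Y f \<in> fob P X \<rightarrow>\<^sub>E fob P Y"
    and presheaf_restr: "\<lbrakk>X \<in> Ob C; Y \<in> Ob C; f \<in> Hom C Y X; a \<in> fob P X\<rbrakk>
      \<Longrightarrow> fmap P X Y f a \<in> fob P Y"
    and presheaf_idn: "\<lbrakk>X \<in> Ob C; a \<in> fob P X\<rbrakk> \<Longrightarrow> fmap P X X (Idn C X) a = a"
    and presheaf_comp: "\<lbrakk>X \<in> Ob C; Y \<in> Ob C; Z \<in> Ob C; f \<in> Hom C Y X; g \<in> Hom C Z Y; a \<in> fob P X\<rbrakk>
      \<Longrightarrow> fmap P X Z (Cmp C Z Y X f g) a = fmap P Y Z g (fmap P X Y f a)"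
proof -
  have P: "is_func (op_cat C) set_cat P"
    using assms by (simp add: presheaf_cat_def functor_cat_def)
  note P' = is_funcD[OF P, unfolded op_cat_def set_cat_def, simplified]
  show "X \<in> Ob C \<Longrightarrow> small (fob P X) TYPE('u)"
    and "\<lbrakk>X \<in> Ob C; Y \<in> Ob C; f \<in> Hom C Y X\<rbrakk> \<Longrightarrow> fmap P X Y f \<in> fob P X \<rightarrow>\<^sub>E fob P Y"
    and "\<lbrakk>X \<in> Ob C; a \<in> fob P X\<rbrakk> \<Longrightarrow> fmap P X X (Idn C X) a = a"
    and "\<lbrakk>X \<in> Ob C; Y \<in> Ob C; Z \<in> Ob C; f \<in> Hom C Y X; g \<in> Hom C Z Y; a \<in> fob P X\<rbrakk>
      \<Longrightarrow> fmap P X Z (Cmp C Z Y X f g) a = fmap P Y Z g (fmap P X Y f a)"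
    by (simp_all add: P' compose_def)
  then show "\<lbrakk>X \<in> Ob C; Y \<in> Ob C; f \<in> Hom C Y X; a \<in> fob P X\<rbrakk> \<Longrightarrow> fmap P X Y f a \<in> fob P Y"
    by blast
qed

lemma presheaf_homI:
  assumes P: "P \<in> Ob (presheaf_cat C)" and Q: "Q \<in> Ob (presheaf_cat C)"
    and "\<tau> \<in> extensional (Ob C)"
    and "\<And>X. X \<in> Ob C \<Longrightarrow> \<tau> X \<in> fob P X \<rightarrow>\<^sub>E fob Q X"
    and nat: "\<And>X Y f a. \<lbrakk>X \<in> Ob C; Y \<in> Ob C; f \<in> Hom C Y X; a \<in> fob P X\<rbrakk>
      \<Longrightarrow> \<tau> Y (fmap P X Y f a) = fmap Q X Y f (\<tau> X a)"
  shows "\<tau> \<in> Hom (presheaf_cat C) P Q"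
  using assms(3-)
  by (auto simp: presheaf_cat_def functor_cat_def nat_trans_def op_cat_def set_cat_def
      compose_def intro!: restrict_ext)

lemma presheaf_homD:
  assumes "\<tau> \<in> Hom (presheaf_cat C) P Q"
  shows presheaf_hom_extensional: "\<tau> \<in> extensional (Ob C)"
    and presheaf_hom_PiE: "X \<in> Ob C \<Longrightarrow> \<tau> X \<in> fob P X \<rightarrow>\<^sub>E fob Q X"
    and presheaf_hom_mem: "\<lbrakk>X \<in> Ob C; a \<in> fob P X\<rbrakk> \<Longrightarrow> \<tau> X a \<in> fob Q X"
    and presheaf_hom_nat: "\<lbrakk>X \<in> Ob C; Y \<in> Ob C; f \<in> Hom C Y X; a \<in> fob P X\<rbrakk>
      \<Longrightarrow> \<tau> Y (fmap P X Y f a) = fmap Q X Y f (\<tau> X a)"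
proof -
  have n: "nat_trans (op_cat C) set_cat P Q \<tau>"
    using assms by (simp add: presheaf_cat_def functor_cat_def)
  show "\<tau> \<in> extensional (Ob C)" and PiE: "X \<in> Ob C \<Longrightarrow> \<tau> X \<in> fob P X \<rightarrow>\<^sub>E fob Q X"
    using n by (auto simp: nat_trans_def op_cat_def set_cat_def)
  show "\<lbrakk>X \<in> Ob C; a \<in> fob P X\<rbrakk> \<Longrightarrow> \<tau> X a \<in> fob Q X"
    using PiE by blast
  show "\<tau> Y (fmap P X Y f a) = fmap Q X Y f (\<tau> X a)"
    if *: "X \<in> Ob C" "Y \<in> Ob C" "f \<in> Hom C Y X" "a \<in> fob P X"
  proof -
    have "compose (fob P X) (\<tau> Y) (fmap P X Y f) = compose (fob P X) (fmap Q X Y f) (\<tau> X)"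
      using n * by (simp add: nat_trans_def op_cat_def set_cat_def)
    from fun_cong[OF this, of a] show ?thesis using *(4) by (simp add: compose_def)
  qed
qed

lemma presheaf_hom_eqI:
  assumes "\<sigma> \<in> Hom (presheaf_cat C) P Q" "\<tau> \<in> Hom (presheaf_cat C) P Q"
    and "\<And>X a. \<lbrakk>X \<in> Ob C; a \<in> fob P X\<rbrakk> \<Longrightarrow> \<sigma> X a = \<tau> X a"
  shows "\<sigma> = \<tau>"
proof (rule extensionalityI[of _ "Ob C"])
  fix X assume X: "X \<in> Ob C"
  show "\<sigma> X = \<tau> X"
    using presheaf_hom_PiE[OF assms(1) X] presheaf_hom_PiE[OF assms(2) X] assms(3)[OF X]
    by (auto intro: PiE_ext)
qed (rule presheaf_hom_extensional[OF assms(1)] presheaf_hom_extensional[OF assms(2)])+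

lemma presheaf_cat_comp:
  "\<lbrakk>X \<in> Ob C; a \<in> fob P X\<rbrakk> \<Longrightarrow> Cmp (presheaf_cat C) P Q R \<tau> \<sigma> X a = \<tau> X (\<sigma> X a)"
  by (simp add: presheaf_cat_def functor_cat_def set_cat_def compose_def op_cat_def)

lemma sheaf_cat_simps:
  "Ob (sheaf_cat C J) = {P \<in> Ob (presheaf_cat C). is_sheaf C J P}"
  "Hom (sheaf_cat C J) = Hom (presheaf_cat C)"
  "Cmp (sheaf_cat C J) = Cmp (presheaf_cat C)"
  by (auto simp: sheaf_cat_def full_subcat_def)

lemma small_subset: "\<lbrakk>small B TYPE('u); A \<subseteq> B\<rbrakk> \<Longrightarrow> small A TYPE('u)"
  by (meson small_def subset_imp_lepoll lesspoll_trans1)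

lemma small_image: "small A TYPE('u) \<Longrightarrow> small (f ` A) TYPE('u)"
  by (meson small_def image_lepoll lesspoll_trans1)

lemma small_insert:
  assumes A: "small A TYPE('u)" and inf: "infinite (UNIV :: 'u set)"
  shows "small (insert a A) TYPE('u)"
proof (cases "finite A")
  case True
  then have "finite (insert a A)" by simp
  then show ?thesis unfolding small_def by (rule finite_lesspoll_infinite[OF inf])
next
  case False
  then show ?thesis using A infinite_insert_eqpoll eq_lesspoll_trans by (metis small_def)
qed

definition representable :: "('u, 'u) cat \<Rightarrow> 'u \<Rightarrow> ('u, 'u, 'u) presheaf" where
  "representable C c = \<lparr>fob = (\<lambda>d. Hom C d c), fmap = (\<lambda>d e f. \<lambda>g\<in>Hom C d c. Cmp C e d c g f)\<rparr>"

lemma representable_presheaf: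
  assumes C: "small_category (C :: ('u, 'u) cat)" and c: "c \<in> Ob C"
  shows "representable C c \<in> Ob (presheaf_cat C)"
proof -
  have cat: "category C" using C by (simp add: small_category_def)
  have "small (Hom C d c) TYPE('u)" if d: "d \<in> Ob C" for d
  proof (rule small_subset[OF small_image[of _ snd]])
    show "small (SIGMA (X, Y) : Ob C \<times> Ob C. Hom C X Y) TYPE('u)"
      using C by (simp add: small_category_def)
    show "Hom C d c \<subseteq> snd ` (SIGMA (X, Y) : Ob C \<times> Ob C. Hom C X Y)"
      using c d by force
  qed
  then show ?thesis
    using c by (intro presheafI) (auto simp: representable_def category_rules[OF cat])
qed

definition yoneda_map :: "('u, 'u) cat \<Rightarrow> 'u \<Rightarrow> ('u, 'u, 'u) presheaf \<Rightarrow> 'u \<Rightarrow> 'u \<Rightarrow> 'u \<Rightarrow> 'u" where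
  "yoneda_map C c P a = (\<lambda>d\<in>Ob C. \<lambda>f\<in>Hom C d c. fmap P c d f a)"

lemma yoneda_map_hom:
  assumes C: "small_category C" and c: "c \<in> Ob C" and P: "P \<in> Ob (presheaf_cat C)"
    and a: "a \<in> fob P c"
  shows "yoneda_map C c P a \<in> Hom (presheaf_cat C) (representable C c) P"
proof -
  have cat: "category C" using C by (simp add: small_category_def)
  show ?thesis
    using representable_presheaf[OF C c] P
    by (rule presheaf_homI) (use c a in
        \<open>auto simp: yoneda_map_def representable_def category_compI[OF cat] presheafD[OF P]\<close>)
qed

lemma yoneda_map_idn:
  assumes "category C" "c \<in> Ob C" "P \<in> Ob (presheaf_cat C)" "a \<in> fob P c"
  shows "yoneda_map C c P a c (Idn C c) = a"
  using assms by (simp add: yoneda_map_def category_idnI presheaf_idn)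

lemma yoneda_unique:
  assumes C: "small_category C" and c: "c \<in> Ob C" and P: "P \<in> Ob (presheaf_cat C)"
    and m: "m \<in> Hom (presheaf_cat C) (representable C c) P"
  shows "m = yoneda_map C c P (m c (Idn C c))"
proof -
  have cat: "category C" using C by (simp add: small_category_def)
  have a: "m c (Idn C c) \<in> fob P c"
    using presheaf_hom_mem[OF m c] category_idnI[OF cat c] by (simp add: representable_def)
  show ?thesis
  proof (rule presheaf_hom_eqI[OF m yoneda_map_hom[OF C c P a]])
    fix d f assume d: "d \<in> Ob C" and f: "f \<in> fob (representable C c) d"
    have f': "f \<in> Hom C d c" using f by (simp add: representable_def)
    have "m d (fmap (representable C c) c d f (Idn C c)) = fmap P c d f (m c (Idn C c))"
      using presheaf_hom_nat[OF m c d f'] category_idnI[OF cat c] by (simp add: representable_def)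
    then show "m d f = yoneda_map C c P (m c (Idn C c)) d f"
      using c d f' by (simp add: representable_def yoneda_map_def category_rules[OF cat])
  qed
qed

text \<open>The elements reached by the family form a subpresheaf \<open>Q\<close> of \<open>V\<close>. Collapsing \<open>Q\<close> to a point yields two maps out
  of \<open>V\<close>, the quotient map and the constant one. They agree on \<open>Q\<close>, hence they are equal, so that \<open>Q\<close> is all of
  \<open>V\<close>. The quotient has at most one element more than \<open>V\<close> at each object, which is what makes it small: in an
  arbitrary universe \<open>'u\<close>, the sieves on an object, needed for characteristic maps, may not form a small set.\<close>

lemma presheaf_jointly_epic_imp_surjective:
  fixes C :: "('u, 'u) cat"
  assumes C: "small_category C" and inf: "infinite (UNIV :: 'u set)"
    and je: "jointly_epic (presheaf_cat C :: (('u, 'u, 'u) presheaf, _) cat) V W i"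
    and c: "c \<in> Ob C" and a: "a \<in> fob V c"
  shows "\<exists>j. \<exists>w\<in>fob (W j) c. i j c w = a"
proof (rule ccontr)
  assume neg: "\<not> ?thesis"
  have cat: "category C" using C by (simp add: small_category_def)
  have V: "V \<in> Ob (presheaf_cat C)" and W: "\<And>j. W j \<in> Ob (presheaf_cat C)"
    and i: "\<And>j. i j \<in> Hom (presheaf_cat C) (W j) V"
    using je by (auto simp: jointly_epic_def)
  define Q where "Q d = {b. \<exists>j. \<exists>w\<in>fob (W j) d. b = i j d w}" for d
  have Q: "fmap V d e f b \<in> Q e" if "d \<in> Ob C" "e \<in> Ob C" "f \<in> Hom C e d" "b \<in> Q d" for d e f b
    using that presheaf_hom_nat[OF i that(1-3), symmetric] presheaf_restr[OF W that(1-3)]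
    unfolding Q_def by blast
  \<comment> \<open>The point \<open>star\<close> must differ from all other elements of the quotient, so these are moved away
    from it by \<open>s\<close>.\<close>
  obtain s :: "'u \<Rightarrow> 'u" and star where s: "inj s" and star: "star \<notin> range s"
  proof -
    have "infinite (UNIV - {undefined :: 'u})" using inf by simp
    then have "insert undefined (UNIV - {undefined :: 'u}) \<approx> UNIV - {undefined :: 'u}"
      by (rule infinite_insert_eqpoll)
    moreover have "insert undefined (UNIV - {undefined :: 'u}) = UNIV" by auto
    ultimately obtain s :: "'u \<Rightarrow> 'u" where "bij_betw s UNIV (UNIV - {undefined})"
      by (auto simp: eqpoll_def)
    then show ?thesis using that[of s undefined] by (auto simp: bij_betw_def)
  qed
  let ?q = "\<lambda>d b. if b \<in> Q d then star else s b"
  define G :: "('u, 'u, 'u) presheaf" where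
    "G = \<lparr>fob = (\<lambda>d. insert star (?q d ` fob V d)),
      fmap = (\<lambda>d e f. \<lambda>z\<in>insert star (?q d ` fob V d).
         if z = star then star else ?q e (fmap V d e f (inv s z)))\<rparr>"
  have G_map: "fmap G d e f (?q d b) = ?q e (fmap V d e f b)"
    if "d \<in> Ob C" "e \<in> Ob C" "f \<in> Hom C e d" "b \<in> fob V d" for d e f b
    using that star Q s by (auto simp: G_def)
  have G_star: "fmap G d e f star = star" for d e f
    by (simp add: G_def)
  have fobG: "fob G d = insert star (?q d ` fob V d)" for d by (simp add: G_def)
  have mapG: "fmap G d e f \<in> extensional (fob G d)" for d e f by (simp add: G_def)
  have G: "G \<in> Ob (presheaf_cat C)"
  proof (rule presheafI)
    fix d assume d: "d \<in> Ob C"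
    show "small (fob G d) TYPE('u)"
      unfolding fobG using presheaf_small[OF V d] inf by (intro small_insert small_image)
    show "fmap G d d (Idn C d) z = z" if "z \<in> fob G d" for z
    proof -
      have "z = star \<or> (\<exists>b\<in>fob V d. z = ?q d b)" using that unfolding fobG by blast
      then show ?thesis
      proof
        assume "\<exists>b\<in>fob V d. z = ?q d b"
        then obtain b where b: "b \<in> fob V d" and zb: "z = ?q d b" by blast
        show ?thesis
          unfolding zb using d b by (simp only: G_map category_idnI[OF cat] presheaf_idn[OF V])
      qed (simp add: G_star)
    qed
    fix e f assume e: "e \<in> Ob C" and f: "f \<in> Hom C e d"
    have "fmap G d e f z \<in> fob G e" if "z \<in> fob G d" for z
    proof -
      have "z = star \<or> (\<exists>b\<in>fob V d. z = ?q d b)" using that unfolding fobG by blast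
      then show ?thesis
      proof
        assume "\<exists>b\<in>fob V d. z = ?q d b"
        then obtain b where b: "b \<in> fob V d" and zb: "z = ?q d b" by blast
        show ?thesis
          unfolding zb G_map[OF d e f b] fobG using presheaf_restr[OF V d e f b] by blast
      qed (simp add: G_star fobG)
    qed
    then show "fmap G d e f \<in> fob G d \<rightarrow>\<^sub>E fob G e" using mapG by (auto simp: PiE_iff)
    fix e' g z assume e': "e' \<in> Ob C" and g: "g \<in> Hom C e' e" and z: "z \<in> fob G d"
    have "z = star \<or> (\<exists>b\<in>fob V d. z = ?q d b)" using z unfolding fobG by blast
    then show "fmap G d e' (Cmp C e' e d f g) z = fmap G e e' g (fmap G d e f z)"
    proof
      assume "\<exists>b\<in>fob V d. z = ?q d b"
      then obtain b where b: "b \<in> fob V d" and zb: "z = ?q d b" by blast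
      show ?thesis
        unfolding zb using d e e' f g b
        by (simp only: G_map category_compI[OF cat] presheaf_comp[OF V] presheaf_restr[OF V])
    qed (simp add: G_star)
  qed (auto simp: category_rules[OF cat])
  define u v :: "'u \<Rightarrow> 'u \<Rightarrow> 'u" where "u = (\<lambda>d\<in>Ob C. \<lambda>b\<in>fob V d. ?q d b)"
    and "v = (\<lambda>d\<in>Ob C. \<lambda>b\<in>fob V d. star)"
  have u_app: "u d b = ?q d b" if "d \<in> Ob C" "b \<in> fob V d" for d b
    using that by (simp add: u_def)
  have u: "u \<in> Hom (presheaf_cat C) V G"
    using V G
  proof (rule presheaf_homI)
    fix d assume d: "d \<in> Ob C"
    have "u d b \<in> fob G d" if "b \<in> fob V d" for b
      unfolding u_app[OF d that] fobG using that by blast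
    then show "u d \<in> fob V d \<rightarrow>\<^sub>E fob G d" using d by (auto simp: PiE_iff u_def)
    fix e f b assume e: "e \<in> Ob C" and f: "f \<in> Hom C e d" and b: "b \<in> fob V d"
    show "u e (fmap V d e f b) = fmap G d e f (u d b)"
      unfolding u_app[OF d b] G_map[OF d e f b] by (rule u_app[OF e presheaf_restr[OF V d e f b]])
  qed (simp add: u_def)
  have v: "v \<in> Hom (presheaf_cat C) V G"
    using V G by (rule presheaf_homI) (auto simp: v_def fobG G_star presheaf_restr[OF V])
  have "Cmp (presheaf_cat C) (W j) V G u (i j) = Cmp (presheaf_cat C) (W j) V G v (i j)" for j
  proof (rule presheaf_hom_eqI)
    show "Cmp (presheaf_cat C) (W j) V G u (i j) \<in> Hom (presheaf_cat C) (W j) G"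
      "Cmp (presheaf_cat C) (W j) V G v (i j) \<in> Hom (presheaf_cat C) (W j) G"
      using W V G i u v by (simp_all add: category_compI[OF category_presheaf_cat])
    fix d w assume d: "d \<in> Ob C" and w: "w \<in> fob (W j) d"
    have "i j d w \<in> Q d" using w by (auto simp: Q_def)
    then show "Cmp (presheaf_cat C) (W j) V G u (i j) d w = Cmp (presheaf_cat C) (W j) V G v (i j) d w"
      using d w presheaf_hom_mem[OF i d w] by (simp add: presheaf_cat_comp u_def v_def)
  qed
  then have "u = v" using je G u v by (simp add: jointly_epic_def)
  then have "u c a = v c a" by simp
  moreover have "a \<notin> Q c" using neg by (auto simp: Q_def)
  ultimately show False using c a star by (auto simp: u_def v_def)
qed

text \<open>By the Yoneda lemma a map out of the representable is an element of \<open>V\<close>, and jointly epic families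
  reach every element.\<close>

lemma representable_irreducible:
  fixes C :: "('u, 'u) cat"
  assumes C: "small_category C" and inf: "infinite (UNIV :: 'u set)" and c: "c \<in> Ob C"
  shows "irreducible_object (presheaf_cat C) (representable C c)"
  unfolding irreducible_object_def
proof (intro conjI allI impI)
  have cat: "category C" using C by (simp add: small_category_def)
  show "representable C c \<in> Ob (presheaf_cat C)" by (rule representable_presheaf[OF C c])
  fix V W i m
  assume je: "jointly_epic (presheaf_cat C) V W i"
    and m: "m \<in> Hom (presheaf_cat C) (representable C c) V"
  have V: "V \<in> Ob (presheaf_cat C)" and W: "\<And>j. W j \<in> Ob (presheaf_cat C)"
    and i: "\<And>j. i j \<in> Hom (presheaf_cat C) (W j) V"
    using je by (auto simp: jointly_epic_def)
  have idc: "Idn C c \<in> fob (representable C c) c"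
    using category_idnI[OF cat c] by (simp add: representable_def)
  then obtain j w where w: "w \<in> fob (W j) c" and iw: "i j c w = m c (Idn C c)"
    using presheaf_jointly_epic_imp_surjective[OF C inf je c] presheaf_hom_mem[OF m c] by metis
  let ?g = "yoneda_map C c (W j) w"
  have g: "?g \<in> Hom (presheaf_cat C) (representable C c) (W j)"
    by (rule yoneda_map_hom[OF C c W w])
  let ?ig = "Cmp (presheaf_cat C) (representable C c) (W j) V (i j) ?g"
  have ig: "?ig \<in> Hom (presheaf_cat C) (representable C c) V"
    using representable_presheaf[OF C c] V W i g
    by (simp add: category_compI[OF category_presheaf_cat])
  have "?ig c (Idn C c) = m c (Idn C c)"
    using c idc w W by (simp add: presheaf_cat_comp yoneda_map_idn[OF cat] iw)
  then have "?ig = m"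
    using yoneda_unique[OF C c V ig] yoneda_unique[OF C c V m] by simp
  then show "\<exists>j. \<exists>g\<in>Hom (presheaf_cat C) (representable C c) (W j).
      Cmp (presheaf_cat C) (representable C c) (W j) V (i j) g = m"
    using g by blast
qed

lemma presheaf_cat_separated_by_irreducibles:
  fixes C :: "('u, 'u) cat"
  assumes C: "small_category C" and inf: "infinite (UNIV :: 'u set)"
  shows "separated_by_irreducibles (presheaf_cat C :: (('u, 'u, 'u) presheaf, _) cat)"
  unfolding separated_by_irreducibles_def
proof (intro ballI impI)
  have cat: "category C" using C by (simp add: small_category_def)
  fix V Z :: "('u, 'u, 'u) presheaf" and u v
  assume V: "V \<in> Ob (presheaf_cat C)" and Z: "Z \<in> Ob (presheaf_cat C)"
    and u: "u \<in> Hom (presheaf_cat C) V Z" and v: "v \<in> Hom (presheaf_cat C) V Z" and "u \<noteq> v"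
  then obtain c a where c: "c \<in> Ob C" and a: "a \<in> fob V c" and ne: "u c a \<noteq> v c a"
    using presheaf_hom_eqI by meson
  let ?m = "yoneda_map C c V a"
  have m: "?m \<in> Hom (presheaf_cat C) (representable C c) V"
    by (rule yoneda_map_hom[OF C c V a])
  have idc: "Idn C c \<in> fob (representable C c) c"
    using category_idnI[OF cat c] by (simp add: representable_def)
  have "Cmp (presheaf_cat C) (representable C c) V Z w ?m c (Idn C c) = w c a" for w
    using c idc a V by (simp add: presheaf_cat_comp yoneda_map_idn[OF cat])
  then have "Cmp (presheaf_cat C) (representable C c) V Z u ?m \<noteq>
      Cmp (presheaf_cat C) (representable C c) V Z v ?m"
    using ne by metis
  then show "\<exists>X. irreducible_object (presheaf_cat C) X \<and> (\<exists>m\<in>Hom (presheaf_cat C) X V.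
      Cmp (presheaf_cat C) X V Z u m \<noteq> Cmp (presheaf_cat C) X V Z v m)"
    using representable_irreducible[OF C inf c] m by blast
qed

section \<open>A countable simple MV-algebra\<close>

lemma sqrt_2_irrational: "sqrt 2 \<notin> \<rat>"
proof
  assume "sqrt 2 \<in> \<rat>"
  then obtain m n :: nat where n: "n \<noteq> 0" and eq: "\<bar>sqrt 2\<bar> = real m / real n" and mn: "coprime m n"
    by (rule Rats_abs_nat_div_natE)
  have "real m = sqrt 2 * real n" using n eq by (simp add: field_simps)
  then have "real (m\<^sup>2) = real (2 * n\<^sup>2)" by (simp add: power_mult_distrib)
  then have eq: "m\<^sup>2 = 2 * n\<^sup>2" by (simp only: of_nat_eq_iff)
  then have m: "even m" by (metis dvd_triv_left even_power pos2)
  then obtain k where "m = 2 * k" by blast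
  with eq have "n\<^sup>2 = 2 * k\<^sup>2" by (simp add: power_mult_distrib)
  then have "even n" by (metis dvd_triv_left even_power pos2)
  with m mn show False by (metis coprime_common_divisor_nat dvd_refl even_Suc One_nat_def odd_one)
qed

definition surd :: "rat \<Rightarrow> rat \<Rightarrow> real" where
  "surd p q = of_rat p + of_rat q * sqrt 2"

lemma surd_eq_iff: "surd p q = surd p' q' \<longleftrightarrow> p = p' \<and> q = q'"
proof
  assume eq: "surd p q = surd p' q'"
  have "q = q'"
  proof (rule ccontr)
    assume "q \<noteq> q'"
    then have "sqrt 2 = of_rat ((p' - p) / (q - q'))"
      using eq by (simp add: surd_def of_rat_divide of_rat_diff field_simps)
    then show False using sqrt_2_irrational by (metis Rats_of_rat)
  qed
  then show "p = p' \<and> q = q'" using eq by (simp add: surd_def)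
qed simp

text \<open>Well-defined on the range of \<open>surd\<close> by the irrationality of \<open>sqrt 2\<close>.\<close>

definition surd_coeff :: "real \<Rightarrow> rat" where
  "surd_coeff r = (THE q. \<exists>p. r = surd p q)"

lemma surd_coeff_surd [simp]: "surd_coeff (surd p q) = q"
  by (auto simp: surd_coeff_def surd_eq_iff)

text \<open>The carrier of the model used throughout, a subalgebra of the standard MV-algebra \<open>[0, 1]\<close>. It is countable,
  so that the sheaves of functions constructed below are small, and it contains irrational elements.\<close>

definition unit_surds :: "real set" where
  "unit_surds = range (\<lambda>(p, q). surd p q) \<inter> {0..1}"

lemma unit_surds_bounds: "a \<in> unit_surds \<Longrightarrow> 0 \<le> a \<and> a \<le> 1"
  by (auto simp: unit_surds_def)

lemma unit_surdsE:
  assumes "a \<in> unit_surds"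
  obtains p q where "a = surd p q"
  using assms by (auto simp: unit_surds_def)

lemma unit_surdsI: "\<lbrakk>0 \<le> surd p q; surd p q \<le> 1\<rbrakk> \<Longrightarrow> surd p q \<in> unit_surds"
  by (force simp: unit_surds_def)

lemma countable_unit_surds: "countable unit_surds"
  unfolding unit_surds_def by (intro countable_Int1 countable_image) simp

lemma surd_0 [simp]: "surd 0 0 = 0" and surd_1: "surd 1 0 = 1"
  by (simp_all add: surd_def)

lemma surd_add: "surd p q + surd p' q' = surd (p + p') (q + q')"
  by (simp add: surd_def of_rat_add algebra_simps)

lemma surd_one_minus: "1 - surd p q = surd (1 - p) (- q)"
  by (simp add: surd_def of_rat_diff of_rat_minus)

lemma unit_surds_0 [simp]: "0 \<in> unit_surds" and unit_surds_1 [simp]: "1 \<in> unit_surds"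
  using unit_surdsI[of 0 0] unit_surdsI[of 1 0] by (simp_all add: surd_1)

lemma unit_surds_one_minus: "a \<in> unit_surds \<Longrightarrow> 1 - a \<in> unit_surds"
proof -
  assume a: "a \<in> unit_surds"
  then obtain p q where "a = surd p q" by (rule unit_surdsE)
  then show ?thesis
    using unit_surds_bounds[OF a] unit_surdsI[of "1 - p" "- q"] by (simp add: surd_one_minus[symmetric])
qed

lemma unit_surds_plus: 
  assumes "a \<in> unit_surds" "b \<in> unit_surds" shows "min 1 (a + b) \<in> unit_surds"
proof (cases "a + b \<le> 1")
  case True
  obtain p q p' q' where "a = surd p q" "b = surd p' q'" using assms unit_surdsE by metis
  then show ?thesis
    using True assms[THEN unit_surds_bounds] unit_surdsI[of "p + p'" "q + q'"]
    by (simp add: surd_add[symmetric])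
qed simp

section \<open>Interpretation of geometric formulas\<close>

primrec tm_val :: "(nat \<Rightarrow> real) \<Rightarrow> tm \<Rightarrow> real" where
  "tm_val e (Var k) = e k"
| "tm_val e Zero = 0"
| "tm_val e (Neg t) = 1 - tm_val e t"
| "tm_val e (Plus s t) = min 1 (tm_val e s + tm_val e t)"

primrec sat :: "'i fm \<Rightarrow> (nat \<Rightarrow> real) \<Rightarrow> bool" where
  "sat (Eq s t) e \<longleftrightarrow> tm_val e s = tm_val e t"
| "sat Top e \<longleftrightarrow> True"
| "sat (And \<phi> \<psi>) e \<longleftrightarrow> sat \<phi> e \<and> sat \<psi> e"
| "sat (Disj I f) e \<longleftrightarrow> (\<exists>i\<in>I. sat (f i) e)"
| "sat (Ex \<phi>) e \<longleftrightarrow> (\<exists>a\<in>unit_surds. sat \<phi> (case_nat a e))"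

lemma tm_val_unit_surds: "(\<And>k. e k \<in> unit_surds) \<Longrightarrow> tm_val e t \<in> unit_surds"
  by (induction t) (simp_all add: unit_surds_one_minus unit_surds_plus)

lemma tm_val_subst: "tm_val e (tm_subst \<sigma> t) = tm_val (\<lambda>k. tm_val e (\<sigma> k)) t"
  by (induction t) simp_all

lemma tm_val_cong: "\<lbrakk>tm_in n t; \<And>k. k < n \<Longrightarrow> e k = e' k\<rbrakk> \<Longrightarrow> tm_val e t = tm_val e' t"
  by (induction t) simp_all

lemma sat_cong: "\<lbrakk>fm_in \<phi> n; \<And>k. k < n \<Longrightarrow> e k = e' k\<rbrakk> \<Longrightarrow> sat \<phi> e \<longleftrightarrow> sat \<phi> e'"
proof (induction \<phi> arbitrary: n e e')
  case (Eq s t)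
  then show ?case using tm_val_cong by (metis fm_in.simps(1) sat.simps(1))
next
  case (And \<phi> \<psi>)
  then show ?case by (metis fm_in.simps(3) sat.simps(3))
next
  case (Disj I f)
  have "sat (f i) e = sat (f i) e'" if "i \<in> I" for i
    using Disj that by (metis fm_in.simps(4) rangeI)
  then show ?case by auto
next
  case (Ex \<phi>)
  have "sat \<phi> (case_nat a e) = sat \<phi> (case_nat a e')" for a
    using Ex.prems by (intro Ex.IH[of "Suc n"]) (auto split: nat.split)
  then show ?case by simp
qed simp

lemma sat_subst: "sat (fm_subst \<phi> \<sigma>) e \<longleftrightarrow> sat \<phi> (\<lambda>k. tm_val e (\<sigma> k))"
proof (induction \<phi> arbitrary: \<sigma> e)
  case (Ex \<phi>)
  have "(\<lambda>k. tm_val (case_nat a e) (lift_subst \<sigma> k)) = case_nat a (\<lambda>k. tm_val e (\<sigma> k))" for a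
    by (auto simp: lift_subst_def tm_val_subst split: nat.split)
  then show ?case using Ex by simp
qed (auto simp: tm_val_subst)

lemma sat_rename [simp]: "sat (fm_rename r \<phi>) e \<longleftrightarrow> sat \<phi> (\<lambda>k. e (r k))"
  by (simp add: fm_rename_def sat_subst)

lemma sat_shift: "sat (fm_shift \<phi>) e \<longleftrightarrow> sat \<phi> (\<lambda>k. e (Suc k))"
  by (simp add: fm_shift_def)

lemma sat_inst: "sat (fm_inst \<phi> t) e \<longleftrightarrow> sat \<phi> (case_nat (tm_val e t) e)"
proof -
  have "(\<lambda>k. tm_val e (case_nat t Var k)) = case_nat (tm_val e t) e"
    by (auto split: nat.split)
  then show ?thesis by (simp add: fm_inst_def sat_subst)
qed

lemma sat_Conj [simp]: "sat (Conj \<phi>s) e \<longleftrightarrow> (\<forall>\<phi>\<in>set \<phi>s. sat \<phi> e)"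
  by (induction \<phi>s) (auto simp: Conj_def)

text \<open>Prepending a list to an environment. As \<open>Ex\<close> binds \<open>Var 0\<close>, the context \<open>y, x\<close> of an arrow from \<open>x\<close> to \<open>y\<close>
  corresponds to \<open>ys @ xs\<close>. The entries are elements of the model or terms.\<close>

definition env :: "'a list \<Rightarrow> (nat \<Rightarrow> 'a) \<Rightarrow> nat \<Rightarrow> 'a" where
  "env xs e k = (if k < length xs then xs ! k else e (k - length xs))"

lemma env_append: "env (xs @ ys) e = env xs (env ys e)"
  by (auto simp: env_def nth_append fun_eq_iff)

lemma env_nth: "i < length ts \<Longrightarrow> env ts e i = ts ! i"
  by (simp add: env_def)

lemma env_add: "env (ss @ ts) e (length ss + i) = env ts e i"
  by (simp add: env_append) (simp add: env_def)

lemma env_map_Var: "i < b - a \<Longrightarrow> env (map Var [a..<b]) e i = Var (a + i)"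
  by (simp add: env_def)

lemma sat_Exs: "sat (Exs m \<phi>) e \<longleftrightarrow> (\<exists>ys\<in>lists unit_surds. length ys = m \<and> sat \<phi> (env ys e))"
proof (induction m arbitrary: e)
  case 0
  have "env [] e = e" by (auto simp: env_def)
  then show ?case by (force simp: Exs_def)
next
  case (Suc m)
  have snoc: "env (ys @ [a]) e = env ys (case_nat a e)" for ys a
  proof
    fix k
    have "k - length ys = Suc (k - Suc (length ys))" if "k > length ys" using that by simp
    then show "env (ys @ [a]) e k = env ys (case_nat a e) k"
      by (cases "k = length ys") (auto simp: env_append env_def)
  qed
  have "sat (Exs (Suc m) \<phi>) e \<longleftrightarrow>
      (\<exists>a\<in>unit_surds. \<exists>ys\<in>lists unit_surds. length ys = m \<and> sat \<phi> (env (ys @ [a]) e))"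
    using Suc by (simp add: Exs_def snoc)
  also have "\<dots> \<longleftrightarrow> (\<exists>ys\<in>lists unit_surds. length ys = Suc m \<and> sat \<phi> (env ys e))"
  proof
    assume "\<exists>ys\<in>lists unit_surds. length ys = Suc m \<and> sat \<phi> (env ys e)"
    then obtain zs where "zs \<in> lists unit_surds" "length zs = Suc m" "sat \<phi> (env zs e)" by blast
    then show "\<exists>a\<in>unit_surds. \<exists>ys\<in>lists unit_surds. length ys = m \<and> sat \<phi> (env (ys @ [a]) e)"
      by (cases zs rule: rev_cases) auto
  next
    assume "\<exists>a\<in>unit_surds. \<exists>ys\<in>lists unit_surds. length ys = m \<and> sat \<phi> (env (ys @ [a]) e)"
    then obtain a ys where "a \<in> unit_surds" "ys \<in> lists unit_surds" "length ys = m"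
      "sat \<phi> (env (ys @ [a]) e)" by blast
    then show "\<exists>ys\<in>lists unit_surds. length ys = Suc m \<and> sat \<phi> (env ys e)"
      by (intro bexI[of _ "ys @ [a]"]) auto
  qed
  finally show ?case .
qed

lemma inj_nat_idx: "inj (nat_idx :: nat \<Rightarrow> 'i::infinite)"
proof -
  have "\<exists>e :: nat \<Rightarrow> 'i. inj e"
    using infinite_UNIV infinite_countable_subset[of "UNIV :: 'i set"] by auto
  then show ?thesis unfolding nat_idx_def by (rule someI_ex)
qed

lemma sat_nDisj [simp]: "sat (nDisj K f) e \<longleftrightarrow> (\<exists>n\<in>K. sat (f n) e)"
  by (simp add: nDisj_def inv_f_f[OF inj_nat_idx])

lemma sat_Or [simp]: "sat (Or \<phi> \<psi>) e \<longleftrightarrow> sat \<phi> e \<or> sat \<psi> e"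
  by (simp add: Or_def)

lemma tm_val_nmult:
  "tm_val e t \<in> unit_surds \<Longrightarrow> tm_val e (nmult n t) = min 1 (real n * tm_val e t)"
  by (induction n) (auto simp: algebra_simps min_def dest: unit_surds_bounds intro: mult_nonneg_nonneg)

lemma sat_Simple:
  assumes "(n, \<phi>, \<psi>) \<in> Simple" and e: "\<And>k. e k \<in> unit_surds"
  shows "sat \<psi> e"
proof (cases "(n, \<phi>, \<psi>) \<in> MV")
  case True
  have "0 \<le> e 0 \<and> e 0 \<le> 1 \<and> 0 \<le> e (Suc 0) \<and> e (Suc 0) \<le> 1 \<and> 0 \<le> e 2 \<and> e 2 \<le> 1"
    using e unit_surds_bounds by blast
  then show ?thesis
    using True by (auto simp: MV_def Let_def min_def)
next
  case False
  then have \<psi>: "\<psi> = nDisj UNIV (\<lambda>n. Or (Eq (Var 0) Zero) (Eq (nmult n (Var 0)) One))"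
    using assms(1) by (simp add: Simple_def)
  have "\<exists>n. e 0 = 0 \<or> tm_val e (nmult n (Var 0)) = 1"
  proof (cases "e 0 = 0")
    case False
    then have "e 0 > 0" using unit_surds_bounds[OF e[of 0]] by simp
    then obtain n where "1 < real n * e 0" using reals_Archimedean3 by blast
    then have "tm_val e (nmult n (Var 0)) = 1" using e by (simp add: tm_val_nmult)
    then show ?thesis by blast
  qed simp
  then show ?thesis by (auto simp: \<psi> One_def)
qed

lemma soundness:
  assumes "prv Simple n \<phi> \<psi>" "\<And>k. e k \<in> unit_surds" "sat \<phi> e"
  shows "sat \<psi> e"
  using assms
proof (induction arbitrary: e rule: prv.induct)
  case (Axiom n \<phi> \<psi>)
  then show ?case by (intro sat_Simple)
next
  case (Subst n \<phi> \<psi> m \<sigma>)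
  then show ?case by (simp add: sat_subst tm_val_unit_surds)
next
  case (ExI n \<phi> \<psi>)
  have "sat \<psi> (\<lambda>k. e (Suc k))"
  proof (rule ExI.IH)
    have "case_nat (e 0) (\<lambda>k. e (Suc k)) = e" by (auto split: nat.split)
    then show "sat (Ex \<phi>) (\<lambda>k. e (Suc k))" using ExI.prems by (auto intro!: bexI[of _ "e 0"])
  qed (use ExI.prems in auto)
  then show ?case by (simp add: sat_shift)
next
  case (ExE n \<phi> \<psi>)
  then obtain a where a: "a \<in> unit_surds" "sat \<phi> (case_nat a e)" by auto
  then have "sat (fm_shift \<psi>) (case_nat a e)"
    using ExE.prems by (intro ExE.IH) (auto split: nat.split)
  then show ?case by (simp add: sat_shift)
next
  case (Frobenius \<phi> n \<psi>)
  then show ?case by (auto simp: sat_shift)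
qed (auto simp: sat_inst)

section \<open>Perturbation of the model\<close>

text \<open>An additive map on \<open>surd p q\<close> that fixes the rationals and converges pointwise to the identity. It does not preserve
  the order, but any finite amount of information about the order survives when \<open>n\<close> is large.\<close>

definition shear :: "nat \<Rightarrow> real \<Rightarrow> real" where
  "shear n r = r + of_rat (surd_coeff r) / real (Suc n)"

lemma shear_surd: "shear n (surd p q) = surd (p + q / of_nat (Suc n)) q"
  by (simp add: shear_def surd_def[of "_ + _"] of_rat_add of_rat_divide surd_def[symmetric])

lemma shear_0 [simp]: "shear n 0 = 0" and shear_1 [simp]: "shear n 1 = 1"
  using shear_surd[of n 0 0] shear_surd[of n 1 0] by (simp_all add: surd_1)

lemma shear_one_minus: "a \<in> unit_surds \<Longrightarrow> shear n (1 - a) = 1 - shear n a"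
  by (elim unit_surdsE) (simp add: surd_one_minus shear_surd diff_diff_eq)

lemma shear_add: "\<lbrakk>a \<in> unit_surds; b \<in> unit_surds\<rbrakk> \<Longrightarrow> shear n (a + b) = shear n a + shear n b"
  by (elim unit_surdsE) (simp add: surd_add shear_surd add_divide_distrib algebra_simps)

lemma shear_tendsto: "(\<lambda>n. shear n r) \<longlonglongrightarrow> r"
proof -
  have "(\<lambda>n. r + of_rat (surd_coeff r) * inverse (real (Suc n))) \<longlonglongrightarrow> r + of_rat (surd_coeff r) * 0"
    by (intro tendsto_intros LIMSEQ_inverse_real_of_nat)
  then show ?thesis by (simp add: shear_def divide_inverse)
qed

lemma eventually_shear_unit_surds:
  assumes a: "a \<in> unit_surds"
  shows "\<forall>\<^sub>F n in sequentially. shear n a \<in> unit_surds"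
proof (cases "a = 0 \<or> a = 1")
  case False
  then have "0 < a" "a < 1" using unit_surds_bounds[OF a] by auto
  then have "\<forall>\<^sub>F n in sequentially. 0 < shear n a" "\<forall>\<^sub>F n in sequentially. shear n a < 1"
    using order_tendstoD[OF shear_tendsto] by auto
  then show ?thesis
  proof eventually_elim
    case (elim n)
    obtain p q where "a = surd p q" using a by (rule unit_surdsE)
    then show ?case using elim unit_surdsI by (simp add: shear_surd)
  qed
qed auto

text \<open>As \<open>shear n\<close> is additive and fixes 1, only the truncation in \<open>Plus\<close> is at stake: a strict inequality between
  \<open>a + b\<close> and 1 survives small perturbations, and the equation \<open>a + b = 1\<close> is preserved for every \<open>n\<close>.\<close>

lemma eventually_tm_val_shear:
  assumes e: "\<And>k. e k \<in> unit_surds"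
  shows "\<forall>\<^sub>F n in sequentially. tm_val (\<lambda>k. shear n (e k)) t = shear n (tm_val e t)"
proof (induction t)
  case (Neg t)
  then show ?case
    by eventually_elim (simp add: shear_one_minus tm_val_unit_surds[OF e])
next
  case (Plus s t)
  let ?a = "tm_val e s" and ?b = "tm_val e t"
  have ab: "?a \<in> unit_surds" "?b \<in> unit_surds" using tm_val_unit_surds[OF e] by auto
  have lim: "(\<lambda>n. shear n ?a + shear n ?b) \<longlonglongrightarrow> ?a + ?b"
    by (intro tendsto_add shear_tendsto)
  have "\<forall>\<^sub>F n in sequentially. min 1 (shear n ?a + shear n ?b) = shear n (min 1 (?a + ?b))"
  proof (rule linorder_cases[of "?a + ?b" 1])
    assume "?a + ?b < 1"
    then show ?thesis
      using order_tendstoD(2)[OF lim, of 1]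
      by (simp add: shear_add[OF ab]) (auto elim!: eventually_mono)
  next
    assume "?a + ?b > 1"
    then show ?thesis
      using order_tendstoD(1)[OF lim, of 1] by (auto elim!: eventually_mono)
  next
    assume "?a + ?b = 1"
    then show ?thesis using shear_add[OF ab] by simp
  qed
  with Plus show ?case by eventually_elim simp
qed simp_all

text \<open>The truth of a geometric formula rests on a choice of disjuncts and witnesses and on finitely many equations
  between terms, each of which is preserved eventually.\<close>

lemma eventually_sat_shear:
  assumes "sat \<phi> e" "\<And>k. e k \<in> unit_surds"
  shows "\<forall>\<^sub>F n in sequentially. sat \<phi> (\<lambda>k. shear n (e k))"
  using assms
proof (induction \<phi> arbitrary: e)
  case (Eq s t)
  then have "\<forall>\<^sub>F n in sequentially. tm_val (\<lambda>k. shear n (e k)) r = shear n (tm_val e r)" for r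
    by (intro eventually_tm_val_shear)
  from this[of s] this[of t] show ?case
    by eventually_elim (use Eq in simp)
next
  case (And \<phi> \<psi>)
  then show ?case by (auto intro: eventually_conj)
next
  case (Disj I f)
  then obtain i where "i \<in> I" "sat (f i) e" by auto
  then show ?case using Disj.IH[of "f i" e] Disj.prems(2) by (auto elim!: eventually_mono)
next
  case (Ex \<phi>)
  then obtain a where a: "a \<in> unit_surds" and "sat \<phi> (case_nat a e)" by auto
  then have "\<forall>\<^sub>F n in sequentially. sat \<phi> (\<lambda>k. shear n (case_nat a e k))"
    using Ex by (auto split: nat.split)
  with eventually_shear_unit_surds[OF a] show ?case
  proof eventually_elim
    case (elim n)
    have "(\<lambda>k. shear n (case_nat a e k)) = case_nat (shear n a) (\<lambda>k. shear n (e k))"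
      by (auto split: nat.split)
    then show ?case using elim by auto
  qed
qed simp

text \<open>The maps \<open>x \<mapsto> 2 x\<close> and \<open>x \<mapsto> 2 x - 1\<close>, truncated to \<open>[0, 1]\<close>, double the distance between two points of the lower and
  of the upper half respectively. Finitely many applications bring \<open>a\<close> and \<open>b\<close> to different halves, where the
  second map finishes the proof.\<close>

lemma separating_term:
  assumes "0 \<le> a" "a < b" "b \<le> 1"
  shows "\<exists>t. tm_in 1 t \<and> tm_val (\<lambda>_. a) t = 0 \<and> tm_val (\<lambda>_. b) t > 0"
proof -
  have compose: "\<exists>t. tm_in 1 t \<and> tm_val (\<lambda>_. a) t = 0 \<and> tm_val (\<lambda>_. b) t > 0"
    if s: "tm_in 1 s" and ex: "\<exists>t. tm_in 1 t \<and> tm_val (\<lambda>_. tm_val (\<lambda>_. a) s) t = 0 \<and>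
      tm_val (\<lambda>_. tm_val (\<lambda>_. b) s) t > 0" for s a b
  proof -
    obtain t where t: "tm_in 1 t" "tm_val (\<lambda>_. tm_val (\<lambda>_. a) s) t = 0"
      "tm_val (\<lambda>_. tm_val (\<lambda>_. b) s) t > 0" using ex by blast
    have "tm_in 1 (tm_subst (\<lambda>_. s) t)" using s by (induction t) auto
    then show ?thesis using t by (intro exI[of _ "tm_subst (\<lambda>_. s) t"]) (simp add: tm_val_subst)
  qed
  have main: "\<lbrakk>0 \<le> a; b \<le> 1; (1/2) ^ n \<le> b - a\<rbrakk> \<Longrightarrow>
      \<exists>t. tm_in 1 t \<and> tm_val (\<lambda>_. a) t = 0 \<and> tm_val (\<lambda>_. b) t > 0" for n
  proof (induction n arbitrary: a b)
    case 0
    then show ?case by (intro exI[of _ "Var 0"]) auto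
  next
    case (Suc n)
    have pos: "b - a > 0" using Suc.prems(3) by (smt (verit) zero_less_power divide_pos_pos)
    \<comment> \<open>The truncation of \<open>2 x - 1\<close>, that is, the MV-algebraic product of \<open>x\<close> with itself.\<close>
    let ?square = "Neg (Plus (Neg (Var 0)) (Neg (Var 0)))"
    consider "b \<le> 1/2" | "a \<le> 1/2" "1/2 < b" | "1/2 < a" by linarith
    then show ?case
    proof cases
      case 1
      show ?thesis
        by (rule compose[of "Plus (Var 0) (Var 0)"], simp, rule Suc.IH)
          (use 1 Suc.prems pos in \<open>simp_all add: min_def\<close>)
    next
      case 2
      then show ?thesis by (intro exI[of _ ?square]) (auto simp: min_def)
    next
      case 3
      show ?thesis
        by (rule compose[of ?square], simp, rule Suc.IH)
          (use 3 Suc.prems pos in \<open>simp_all add: min_def\<close>)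
    qed
  qed
  obtain n where "(1/2) ^ n < b - a" using real_arch_pow_inv[of "b - a" "1/2"] assms by auto
  then show ?thesis using main[of n] assms by simp
qed

section \<open>Derivations in geometric logic\<close>

lemma tm_subst_subst: "tm_subst \<tau> (tm_subst \<sigma> t) = tm_subst (\<lambda>k. tm_subst \<tau> (\<sigma> k)) t"
  by (induction t) simp_all

lemma tm_subst_Var [simp]: "tm_subst Var t = t"
  by (induction t) simp_all

lemma lift_subst_0 [simp]: "lift_subst \<sigma> 0 = Var 0"
  and lift_subst_Suc: "lift_subst \<sigma> (Suc k) = tm_subst (\<lambda>j. Var (Suc j)) (\<sigma> k)"
  by (simp_all add: lift_subst_def)

lemma fm_subst_subst: "fm_subst (fm_subst \<phi> \<sigma>) \<tau> = fm_subst \<phi> (\<lambda>k. tm_subst \<tau> (\<sigma> k))"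
proof (induction \<phi> arbitrary: \<sigma> \<tau>)
  case (Ex \<phi>)
  have "(\<lambda>k. tm_subst (lift_subst \<tau>) (lift_subst \<sigma> k)) = lift_subst (\<lambda>k. tm_subst \<tau> (\<sigma> k))"
    by (auto simp: fun_eq_iff lift_subst_def tm_subst_subst split: nat.split)
  then show ?case using Ex by simp
qed (simp_all add: tm_subst_subst)

lemma fm_subst_Var [simp]: "fm_subst \<phi> Var = \<phi>"
proof (induction \<phi>)
  case (Ex \<phi>)
  have "lift_subst Var = Var" by (auto simp: lift_subst_def fun_eq_iff split: nat.split)
  then show ?case using Ex by simp
qed simp_all

lemma fm_subst_rename: "fm_subst (fm_rename r \<phi>) e = fm_subst \<phi> (\<lambda>k. e (r k))"
  by (simp add: fm_rename_def fm_subst_subst)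

lemma tm_in_subst: "\<lbrakk>tm_in n t; \<And>k. k < n \<Longrightarrow> tm_in m (\<sigma> k)\<rbrakk> \<Longrightarrow> tm_in m (tm_subst \<sigma> t)"
  by (induction t) simp_all

lemma tm_in_mono: "\<lbrakk>tm_in n t; n \<le> m\<rbrakk> \<Longrightarrow> tm_in m t"
  by (induction t) simp_all

lemma tm_in_lift:
  "\<lbrakk>\<And>k. k < n \<Longrightarrow> tm_in m (\<sigma> k); k < Suc n\<rbrakk> \<Longrightarrow> tm_in (Suc m) (lift_subst \<sigma> k)"
  by (cases k) (auto simp: lift_subst_Suc intro!: tm_in_subst[of m])

lemma fm_in_subst: "\<lbrakk>fm_in \<phi> n; \<And>k. k < n \<Longrightarrow> tm_in m (\<sigma> k)\<rbrakk> \<Longrightarrow> fm_in (fm_subst \<phi> \<sigma>) m"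
proof (induction \<phi> arbitrary: n m \<sigma>)
  case (Eq s t)
  then show ?case by (auto intro: tm_in_subst)
next
  case (And \<phi> \<psi>)
  then show ?case by auto
next
  case (Disj I f)
  then show ?case by auto
next
  case (Ex \<phi>)
  then show ?case using Ex.IH[of "Suc n" "Suc m" "lift_subst \<sigma>"] tm_in_lift[of n m \<sigma>] by simp
qed auto

lemma fm_in_rename: "\<lbrakk>fm_in \<phi> n; \<And>k. k < n \<Longrightarrow> r k < m\<rbrakk> \<Longrightarrow> fm_in (fm_rename r \<phi>) m"
  by (auto simp: fm_rename_def intro: fm_in_subst)

lemma fm_in_shift: "fm_in \<phi> n \<Longrightarrow> fm_in (fm_shift \<phi>) (Suc n)"
  by (auto simp: fm_shift_def intro: fm_in_rename)

lemma fm_in_inst: "\<lbrakk>fm_in \<phi> (Suc n); tm_in n t\<rbrakk> \<Longrightarrow> fm_in (fm_inst \<phi> t) n"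
  unfolding fm_inst_def by (erule fm_in_subst) (auto split: nat.split)

lemma fm_in_mono: "\<lbrakk>fm_in \<phi> n; n \<le> m\<rbrakk> \<Longrightarrow> fm_in \<phi> m"
  using fm_in_subst[of \<phi> n m Var] by simp

lemma fm_in_Exs [simp]: "fm_in (Exs m \<phi>) n \<longleftrightarrow> fm_in \<phi> (m + n)"
  unfolding Exs_def by (induction m arbitrary: n) simp_all

lemma Exs_Suc: "Exs (Suc m) \<phi> = Ex (Exs m \<phi>)"
  by (simp add: Exs_def)

lemma fm_in_Conj [simp]: "fm_in (Conj \<phi>s) n \<longleftrightarrow> (\<forall>\<phi>\<in>set \<phi>s. fm_in \<phi> n)"
  by (induction \<phi>s) (auto simp: Conj_def)

lemma prv_fm_in: "prv T n \<phi> \<psi> \<Longrightarrow> fm_in \<phi> n \<and> fm_in \<psi> n"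
  by (induction rule: prv.induct) (auto intro: fm_in_subst fm_in_inst fm_in_shift)

lemma prv_weaken: "\<lbrakk>prv T n \<phi> \<psi>; n \<le> m\<rbrakk> \<Longrightarrow> prv T m \<phi> \<psi>"
  using prv.Subst[of T n \<phi> \<psi> m Var] by simp

lemma prv_Ex_self: "fm_in \<phi> (Suc n) \<Longrightarrow> prv T (Suc n) \<phi> (fm_shift (Ex \<phi>))"
  by (intro prv.ExI prv.Ident) simp_all

text \<open>The two formulas are equivalent but need not be equal: substitution also acts on the members of a
  disjunction outside of its index set, whose variables are not bounded by \<open>fm_in\<close>.\<close>

lemma prv_subst_cong:
  "\<lbrakk>fm_in \<phi> n; \<And>k. k < n \<Longrightarrow> \<sigma> k = \<sigma>' k; \<And>k. k < n \<Longrightarrow> tm_in m (\<sigma> k)\<rbrakk>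
    \<Longrightarrow> prv T m (fm_subst \<phi> \<sigma>) (fm_subst \<phi> \<sigma>')"
proof (induction \<phi> arbitrary: n m \<sigma> \<sigma>')
  case (Eq s t)
  have "tm_subst \<sigma> r = tm_subst \<sigma>' r" if "tm_in n r" for r
    using that Eq.prems(2) by (induction r) simp_all
  then show ?case using Eq fm_in_subst[OF Eq.prems(1), of m \<sigma>] prv.Ident by force
next
  case Top
  then show ?case by (simp add: prv.Ident)
next
  case (And \<phi> \<psi>)
  then have in1: "fm_in (fm_subst \<phi> \<sigma>) m" "fm_in (fm_subst \<psi> \<sigma>) m" by (auto intro: fm_in_subst)
  have "prv T m (fm_subst \<phi> \<sigma>) (fm_subst \<phi> \<sigma>')" "prv T m (fm_subst \<psi> \<sigma>) (fm_subst \<psi> \<sigma>')"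
    using And.prems by (auto intro!: And.IH[of n])
  then show ?case
    using in1 by (auto intro!: prv.AndI intro: prv.Cut prv.AndE1 prv.AndE2)
next
  case (Disj I f)
  have in2: "fm_in (fm_subst (Disj I f) \<sigma>') m"
    using Disj.prems by (intro fm_in_subst[of _ n]) auto
  have "prv T m (fm_subst (f i) \<sigma>) (Disj I (\<lambda>i. fm_subst (f i) \<sigma>'))" if i: "i \<in> I" for i
  proof -
    have "prv T m (fm_subst (f i) \<sigma>) (fm_subst (f i) \<sigma>')"
      using i Disj.prems by (intro Disj.IH[of "f i" n]) auto
    moreover have "prv T m (fm_subst (f i) \<sigma>') (Disj I (\<lambda>i. fm_subst (f i) \<sigma>'))"
      using in2 i by (intro prv.DisjI[where f = "\<lambda>i. fm_subst (f i) \<sigma>'"]) simp_all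
    ultimately show ?thesis by (rule prv.Cut)
  qed
  then show ?case using in2 by (auto intro: prv.DisjE)
next
  case (Ex \<phi>)
  have in2: "fm_in (fm_subst (Ex \<phi>) \<sigma>') m"
    using Ex.prems by (intro fm_in_subst[of _ n]) auto
  have "prv T (Suc m) (fm_subst \<phi> (lift_subst \<sigma>)) (fm_subst \<phi> (lift_subst \<sigma>'))"
  proof (rule Ex.IH[of "Suc n"])
    fix k assume "k < Suc n"
    then show "lift_subst \<sigma> k = lift_subst \<sigma>' k" "tm_in (Suc m) (lift_subst \<sigma> k)"
      using Ex.prems tm_in_lift[of n m \<sigma> k] by (cases k; simp add: lift_subst_Suc)+
  qed (use Ex.prems in simp)
  moreover have "prv T (Suc m) (fm_subst \<phi> (lift_subst \<sigma>')) (fm_shift (fm_subst (Ex \<phi>) \<sigma>'))"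
    using in2 by (simp add: prv_Ex_self)
  ultimately show ?case using in2 by (auto intro: prv.ExE prv.Cut)
qed

text \<open>The calculus is used below in the style of Kripke-Joyal semantics. A stage is a context \<open>k\<close> with a formula \<open>\<chi>\<close> in
  this context, the elements at a stage are the terms in context \<open>k\<close>, and \<open>\<phi>\<close> is true of the list \<open>ts\<close> of elements if
  \<open>prv T k \<chi> (holds \<phi> ts)\<close>. A stage \<open>(k', \<chi>')\<close> is later than \<open>(k, \<chi>)\<close> if \<open>k \<le> k'\<close> and \<open>prv T k' \<chi>' \<chi>\<close>. An existential
  statement may be used by passing to a later stage at which there is a witness. In this way the
  derivations needed for the syntactic category become ordinary reasoning about elements.\<close>

definition tms_in :: "nat \<Rightarrow> tm list \<Rightarrow> bool" where
  "tms_in k ts \<longleftrightarrow> (\<forall>t\<in>set ts. tm_in k t)"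

lemma tms_in_simps [simp]:
  "tms_in k []" "tms_in k (t # ts) \<longleftrightarrow> tm_in k t \<and> tms_in k ts"
  "tms_in k (ss @ ts) \<longleftrightarrow> tms_in k ss \<and> tms_in k ts"
  by (auto simp: tms_in_def)

lemma tms_in_mono: "\<lbrakk>tms_in k ts; k \<le> k'\<rbrakk> \<Longrightarrow> tms_in k' ts"
  by (auto simp: tms_in_def intro: tm_in_mono)

lemma tms_in_nth: "\<lbrakk>tms_in k ts; i < length ts\<rbrakk> \<Longrightarrow> tm_in k (ts ! i)"
  by (auto simp: tms_in_def)

lemma tms_in_Var [simp]: "b \<le> k \<Longrightarrow> tms_in k (map Var [a..<b])"
  by (auto simp: tms_in_def)

abbreviation holds :: "'i fm \<Rightarrow> tm list \<Rightarrow> 'i fm" where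
  "holds \<phi> ts \<equiv> fm_subst \<phi> (env ts (\<lambda>_. Zero))"

lemma env_Zero_tm_in: "tms_in k ts \<Longrightarrow> tm_in k (env ts (\<lambda>_. Zero) i)"
  by (auto simp: env_def tms_in_nth)

lemma fm_in_holds: "\<lbrakk>fm_in \<phi> n; tms_in k ts\<rbrakk> \<Longrightarrow> fm_in (holds \<phi> ts) k"
  by (erule fm_in_subst) (rule env_Zero_tm_in)

lemma prv_cong:
  assumes "prv T k \<chi> (fm_subst \<phi> e)" "fm_in \<phi> n" "\<And>i. i < n \<Longrightarrow> e i = e' i" "\<And>i. i < n \<Longrightarrow> tm_in k (e i)"
  shows "prv T k \<chi> (fm_subst \<phi> e')"
  using assms(1) prv_subst_cong[of \<phi> n e e' k T] assms(2-4) by (blast intro: prv.Cut)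

lemma prv_And_iff: "prv T k \<chi> (And \<phi> \<psi>) \<longleftrightarrow> prv T k \<chi> \<phi> \<and> prv T k \<chi> \<psi>"
proof
  assume h: "prv T k \<chi> (And \<phi> \<psi>)"
  then have "fm_in \<phi> k" "fm_in \<psi> k" using prv_fm_in by fastforce+
  then show "prv T k \<chi> \<phi> \<and> prv T k \<chi> \<psi>"
    using h by (blast intro: prv.AndE1 prv.AndE2 prv.Cut)
qed (blast intro: prv.AndI)

lemma prv_Conj_iff:
  "fm_in \<chi> k \<Longrightarrow> prv T k \<chi> (fm_subst (Conj \<phi>s) e) \<longleftrightarrow> (\<forall>\<phi>\<in>set \<phi>s. prv T k \<chi> (fm_subst \<phi> e))"
proof (induction \<phi>s)
  case (Cons \<phi> \<phi>s)
  have "Conj (\<phi> # \<phi>s) = And \<phi> (Conj \<phi>s)" by (simp add: Conj_def)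
  then show ?case using Cons by (simp add: prv_And_iff)
qed (simp add: Conj_def prv.TopI)

lemma prv_Ex_intro:
  assumes "prv T k \<chi> (fm_subst \<phi> (case_nat t e))" "fm_in (Ex \<phi>) n" "tm_in k t"
    and e: "\<And>i. i < n \<Longrightarrow> tm_in k (e i)"
  shows "prv T k \<chi> (fm_subst (Ex \<phi>) e)"
proof -
  let ?\<psi> = "fm_subst \<phi> (lift_subst e)"
  have "fm_in (fm_subst (Ex \<phi>) e) k" using assms(2) e by (rule fm_in_subst)
  then have "prv T (Suc k) ?\<psi> (fm_shift (Ex ?\<psi>))" by (intro prv_Ex_self) simp
  then have "prv T k (fm_subst ?\<psi> (case_nat t Var)) (fm_subst (fm_shift (Ex ?\<psi>)) (case_nat t Var))"
    by (rule prv.Subst) (use assms(3) in \<open>auto split: nat.split\<close>)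
  moreover have "fm_subst ?\<psi> (case_nat t Var) = fm_subst \<phi> (case_nat t e)"
  proof -
    have "(\<lambda>i. tm_subst (case_nat t Var) (lift_subst e i)) = case_nat t e"
      by (auto simp: fun_eq_iff lift_subst_def tm_subst_subst split: nat.split)
    then show ?thesis by (simp add: fm_subst_subst)
  qed
  moreover have "fm_subst (fm_shift (Ex ?\<psi>)) (case_nat t Var) = Ex ?\<psi>"
    unfolding fm_shift_def fm_subst_rename by (simp del: fm_subst.simps)
  ultimately show ?thesis using assms(1) by (auto intro: prv.Cut)
qed

text \<open>The rule for existential elimination: the conclusion need only be derived at all later stages
  that have a witness.\<close>

lemma prv_Ex_elim:
  assumes ex: "prv T k \<chi> (fm_subst (Ex \<phi>) e)" and "fm_in (Ex \<phi>) n"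
    and e: "\<And>i. i < n \<Longrightarrow> tm_in k (e i)" and \<rho>: "fm_in \<rho> k"
    and step: "\<And>k' \<chi>' t. \<lbrakk>k \<le> k'; prv T k' \<chi>' \<chi>; tm_in k' t;
      prv T k' \<chi>' (fm_subst \<phi> (case_nat t e))\<rbrakk> \<Longrightarrow> prv T k' \<chi>' \<rho>"
  shows "prv T k \<chi> \<rho>"
proof -
  \<comment> \<open>The witness is \<open>Var k\<close>, a fresh variable added at the outer end of the context, so that
    \<open>\<chi>\<close>, \<open>\<rho>\<close> and \<open>e\<close> need not be shifted.\<close>
  have \<chi>: "fm_in \<chi> k" using ex prv_fm_in by blast
  let ?\<phi>' = "fm_subst \<phi> (case_nat (Var k) e)" and ?\<psi> = "fm_subst \<phi> (lift_subst e)"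
  let ?r = "\<lambda>i. if i = k then 0 else Suc i"
  have \<phi>': "fm_in ?\<phi>' (Suc k)"
    using assms(2) by (rule fm_in_subst[OF fm_in.simps(5)[THEN iffD1]])
      (auto split: nat.split intro: tm_in_mono[OF e])
  have \<psi>: "fm_in (Ex ?\<psi>) k" using fm_in_subst[OF assms(2) e] by simp
  have \<chi>': "fm_in \<chi> (Suc k)" using \<chi> by (rule fm_in_mono) simp
  have "prv T (Suc k) (And \<chi> ?\<phi>') \<rho>"
    using \<chi>' \<phi>' by (intro step[where t = "Var k"] prv.AndE1 prv.AndE2) simp_all
  then have "prv T (Suc k) (fm_subst (And \<chi> ?\<phi>') (\<lambda>i. Var (?r i))) (fm_subst \<rho> (\<lambda>i. Var (?r i)))"
    by (rule prv.Subst) auto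
  moreover have "prv T (Suc k) (fm_subst \<rho> (\<lambda>i. Var (?r i))) (fm_shift \<rho>)"
    unfolding fm_shift_def fm_rename_def using \<rho> by (rule prv_subst_cong) auto
  moreover have "prv T (Suc k) (fm_shift \<chi>) (fm_subst \<chi> (\<lambda>i. Var (?r i)))"
    unfolding fm_shift_def fm_rename_def using \<chi> by (rule prv_subst_cong) auto
  moreover have "prv T (Suc k) ?\<psi> (fm_subst ?\<phi>' (\<lambda>i. Var (?r i)))"
    unfolding fm_subst_subst
  proof (rule prv_subst_cong)
    show "fm_in \<phi> (Suc n)" using assms(2) by simp
    fix i assume i: "i < Suc n"
    show "tm_in (Suc k) (lift_subst e i)" using tm_in_lift[of n k e i] e i by simp
    have eq: "tm_subst (\<lambda>i. Var (Suc i)) t = tm_subst (\<lambda>i. Var (?r i)) t" if "tm_in k t" for t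
      using that by (induction t) auto
    show "lift_subst e i = tm_subst (\<lambda>i. Var (?r i)) (case_nat (Var k) e i)"
      using i eq[OF e] by (cases i) (simp_all add: lift_subst_Suc)
  qed
  moreover have "prv T (Suc k) (And (fm_shift \<chi>) ?\<psi>) (fm_shift \<chi>)"
    and "prv T (Suc k) (And (fm_shift \<chi>) ?\<psi>) ?\<psi>"
    using \<psi> fm_in_shift[OF \<chi>] by (simp_all add: prv.AndE1 prv.AndE2)
  ultimately have "prv T (Suc k) (And (fm_shift \<chi>) ?\<psi>) (fm_shift \<rho>)"
    unfolding fm_subst.simps by (blast intro: prv.AndI prv.Cut)
  then have "prv T k (Ex (And (fm_shift \<chi>) ?\<psi>)) \<rho>" using \<rho> by (rule prv.ExE)
  moreover have "prv T k (And \<chi> (Ex ?\<psi>)) (Ex (And (fm_shift \<chi>) ?\<psi>))"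
    using \<chi> \<psi> by (rule prv.Frobenius)
  moreover have "prv T k \<chi> (And \<chi> (Ex ?\<psi>))"
    using ex \<chi> by (simp add: prv.AndI prv.Ident)
  ultimately show ?thesis by (meson prv.Cut)
qed

lemma env_Cons_case: "env [t] e = case_nat t e"
  by (auto simp: env_def fun_eq_iff split: nat.split)

lemma prv_Exs_intro:
  "\<lbrakk>prv T k \<chi> (fm_subst \<phi> (env ts e)); fm_in (Exs m \<phi>) n; length ts = m; tms_in k ts;
    \<And>i. i < n \<Longrightarrow> tm_in k (e i)\<rbrakk> \<Longrightarrow> prv T k \<chi> (fm_subst (Exs m \<phi>) e)"
proof (induction m arbitrary: ts e n)
  case 0
  then show ?case by (simp add: Exs_def env_def)
next
  case (Suc m)
  obtain us t where ts: "ts = us @ [t]" using Suc.prems(3) by (cases ts rule: rev_cases) auto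
  have "prv T k \<chi> (fm_subst (Exs m \<phi>) (case_nat t e))"
    using Suc.prems by (intro Suc.IH[of us _ "Suc n"])
      (auto simp: ts env_append env_Cons_case split: nat.split)
  then show ?case
    unfolding Exs_Suc using Suc.prems by (intro prv_Ex_intro[where n = n]) (auto simp: ts)
qed

lemma prv_Exs_elim:
  assumes "prv T k \<chi> (fm_subst (Exs m \<phi>) e)" "fm_in (Exs m \<phi>) n"
    and "\<And>i. i < n \<Longrightarrow> tm_in k (e i)" "fm_in \<rho> k"
    and "\<And>k' \<chi>' ts. \<lbrakk>k \<le> k'; prv T k' \<chi>' \<chi>; tms_in k' ts; length ts = m;
      prv T k' \<chi>' (fm_subst \<phi> (env ts e))\<rbrakk> \<Longrightarrow> prv T k' \<chi>' \<rho>"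
  shows "prv T k \<chi> \<rho>"
  using assms
proof (induction m arbitrary: k \<chi> e n)
  case 0
  have "env [] e = e" by (simp add: env_def fun_eq_iff)
  moreover have "prv T k \<chi> \<chi>" using prv_fm_in[OF 0(1)] prv.Ident by blast
  ultimately show ?case
    using 0(1) 0(5)[of k \<chi> "[]"] by (simp add: Exs_def)
next
  case (Suc m)
  show ?case
  proof (rule prv_Ex_elim[OF Suc.prems(1)[unfolded Exs_Suc]])
    show "fm_in (Ex (Exs m \<phi>)) n" using Suc.prems(2) by simp
    fix k' \<chi>' t
    assume k': "k \<le> k'" and \<chi>': "prv T k' \<chi>' \<chi>" and t: "tm_in k' t"
      and ex: "prv T k' \<chi>' (fm_subst (Exs m \<phi>) (case_nat t e))"
    show "prv T k' \<chi>' \<rho>"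
    proof (rule Suc.IH[OF ex])
      show "fm_in (Exs m \<phi>) (Suc n)" using Suc.prems(2) by simp
      show "tm_in k' (case_nat t e i)" if "i < Suc n" for i
        using that t tm_in_mono[OF Suc.prems(3) k'] by (cases i) auto
      show "fm_in \<rho> k'" using Suc.prems(4) k' by (rule fm_in_mono)
      fix k'' \<chi>'' ts
      assume *: "k' \<le> k''" "prv T k'' \<chi>'' \<chi>'" "tms_in k'' ts" "length ts = m"
        "prv T k'' \<chi>'' (fm_subst \<phi> (env ts (case_nat t e)))"
      show "prv T k'' \<chi>'' \<rho>"
      proof (rule Suc.prems(5)[of k'' \<chi>'' "ts @ [t]"])
        show "prv T k'' \<chi>'' \<chi>"
          using *(2) prv_weaken[OF \<chi>' *(1)] by (rule prv.Cut)
        show "tms_in k'' (ts @ [t])" using *(3) tm_in_mono[OF t *(1)] by simp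
        show "prv T k'' \<chi>'' (fm_subst \<phi> (env (ts @ [t]) e))"
          using *(5) by (simp add: env_append env_Cons_case)
      qed (use *(1,4) k' in auto)
    qed
  qed (use Suc.prems(3,4) in auto)
qed

lemma prv_Eq_subst:
  assumes "prv T k \<chi> (Eq s t)" and "fm_in \<phi> (Suc n)" and e: "\<And>i. i < n \<Longrightarrow> tm_in k (e i)"
    and \<phi>: "prv T k \<chi> (fm_subst \<phi> (case_nat s e))"
  shows "prv T k \<chi> (fm_subst \<phi> (case_nat t e))"
proof -
  have inst: "fm_inst (fm_subst \<phi> (lift_subst e)) r = fm_subst \<phi> (case_nat r e)" for r
  proof -
    have "(\<lambda>i. tm_subst (case_nat r Var) (lift_subst e i)) = case_nat r e"
      by (auto simp: fun_eq_iff lift_subst_def tm_subst_subst split: nat.split)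
    then show ?thesis by (simp add: fm_inst_def fm_subst_subst)
  qed
  have st: "tm_in k s" "tm_in k t" using prv_fm_in[OF assms(1)] by auto
  have "fm_in (fm_subst \<phi> (lift_subst e)) (Suc k)"
    using assms(2) by (rule fm_in_subst) (rule tm_in_lift[OF e])
  from prv.EqSubst[OF st this, of T] show ?thesis
    unfolding inst using assms(1) \<phi> by (blast intro: prv.AndI prv.Cut)
qed

text \<open>The variables are replaced one after the other; renaming the variable \<open>j\<close> of \<open>\<phi>\<close> to 0 makes the axiom of
  substitution applicable.\<close>

lemma prv_Eq_cong:
  assumes eq: "\<And>i. i < n \<Longrightarrow> prv T k \<chi> (Eq (e i) (e' i))" and \<phi>: "fm_in \<phi> n"
    and pe: "prv T k \<chi> (fm_subst \<phi> e)"
  shows "prv T k \<chi> (fm_subst \<phi> e')"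
proof -
  have in_e: "tm_in k (e i)" "tm_in k (e' i)" if "i < n" for i
    using prv_fm_in[OF eq[OF that]] by auto
  have "prv T k \<chi> (fm_subst \<phi> (\<lambda>i. if i < j then e' i else e i))" if "j \<le> n" for j
    using that
  proof (induction j)
    case 0
    then show ?case using pe by simp
  next
    case (Suc j)
    let ?e = "\<lambda>i. if i < j then e' i else e i" and ?r = "\<lambda>i. if i = j then 0 else Suc i"
    have sub: "fm_subst (fm_rename ?r \<phi>) (case_nat t ?e) = fm_subst \<phi> (\<lambda>i. if i = j then t else ?e i)"
      for t
    proof -
      have "(\<lambda>i. case_nat t ?e (?r i)) = (\<lambda>i. if i = j then t else ?e i)" by auto
      then show ?thesis by (simp only: fm_subst_rename)
    qed
    have "(\<lambda>i. if i = j then e j else ?e i) = ?e" by auto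
    then have "prv T k \<chi> (fm_subst (fm_rename ?r \<phi>) (case_nat (e j) ?e))"
      using Suc unfolding sub by simp
    moreover have "fm_in (fm_rename ?r \<phi>) (Suc n)" using \<phi> by (rule fm_in_rename) auto
    moreover have "prv T k \<chi> (Eq (e j) (e' j))" using Suc.prems by (intro eq) simp
    ultimately have "prv T k \<chi> (fm_subst (fm_rename ?r \<phi>) (case_nat (e' j) ?e))"
      using in_e prv_Eq_subst[of T k \<chi> "e j" "e' j" "fm_rename ?r \<phi>" n ?e] by auto
    moreover have "(\<lambda>i. if i = j then e' j else ?e i) = (\<lambda>i. if i < Suc j then e' i else e i)"
      by auto
    ultimately show ?case unfolding sub by simp
  qed
  from this[of n] have "prv T k \<chi> (fm_subst \<phi> (\<lambda>i. if i < n then e' i else e i))" by simp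
  then show ?thesis using \<phi> by (rule prv_cong) (simp_all add: in_e)
qed

lemma prv_Eq_refl: "\<lbrakk>fm_in \<chi> k; tm_in k t\<rbrakk> \<Longrightarrow> prv T k \<chi> (Eq t t)"
  by (meson prv.Cut prv.EqRefl prv.TopI)

lemma prv_Eq_sym:
  assumes "prv T k \<chi> (Eq s t)" shows "prv T k \<chi> (Eq t s)"
proof -
  have *: "fm_in \<chi> k" "tm_in k s" "tm_in k t" using prv_fm_in[OF assms] by auto
  have "prv T k \<chi> (fm_subst (Eq (Var 0) (Var 1)) (case_nat t (\<lambda>_. s)))"
    by (rule prv_Eq_subst[OF assms, where n = 1]) (simp_all add: prv_Eq_refl *)
  then show ?thesis by simp
qed

lemma prv_Eq_trans:
  assumes "prv T k \<chi> (Eq s t)" "prv T k \<chi> (Eq t u)" shows "prv T k \<chi> (Eq s u)"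
proof -
  have *: "tm_in k s" using prv_fm_in[OF assms(1)] by auto
  have "prv T k \<chi> (fm_subst (Eq (Var 1) (Var 0)) (case_nat u (\<lambda>_. s)))"
    by (rule prv_Eq_subst[OF assms(2), where n = 1]) (simp_all add: assms(1) *)
  then show ?thesis by simp
qed

section \<open>Arrows of the syntactic category\<close>

lemma functional_total:
  assumes "functional T (n, \<phi>) (m, \<psi>) \<theta>" and xs: "tms_in k xs" "length xs = n"
    and \<phi>: "prv T k \<chi> (holds \<phi> xs)"
  shows "prv T k \<chi> (holds (Exs m \<theta>) xs)"
proof -
  have "prv T n \<phi> (Exs m \<theta>)" using assms(1) by (simp add: functional_def)
  then have "prv T k (holds \<phi> xs) (holds (Exs m \<theta>) xs)"
    by (rule prv.Subst) (use xs env_Zero_tm_in in blast)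
  then show ?thesis by (rule prv.Cut[OF \<phi>])
qed

lemma functional_typed:
  assumes f: "functional T (n, \<phi>) (m, \<psi>) \<theta>" and \<psi>: "fm_in \<psi> m"
    and xs: "tms_in k xs" "length xs = n" and ys: "tms_in k ys" "length ys = m"
    and \<theta>: "prv T k \<chi> (holds \<theta> (ys @ xs))"
  shows "prv T k \<chi> (holds \<phi> xs)" "prv T k \<chi> (holds \<psi> ys)"
proof -
  have "prv T (m + n) \<theta> (And (fm_rename (\<lambda>j. m + j) \<phi>) \<psi>)"
    using f by (simp add: functional_def)
  then have "prv T k (holds \<theta> (ys @ xs)) (holds (And (fm_rename (\<lambda>j. m + j) \<phi>) \<psi>) (ys @ xs))"
    by (rule prv.Subst) (use xs ys env_Zero_tm_in[of k "ys @ xs"] in auto)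
  then have *: "prv T k \<chi> (holds (And (fm_rename (\<lambda>j. m + j) \<phi>) \<psi>) (ys @ xs))"
    by (rule prv.Cut[OF \<theta>])
  have "(\<lambda>j. env (ys @ xs) (\<lambda>_. Zero) (m + j)) = env xs (\<lambda>_. Zero)"
    using ys(2) env_add by fastforce
  then show "prv T k \<chi> (holds \<phi> xs)"
    using * by (simp add: prv_And_iff fm_subst_rename)
  have "prv T k \<chi> (holds \<psi> (ys @ xs))" using * by (simp add: prv_And_iff)
  then show "prv T k \<chi> (holds \<psi> ys)"
    using \<psi> by (rule prv_cong)
      (use ys xs in \<open>auto simp: env_nth nth_append tms_in_nth\<close>)
qed

lemma functional_unique:
  assumes f: "functional T (n, \<phi>) (m, \<psi>) \<theta>" and xs: "tms_in k xs" "length xs = n"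
    and ys: "tms_in k ys" "length ys = m" and zs: "tms_in k zs" "length zs = m"
    and \<theta>: "prv T k \<chi> (holds \<theta> (ys @ xs))" "prv T k \<chi> (holds \<theta> (zs @ xs))" and j: "j < m"
  shows "prv T k \<chi> (Eq (ys ! j) (zs ! j))"
proof -
  let ?ts = "ys @ zs @ xs" and ?r = "\<lambda>j. if j < m then j else m + j"
  let ?eqs = "map (\<lambda>j. Eq (Var j) (Var (m + j))) [0..<m] :: _ fm list"
  have "prv T (m + m + n) (And (fm_rename ?r \<theta>) (fm_rename (\<lambda>j. m + j) \<theta>)) (Conj ?eqs)"
    using f by (simp add: functional_def)
  then have "prv T k (holds (And (fm_rename ?r \<theta>) (fm_rename (\<lambda>j. m + j) \<theta>)) ?ts)
      (holds (Conj ?eqs) ?ts)"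
    by (rule prv.Subst) (use xs ys zs env_Zero_tm_in[of k ?ts] in auto)
  moreover have "(\<lambda>j. env ?ts (\<lambda>_. Zero) (?r j)) = env (ys @ xs) (\<lambda>_. Zero)"
    using ys(2) zs(2) by (auto simp: env_append fun_eq_iff) (auto simp: env_def)
  moreover have "(\<lambda>j. env ?ts (\<lambda>_. Zero) (m + j)) = env (zs @ xs) (\<lambda>_. Zero)"
    using ys(2) env_add by fastforce
  ultimately have "prv T k (And (holds \<theta> (ys @ xs)) (holds \<theta> (zs @ xs))) (holds (Conj ?eqs) ?ts)"
    by (simp only: fm_subst.simps fm_subst_rename)
  then have "prv T k \<chi> (holds (Conj ?eqs) ?ts)"
    using \<theta> by (blast intro: prv.AndI prv.Cut)
  moreover have "fm_in \<chi> k" using prv_fm_in[OF \<theta>(1)] by blast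
  ultimately have "prv T k \<chi> (holds (Eq (Var j) (Var (m + j))) ?ts)"
    using j unfolding prv_Conj_iff[OF \<open>fm_in \<chi> k\<close>] by simp
  moreover have "env ?ts (\<lambda>_. Zero) j = ys ! j" using j ys(2) by (simp add: env_nth nth_append)
  moreover have "env ?ts (\<lambda>_. Zero) (m + j) = zs ! j"
    using j ys(2) zs(2) env_add[of ys "zs @ xs" _ j] by (simp add: env_nth nth_append)
  ultimately show ?thesis by simp
qed

text \<open>The converse of the three preceding rules, obtained by applying the hypotheses to the generic
  elements, which are the variables themselves.\<close>

lemma functionalI:
  assumes A: "fm_in \<phi> n" and B: "fm_in \<psi> m" and \<theta>: "fm_in \<theta> (m + n)"
    and total: "\<And>k \<chi> xs. \<lbrakk>tms_in k xs; length xs = n; prv T k \<chi> (holds \<phi> xs)\<rbrakk>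
      \<Longrightarrow> prv T k \<chi> (holds (Exs m \<theta>) xs)"
    and typed: "\<And>k \<chi> xs ys. \<lbrakk>tms_in k xs; length xs = n; tms_in k ys; length ys = m;
      prv T k \<chi> (holds \<theta> (ys @ xs))\<rbrakk> \<Longrightarrow> prv T k \<chi> (holds \<phi> xs) \<and> prv T k \<chi> (holds \<psi> ys)"
    and unique: "\<And>k \<chi> xs ys zs j. \<lbrakk>tms_in k xs; length xs = n; tms_in k ys; length ys = m;
      tms_in k zs; length zs = m; prv T k \<chi> (holds \<theta> (ys @ xs)); prv T k \<chi> (holds \<theta> (zs @ xs)); j < m\<rbrakk>
      \<Longrightarrow> prv T k \<chi> (Eq (ys ! j) (zs ! j))"
  shows "functional T (n, \<phi>) (m, \<psi>) \<theta>"
proof -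
  have cong: "prv T k (fm_subst \<xi> e) (fm_subst \<xi> e')"
    if "fm_in \<xi> p" "\<And>i. i < p \<Longrightarrow> e i = e' i" "\<And>i. i < p \<Longrightarrow> tm_in k (e i)" for k \<xi> p e e'
    using that by (rule prv_subst_cong)
  have "prv T n \<phi> (Exs m \<theta>)"
  proof -
    let ?xs = "map Var [0..<n]"
    have "prv T n (fm_subst \<phi> Var) (holds \<phi> ?xs)"
      using A by (rule cong) (simp_all add: env_map_Var)
    then have "prv T n \<phi> (holds (Exs m \<theta>) ?xs)" by (intro total) simp_all
    moreover have "prv T n (holds (Exs m \<theta>) ?xs) (fm_subst (Exs m \<theta>) Var)"
      using \<theta> by (intro cong[where p = n]) (simp_all add: env_map_Var)
    ultimately show ?thesis by (simp add: prv.Cut)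
  qed
  moreover have "prv T (m + n) \<theta> (And (fm_rename (\<lambda>j. m + j) \<phi>) \<psi>)"
  proof -
    let ?ys = "map Var [0..<m]" and ?xs = "map Var [m..<m + n]"
    have "prv T (m + n) (fm_subst \<theta> Var) (holds \<theta> (?ys @ ?xs))"
      using \<theta> by (rule cong) (simp_all add: env_def nth_append)
    then have "prv T (m + n) \<theta> (holds \<phi> ?xs)" "prv T (m + n) \<theta> (holds \<psi> ?ys)"
      using typed[of "m + n" ?xs ?ys] by simp_all
    moreover have "prv T (m + n) (holds \<phi> ?xs) (fm_rename (\<lambda>j. m + j) \<phi>)"
      unfolding fm_rename_def using A by (rule cong) (simp_all add: env_map_Var)
    moreover have "prv T (m + n) (holds \<psi> ?ys) (fm_subst \<psi> Var)"
      using B by (rule cong) (simp_all add: env_map_Var)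
    ultimately show ?thesis by (auto intro: prv.AndI prv.Cut)
  qed
  moreover have "prv T (m + m + n)
      (And (fm_rename (\<lambda>j. if j < m then j else m + j) \<theta>) (fm_rename (\<lambda>j. m + j) \<theta>))
      (Conj (map (\<lambda>j. Eq (Var j) (Var (m + j))) [0..<m]))"
    (is "prv T ?k (And ?\<theta>1 ?\<theta>2) _")
  proof -
    let ?ys = "map Var [0..<m]" and ?zs = "map Var [m..<m + m]" and ?xs = "map Var [m + m..<?k]"
    let ?\<chi> = "And ?\<theta>1 ?\<theta>2"
    have in1: "fm_in ?\<theta>1 ?k" "fm_in ?\<theta>2 ?k" using \<theta> by (auto intro: fm_in_rename)
    have "prv T ?k ?\<theta>1 (holds \<theta> (?ys @ ?xs))"
      unfolding fm_rename_def using \<theta> by (rule cong) (auto simp: env_def nth_append)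
    then have 1: "prv T ?k ?\<chi> (holds \<theta> (?ys @ ?xs))"
      using in1 by (blast intro: prv.Cut prv.AndE1)
    have "prv T ?k ?\<theta>2 (holds \<theta> (?zs @ ?xs))"
      unfolding fm_rename_def using \<theta> by (rule cong) (auto simp: env_def nth_append)
    then have 2: "prv T ?k ?\<chi> (holds \<theta> (?zs @ ?xs))"
      using in1 by (blast intro: prv.Cut prv.AndE2)
    have "prv T ?k ?\<chi> (Eq (Var j) (Var (m + j)))" if "j < m" for j
      using unique[OF _ _ _ _ _ _ 1 2 that] that by simp
    then have "prv T ?k ?\<chi> (fm_subst (Conj (map (\<lambda>j. Eq (Var j) (Var (m + j))) [0..<m])) Var)"
      using in1 by (subst prv_Conj_iff) auto
    then show ?thesis by simp
  qed
  ultimately show ?thesis using \<theta> by (simp add: functional_def)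
qed

text \<open>The arrow \<open>(x\<^sub>0, x\<^sub>1, \<dots>) \<mapsto> (x\<^bsub>r 0\<^esub>, x\<^bsub>r 1\<^esub>, \<dots>)\<close> on \<open>{x. \<phi>}\<close>. Identities, inclusions and projections have this form.\<close>

definition var_arr :: "nat \<Rightarrow> (nat \<Rightarrow> nat) \<Rightarrow> 'i fm \<Rightarrow> 'i fm" where
  "var_arr n r \<phi> = And (fm_rename (\<lambda>j. n + j) \<phi>) (Conj (map (\<lambda>j. Eq (Var (n + r j)) (Var j)) [0..<n]))"

lemma arr_id_eq_var_arr: "arr_id (n, \<phi>) = var_arr n (\<lambda>j. j) \<phi>"
  by (simp add: arr_id_def var_arr_def)

lemma fm_in_var_arr:
  "\<lbrakk>fm_in \<phi> p; \<And>j. j < n \<Longrightarrow> r j < p\<rbrakk> \<Longrightarrow> fm_in (var_arr n r \<phi>) (n + p)"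
  by (auto simp: var_arr_def intro: fm_in_rename)

lemma holds_var_arr:
  assumes xs: "tms_in k xs" "length xs = p" and ys: "length ys = n" and \<chi>: "fm_in \<chi> k"
    and r: "\<And>j. j < n \<Longrightarrow> r j < p"
  shows "prv T k \<chi> (holds (var_arr n r \<phi>) (ys @ xs)) \<longleftrightarrow>
    prv T k \<chi> (holds \<phi> xs) \<and> (\<forall>j<n. prv T k \<chi> (Eq (xs ! r j) (ys ! j)))"
proof -
  have 1: "(\<lambda>j. env (ys @ xs) (\<lambda>_. Zero) (n + j)) = env xs (\<lambda>_. Zero)"
    using ys env_add by fastforce
  have "env (ys @ xs) (\<lambda>_. Zero) (n + r j) = xs ! r j" "env (ys @ xs) (\<lambda>_. Zero) j = ys ! j"
    if "j < n" for j
    using that xs ys r[OF that] env_add[of ys xs _ "r j"] by (simp_all add: env_nth nth_append)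
  then show ?thesis
    by (auto simp: var_arr_def prv_And_iff prv_Conj_iff[OF \<chi>] fm_subst_rename 1)
qed

lemma functional_var_arr:
  assumes \<phi>: "fm_in \<phi> p" and \<psi>: "fm_in \<psi> n" and r: "\<And>j. j < n \<Longrightarrow> r j < p"
    and imp: "\<And>k \<chi> xs. \<lbrakk>tms_in k xs; length xs = p; prv T k \<chi> (holds \<phi> xs)\<rbrakk>
      \<Longrightarrow> prv T k \<chi> (holds \<psi> (map (\<lambda>j. xs ! r j) [0..<n]))"
  shows "functional T (p, \<phi>) (n, \<psi>) (var_arr n r \<phi>)"
proof (rule functionalI[OF \<phi> \<psi>])
  show "fm_in (var_arr n r \<phi>) (n + p)" by (rule fm_in_var_arr[OF \<phi> r])
  fix k \<chi> xs
  assume xs: "tms_in k xs" "length xs = p"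
  let ?us = "map (\<lambda>j. xs ! r j) [0..<n]"
  have us: "tms_in k ?us" using xs r by (auto simp: tms_in_def)
  {
    assume q: "prv T k \<chi> (holds \<phi> xs)"
    then have \<chi>: "fm_in \<chi> k" using prv_fm_in by blast
    have "prv T k \<chi> (holds (var_arr n r \<phi>) (?us @ xs))"
      using q \<chi> xs r by (subst holds_var_arr[where p = p]) (auto intro!: prv_Eq_refl tms_in_nth)
    then show "prv T k \<chi> (holds (Exs n (var_arr n r \<phi>)) xs)"
      unfolding env_append
      by (rule prv_Exs_intro[where n = p])
        (use us xs fm_in_var_arr[OF \<phi> r] env_Zero_tm_in[OF xs(1)] in auto)
  next
    fix ys
    assume ys: "tms_in k ys" "length ys = n" and q: "prv T k \<chi> (holds (var_arr n r \<phi>) (ys @ xs))"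
    then have \<chi>: "fm_in \<chi> k" using prv_fm_in by blast
    have q': "prv T k \<chi> (holds \<phi> xs)" "\<forall>j<n. prv T k \<chi> (Eq (xs ! r j) (ys ! j))"
      using q holds_var_arr[OF xs ys(2) \<chi> r] by auto
    have "prv T k \<chi> (holds \<psi> ys)"
      by (rule prv_Eq_cong[OF _ \<psi> imp[OF xs q'(1)]]) (use q' ys in \<open>auto simp: env_nth\<close>)
    then show "prv T k \<chi> (holds \<phi> xs) \<and> prv T k \<chi> (holds \<psi> ys)" using q' by simp
    fix zs j
    assume zs: "tms_in k zs" "length zs = n" and z: "prv T k \<chi> (holds (var_arr n r \<phi>) (zs @ xs))"
      and j: "j < n"
    have "\<forall>j<n. prv T k \<chi> (Eq (xs ! r j) (zs ! j))"
      using z holds_var_arr[OF xs zs(2) \<chi> r] by auto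
    then show "prv T k \<chi> (Eq (ys ! j) (zs ! j))"
      using q' j prv_Eq_sym prv_Eq_trans by blast
  }
qed

lemma fm_in_arr_id: "fm_in \<phi> n \<Longrightarrow> fm_in (arr_id (n, \<phi>)) (n + n)"
  by (simp add: arr_id_eq_var_arr fm_in_var_arr)

lemma functional_arr_id:
  assumes \<phi>: "fm_in \<phi> n" and \<psi>: "fm_in \<psi> n" and imp: "prv T n \<phi> \<psi>"
  shows "functional T (n, \<phi>) (n, \<psi>) (arr_id (n, \<phi>))"
  unfolding arr_id_eq_var_arr
proof (rule functional_var_arr[OF \<phi> \<psi>])
  fix k \<chi> xs
  assume xs: "tms_in k xs" "length xs = n" and q: "prv T k \<chi> (holds \<phi> xs)"
  have "prv T k (holds \<phi> xs) (holds \<psi> xs)"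
    using imp by (rule prv.Subst) (use xs env_Zero_tm_in in blast)
  then show "prv T k \<chi> (holds \<psi> (map (\<lambda>j. xs ! j) [0..<n]))"
    using q xs(2) map_nth[of xs] by (auto intro: prv.Cut)
qed

lemma fm_in_arr_comp:
  "\<lbrakk>fm_in \<theta> (m + n); fm_in \<gamma> (k + m)\<rbrakk> \<Longrightarrow> fm_in (arr_comp m k \<gamma> \<theta>) (k + n)"
  by (auto simp: arr_comp_def intro!: fm_in_rename)

text \<open>The matrix of \<open>arr_comp\<close> at elements: the renamings in its definition pick \<open>\<theta>(x, y)\<close> and \<open>\<gamma>(y, z)\<close>.\<close>

lemma holds_arr_comp_body:
  assumes \<gamma>: "fm_in \<gamma> (p + m)" and xs: "tms_in k xs"
    and ys: "tms_in k ys" "length ys = m" and zs: "tms_in k zs" "length zs = p"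
  shows "prv T k \<chi> (fm_subst (And (fm_rename (\<lambda>j. if j < m then j else j + p) \<theta>)
       (fm_rename (\<lambda>j. if j < p then m + j else j - p) \<gamma>)) (env ys (env (zs @ xs) (\<lambda>_. Zero))))
    \<longleftrightarrow> prv T k \<chi> (holds \<theta> (ys @ xs)) \<and> prv T k \<chi> (holds \<gamma> (zs @ ys))"
proof -
  let ?e = "env ys (env (zs @ xs) (\<lambda>_. Zero))"
  have 1: "(\<lambda>j. ?e (if j < m then j else j + p)) = env (ys @ xs) (\<lambda>_. Zero)"
    using ys(2) zs(2) by (auto simp: env_append fun_eq_iff) (auto simp: env_def)
  let ?e2 = "\<lambda>j. ?e (if j < p then m + j else j - p)"
  have agree: "?e2 i = env (zs @ ys) (\<lambda>_. Zero) i" if "i < p + m" for i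
    using that ys(2) zs(2) by (auto simp: env_append env_def)
  have ins: "tm_in k (env (zs @ ys) (\<lambda>_. Zero) i)" for i
    using ys zs by (intro env_Zero_tm_in) simp
  have "prv T k \<chi> (fm_subst \<gamma> ?e2) \<longleftrightarrow> prv T k \<chi> (holds \<gamma> (zs @ ys))"
  proof
    assume "prv T k \<chi> (fm_subst \<gamma> ?e2)"
    then show "prv T k \<chi> (holds \<gamma> (zs @ ys))"
      using \<gamma> by (rule prv_cong) (simp_all only: agree ins)
  next
    assume "prv T k \<chi> (holds \<gamma> (zs @ ys))"
    then show "prv T k \<chi> (fm_subst \<gamma> ?e2)"
      using \<gamma> by (rule prv_cong) (simp_all only: agree ins)
  qed
  then show ?thesis
    unfolding fm_subst.simps prv_And_iff fm_subst_rename 1 by simp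
qed

lemma arr_comp_intro:
  assumes "fm_in \<theta> (m + n)" "fm_in \<gamma> (p + m)" and xs: "tms_in k xs" "length xs = n"
    and ys: "tms_in k ys" "length ys = m" and zs: "tms_in k zs" "length zs = p"
    and "prv T k \<chi> (holds \<theta> (ys @ xs))" "prv T k \<chi> (holds \<gamma> (zs @ ys))"
  shows "prv T k \<chi> (holds (arr_comp m p \<gamma> \<theta>) (zs @ xs))"
  unfolding arr_comp_def
proof (rule prv_Exs_intro)
  show "prv T k \<chi> (fm_subst (And (fm_rename (\<lambda>j. if j < m then j else j + p) \<theta>)
       (fm_rename (\<lambda>j. if j < p then m + j else j - p) \<gamma>)) (env ys (env (zs @ xs) (\<lambda>_. Zero))))"
    unfolding holds_arr_comp_body[OF assms(2) xs(1) ys zs] using assms(9,10) by simp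
  show "fm_in (Exs m (And (fm_rename (\<lambda>j. if j < m then j else j + p) \<theta>)
       (fm_rename (\<lambda>j. if j < p then m + j else j - p) \<gamma>))) (p + n)"
    using fm_in_arr_comp[OF assms(1,2)] by (simp add: arr_comp_def)
  show "tm_in k (env (zs @ xs) (\<lambda>_. Zero) i)" for i
    using xs zs by (intro env_Zero_tm_in) simp
qed (rule ys)+

lemma arr_comp_elim:
  assumes ac: "prv T k \<chi> (holds (arr_comp m p \<gamma> \<theta>) (zs @ xs))"
    and in1: "fm_in \<theta> (m + n)" and in2: "fm_in \<gamma> (p + m)" and xs: "tms_in k xs" "length xs = n"
    and zs: "tms_in k zs" "length zs = p" and \<rho>: "fm_in \<rho> k"
    and step: "\<And>k' \<chi>' ys. \<lbrakk>k \<le> k'; prv T k' \<chi>' \<chi>; tms_in k' ys; length ys = m;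
      prv T k' \<chi>' (holds \<theta> (ys @ xs)); prv T k' \<chi>' (holds \<gamma> (zs @ ys))\<rbrakk> \<Longrightarrow> prv T k' \<chi>' \<rho>"
  shows "prv T k \<chi> \<rho>"
proof (rule prv_Exs_elim[OF ac[unfolded arr_comp_def]])
  show "fm_in (Exs m (And (fm_rename (\<lambda>j. if j < m then j else j + p) \<theta>)
       (fm_rename (\<lambda>j. if j < p then m + j else j - p) \<gamma>))) (p + n)"
    using fm_in_arr_comp[OF in1 in2] by (simp add: arr_comp_def)
  show "tm_in k (env (zs @ xs) (\<lambda>_. Zero) i)" for i
    using xs zs by (intro env_Zero_tm_in) simp
  fix k' \<chi>' ys
  assume k': "k \<le> k'" and \<chi>': "prv T k' \<chi>' \<chi>" and ys: "tms_in k' ys" "length ys = m"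
    and b: "prv T k' \<chi>' (fm_subst (And (fm_rename (\<lambda>j. if j < m then j else j + p) \<theta>)
       (fm_rename (\<lambda>j. if j < p then m + j else j - p) \<gamma>)) (env ys (env (zs @ xs) (\<lambda>_. Zero))))"
  then have "prv T k' \<chi>' (holds \<theta> (ys @ xs)) \<and> prv T k' \<chi>' (holds \<gamma> (zs @ ys))"
    using holds_arr_comp_body[OF in2 tms_in_mono[OF xs(1) k'] ys tms_in_mono[OF zs(1) k'] zs(2)]
    by blast
  then show "prv T k' \<chi>' \<rho>" using step k' \<chi>' ys by blast
qed (rule \<rho>)

lemma prv_mono: "\<lbrakk>prv T k \<chi> \<phi>; k \<le> k'; prv T k' \<chi>' \<chi>\<rbrakk> \<Longrightarrow> prv T k' \<chi>' \<phi>"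
  by (blast intro: prv.Cut prv_weaken)

text \<open>Composites of provably functional formulas are provably functional; without this, \<open>Cmp\<close> might
  return the empty class.\<close>

lemma functional_arr_comp:
  assumes A: "fm_in \<phi> n" and B: "fm_in \<psi> m" and C: "fm_in \<xi> p"
    and f: "functional T (n, \<phi>) (m, \<psi>) \<theta>" and g: "functional T (m, \<psi>) (p, \<xi>) \<gamma>"
  shows "functional T (n, \<phi>) (p, \<xi>) (arr_comp m p \<gamma> \<theta>)"
proof (rule functionalI[OF A C])
  have \<theta>: "fm_in \<theta> (m + n)" and \<gamma>: "fm_in \<gamma> (p + m)"
    using f g by (auto simp: functional_def)
  show ac: "fm_in (arr_comp m p \<gamma> \<theta>) (p + n)" by (rule fm_in_arr_comp[OF \<theta> \<gamma>])
  fix k \<chi> xs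
  assume xs: "tms_in k xs" "length xs = n"
  {
    assume "prv T k \<chi> (holds \<phi> xs)"
    then have ex: "prv T k \<chi> (holds (Exs m \<theta>) xs)" by (rule functional_total[OF f xs])
    have goal: "fm_in (holds (Exs p (arr_comp m p \<gamma> \<theta>)) xs) k"
      using ac xs(1) by (intro fm_in_holds[of _ n]) simp_all
    show "prv T k \<chi> (holds (Exs p (arr_comp m p \<gamma> \<theta>)) xs)"
    proof (rule prv_Exs_elim[OF ex])
      show "fm_in (Exs m \<theta>) n" using \<theta> by simp
      show "tm_in k (env xs (\<lambda>_. Zero) i)" for i using xs by (intro env_Zero_tm_in)
      fix k' \<chi>' ys
      assume k': "k \<le> k'" and \<chi>': "prv T k' \<chi>' \<chi>" and ys: "tms_in k' ys" "length ys = m"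
        and "prv T k' \<chi>' (fm_subst \<theta> (env ys (env xs (\<lambda>_. Zero))))"
      then have yx: "prv T k' \<chi>' (holds \<theta> (ys @ xs))" by (simp add: env_append)
      have xs': "tms_in k' xs" using xs(1) k' by (rule tms_in_mono)
      have "prv T k' \<chi>' (holds \<psi> ys)" by (rule functional_typed(2)[OF f B xs' xs(2) ys yx])
      then have ex': "prv T k' \<chi>' (holds (Exs p \<gamma>) ys)" by (rule functional_total[OF g ys])
      show "prv T k' \<chi>' (holds (Exs p (arr_comp m p \<gamma> \<theta>)) xs)"
      proof (rule prv_Exs_elim[OF ex'])
        show "fm_in (Exs p \<gamma>) m" using \<gamma> by simp
        show "tm_in k' (env ys (\<lambda>_. Zero) i)" for i using ys by (intro env_Zero_tm_in)
        show "fm_in (holds (Exs p (arr_comp m p \<gamma> \<theta>)) xs) k'" using goal k' by (rule fm_in_mono)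
        fix k'' \<chi>'' zs
        assume k'': "k' \<le> k''" and \<chi>'': "prv T k'' \<chi>'' \<chi>'" and zs: "tms_in k'' zs" "length zs = p"
          and "prv T k'' \<chi>'' (fm_subst \<gamma> (env zs (env ys (\<lambda>_. Zero))))"
        then have zy: "prv T k'' \<chi>'' (holds \<gamma> (zs @ ys))" by (simp add: env_append)
        have xs'': "tms_in k'' xs" and ys'': "tms_in k'' ys"
          using xs' ys(1) k'' by (auto intro: tms_in_mono)
        have "prv T k'' \<chi>'' (holds (arr_comp m p \<gamma> \<theta>) (zs @ xs))"
          by (rule arr_comp_intro[OF \<theta> \<gamma> xs'' xs(2) ys'' ys(2) zs prv_mono[OF yx k'' \<chi>''] zy])
        then show "prv T k'' \<chi>'' (holds (Exs p (arr_comp m p \<gamma> \<theta>)) xs)"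
          unfolding env_append
          by (rule prv_Exs_intro[where n = n])
            (use ac zs env_Zero_tm_in[OF xs''] in auto)
      qed
    qed (rule goal)
  next
    fix zs
    assume zs: "tms_in k zs" "length zs = p" and h: "prv T k \<chi> (holds (arr_comp m p \<gamma> \<theta>) (zs @ xs))"
    have "prv T k \<chi> (holds \<phi> xs)"
      using h \<theta> \<gamma> xs zs
    proof (rule arr_comp_elim)
      show "fm_in (holds \<phi> xs) k" using A xs by (intro fm_in_holds[of _ n])
      fix k' \<chi>' ys
      assume k': "k \<le> k'" and ys: "tms_in k' ys" "length ys = m" and yx: "prv T k' \<chi>' (holds \<theta> (ys @ xs))"
      show "prv T k' \<chi>' (holds \<phi> xs)"
        by (rule functional_typed(1)[OF f B tms_in_mono[OF xs(1) k'] xs(2) ys yx])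
    qed
    moreover have "prv T k \<chi> (holds \<xi> zs)"
      using h \<theta> \<gamma> xs zs
    proof (rule arr_comp_elim)
      show "fm_in (holds \<xi> zs) k" using C zs by (intro fm_in_holds[of _ p])
      fix k' \<chi>' ys
      assume k': "k \<le> k'" and ys: "tms_in k' ys" "length ys = m" and zy: "prv T k' \<chi>' (holds \<gamma> (zs @ ys))"
      show "prv T k' \<chi>' (holds \<xi> zs)"
        by (rule functional_typed(2)[OF g C ys tms_in_mono[OF zs(1) k'] zs(2) zy])
    qed
    ultimately show "prv T k \<chi> (holds \<phi> xs) \<and> prv T k \<chi> (holds \<xi> zs)" ..
    fix us j
    assume us: "tms_in k us" "length us = p"
      and h': "prv T k \<chi> (holds (arr_comp m p \<gamma> \<theta>) (us @ xs))" and j: "j < p"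
    have goal: "fm_in (Eq (zs ! j) (us ! j)) k" using zs us j by (simp add: tms_in_nth)
    show "prv T k \<chi> (Eq (zs ! j) (us ! j))"
      using h \<theta> \<gamma> xs zs goal
    proof (rule arr_comp_elim)
      fix k' \<chi>' ys
      assume k': "k \<le> k'" and \<chi>': "prv T k' \<chi>' \<chi>" and ys: "tms_in k' ys" "length ys = m"
        and yx: "prv T k' \<chi>' (holds \<theta> (ys @ xs))" and zy: "prv T k' \<chi>' (holds \<gamma> (zs @ ys))"
      have xs': "tms_in k' xs" and zs': "tms_in k' zs" and us': "tms_in k' us"
        using xs(1) zs(1) us(1) k' by (auto intro: tms_in_mono)
      show "prv T k' \<chi>' (Eq (zs ! j) (us ! j))"
        using prv_mono[OF h' k' \<chi>'] \<theta> \<gamma> xs' xs(2) us' us(2) fm_in_mono[OF goal k']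
      proof (rule arr_comp_elim)
        fix k'' \<chi>'' vs
        assume k'': "k' \<le> k''" and \<chi>'': "prv T k'' \<chi>'' \<chi>'" and vs: "tms_in k'' vs" "length vs = m"
          and vx: "prv T k'' \<chi>'' (holds \<theta> (vs @ xs))" and uv: "prv T k'' \<chi>'' (holds \<gamma> (us @ vs))"
        have xs'': "tms_in k'' xs" and ys'': "tms_in k'' ys" and zs'': "tms_in k'' zs"
          and us'': "tms_in k'' us"
          using xs' ys(1) zs' us' k'' by (auto intro: tms_in_mono)
        have vy: "prv T k'' \<chi>'' (Eq (vs ! i) (ys ! i))" if "i < m" for i
          by (rule functional_unique[OF f xs'' xs(2) vs ys'' ys(2) vx prv_mono[OF yx k'' \<chi>''] that])
        have \<chi>''_in: "fm_in \<chi>'' k''" using prv_fm_in[OF vx] by blast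
        have "prv T k'' \<chi>'' (holds \<gamma> (us @ ys))"
        proof (rule prv_Eq_cong[OF _ \<gamma> uv])
          fix i assume i: "i < p + m"
          show "prv T k'' \<chi>'' (Eq (env (us @ vs) (\<lambda>_. Zero) i) (env (us @ ys) (\<lambda>_. Zero) i))"
          proof (cases "i < p")
            case True
            then show ?thesis using us us'' \<chi>''_in by (simp add: env_nth nth_append prv_Eq_refl tms_in_nth)
          next
            case False
            then show ?thesis using us vs ys i vy[of "i - p"] by (simp add: env_nth nth_append)
          qed
        qed
        then show "prv T k'' \<chi>'' (Eq (zs ! j) (us ! j))"
          using functional_unique[OF g ys'' ys(2) zs'' zs(2) us'' us(2) prv_mono[OF zy k'' \<chi>''] _ j]
          by blast
      qed
    qed
  }
qed

lemma arr_image_intro: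
  assumes A: "fm_in \<theta> (m + n)" and xs: "tms_in k xs" "length xs = n" and ys: "tms_in k ys" "length ys = m"
    and h: "prv T k \<chi> (holds \<theta> (ys @ xs))"
  shows "prv T k \<chi> (holds (arr_image n m \<theta>) ys)"
proof -
  let ?r = "\<lambda>j. if j < m then n + j else j - m"
  have in1: "fm_in (fm_rename ?r \<theta>) (n + m)" using A by (rule fm_in_rename) auto
  have "prv T k \<chi> (fm_subst (fm_rename ?r \<theta>) (env xs (env ys (\<lambda>_. Zero))))"
    unfolding fm_subst_rename using h A
    by (rule prv_cong) (use xs ys in \<open>auto simp: env_def nth_append tms_in_nth\<close>)
  then show ?thesis
    unfolding arr_image_def
    by (rule prv_Exs_intro[where n = m]) (use in1 xs env_Zero_tm_in[OF ys(1)] in auto)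
qed

lemma prv_arr_image_inclusion:
  assumes \<phi>: "fm_in \<phi> n"
  shows "prv T n \<phi> (arr_image n n (arr_id (n, \<phi>)))"
proof -
  let ?xs = "map Var [0..<n]"
  have "prv T n (fm_subst \<phi> Var) (holds \<phi> ?xs)"
    using \<phi> by (rule prv_subst_cong) (simp_all add: env_map_Var)
  then have "prv T n \<phi> (holds (arr_id (n, \<phi>)) (?xs @ ?xs))"
    unfolding arr_id_eq_var_arr using \<phi> by (subst holds_var_arr) (auto intro: prv_Eq_refl)
  then have "prv T n \<phi> (holds (arr_image n n (arr_id (n, \<phi>))) ?xs)"
    by (intro arr_image_intro[OF fm_in_arr_id[OF \<phi>]]) simp_all
  then have "prv T n \<phi> (fm_subst (arr_image n n (arr_id (n, \<phi>))) Var)"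
    by (rule prv_cong[where n = n])
      (use fm_in_arr_id[OF \<phi>] in \<open>auto simp: arr_image_def env_map_Var intro!: fm_in_rename[of _ "n + n"]\<close>)
  then show ?thesis by simp
qed

lemma prv_iff_holds:
  assumes \<theta>: "fm_in \<theta> p" and \<theta>': "fm_in \<theta>' p"
    and imp: "\<And>k \<chi> xs. \<lbrakk>tms_in k xs; length xs = p; prv T k \<chi> (holds \<theta> xs)\<rbrakk> \<Longrightarrow> prv T k \<chi> (holds \<theta>' xs)"
  shows "prv T p \<theta> \<theta>'"
proof -
  let ?xs = "map Var [0..<p]"
  have "prv T p (fm_subst \<theta> Var) (holds \<theta> ?xs)"
    using \<theta> by (rule prv_subst_cong) (simp_all add: env_map_Var)
  then have "prv T p \<theta> (holds \<theta>' ?xs)" by (intro imp) simp_all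
  then have "prv T p \<theta> (fm_subst \<theta>' Var)"
    using \<theta>' by (rule prv_cong) (simp_all add: env_map_Var)
  then show ?thesis by simp
qed

lemma prv_holds: "\<lbrakk>prv T p \<theta> \<theta>'; tms_in k xs; prv T k \<chi> (holds \<theta> xs)\<rbrakk> \<Longrightarrow> prv T k \<chi> (holds \<theta>' xs)"
  by (rule prv.Cut, assumption, rule prv.Subst) (auto intro: env_Zero_tm_in)

text \<open>If \<open>\<theta>\<close> maps the coordinates selected by \<open>r\<close> to those selected by \<open>s\<close>, then the composite of \<open>\<theta>\<close> with the arrow
  selecting the former is the arrow selecting the latter.\<close>

lemma prv_comp_var_arr:
  assumes \<psi>: "fm_in \<psi> m" and f: "functional T (n, \<phi>) (m, \<psi>) \<theta>"
    and \<xi>: "fm_in \<xi> p" and r: "\<And>j. j < n \<Longrightarrow> r j < p" and s: "\<And>j. j < m \<Longrightarrow> s j < p"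
    and \<gamma>: "prv T (n + p) \<gamma> (var_arr n r \<xi>)" "prv T (n + p) (var_arr n r \<xi>) \<gamma>"
    and imp: "\<And>k \<chi> ws. \<lbrakk>tms_in k ws; length ws = p; prv T k \<chi> (holds \<xi> ws)\<rbrakk> \<Longrightarrow>
      prv T k \<chi> (holds \<theta> (map (\<lambda>j. ws ! s j) [0..<m] @ map (\<lambda>j. ws ! r j) [0..<n]))"
  shows "prv T (m + p) (arr_comp n m \<theta> \<gamma>) (var_arr m s \<xi>)"
    and "prv T (m + p) (var_arr m s \<xi>) (arr_comp n m \<theta> \<gamma>)"
proof -
  have \<theta>: "fm_in \<theta> (m + n)" using f by (auto simp: functional_def)
  have \<gamma>_in: "fm_in \<gamma> (n + p)" using prv_fm_in[OF \<gamma>(1)] by blast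
  have ac: "fm_in (arr_comp n m \<theta> \<gamma>) (m + p)" by (rule fm_in_arr_comp[OF \<gamma>_in \<theta>])
  have va: "fm_in (var_arr m s \<xi>) (m + p)" by (rule fm_in_var_arr[OF \<xi> s])
  have split: "\<exists>us ws. xs = us @ ws \<and> tms_in k us \<and> length us = m \<and> tms_in k ws \<and> length ws = p"
    if "tms_in k xs" "length xs = m + p" for k xs
    using that append_take_drop_id[of m xs] by (intro exI[of _ "take m xs"] exI[of _ "drop m xs"])
      (auto simp: tms_in_def dest: in_set_takeD in_set_dropD)
  show "prv T (m + p) (arr_comp n m \<theta> \<gamma>) (var_arr m s \<xi>)"
  proof (rule prv_iff_holds[OF ac va])
    fix k \<chi> xs
    assume xs: "tms_in k xs" "length xs = m + p" and h: "prv T k \<chi> (holds (arr_comp n m \<theta> \<gamma>) xs)"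
    obtain us ws where xs_eq: "xs = us @ ws" and us: "tms_in k us" "length us = m"
      and ws: "tms_in k ws" "length ws = p"
      using split[OF xs] by blast
    show "prv T k \<chi> (holds (var_arr m s \<xi>) xs)"
    proof (rule arr_comp_elim[OF h[unfolded xs_eq] \<gamma>_in \<theta> ws us fm_in_holds[OF va xs(1)]])
      fix k' \<chi>' ys
      assume k': "k \<le> k'" and ys: "tms_in k' ys" "length ys = n"
        and g: "prv T k' \<chi>' (holds \<gamma> (ys @ ws))" and t: "prv T k' \<chi>' (holds \<theta> (us @ ys))"
      have \<chi>': "fm_in \<chi>' k'" using prv_fm_in[OF t] by blast
      have us': "tms_in k' us" and ws': "tms_in k' ws" using us(1) ws(1) k' by (auto intro: tms_in_mono)
      let ?zs = "map (\<lambda>j. ws ! s j) [0..<m]" and ?vs = "map (\<lambda>j. ws ! r j) [0..<n]"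
      have zs: "tms_in k' ?zs" "length ?zs = m" and vs: "tms_in k' ?vs" "length ?vs = n"
        using ws' ws(2) r s by (auto simp: tms_in_def)
      have "prv T k' \<chi>' (holds (var_arr n r \<xi>) (ys @ ws))"
        using \<gamma>(1) _ g by (rule prv_holds) (use ys ws' in simp)
      then have x: "prv T k' \<chi>' (holds \<xi> ws)" and e: "\<forall>j<n. prv T k' \<chi>' (Eq (ws ! r j) (ys ! j))"
        using holds_var_arr[OF ws' ws(2) ys(2) \<chi>' r] by auto
      have "prv T k' \<chi>' (holds \<theta> (?zs @ ys))"
      proof (rule prv_Eq_cong[OF _ \<theta> imp[OF ws' ws(2) x]])
        fix i assume i: "i < m + n"
        show "prv T k' \<chi>' (Eq (env (?zs @ ?vs) (\<lambda>_. Zero) i) (env (?zs @ ys) (\<lambda>_. Zero) i))"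
        proof (cases "i < m")
          case True
          then show ?thesis using \<chi>' ws' ws(2) s by (simp add: env_nth nth_append prv_Eq_refl tms_in_nth)
        next
          case False
          then have "i - m < n" using i by simp
          then show ?thesis using False e ys by (simp add: env_nth nth_append)
        qed
      qed
      then have "prv T k' \<chi>' (Eq (?zs ! j) (us ! j))" if "j < m" for j
        by (rule functional_unique[OF f ys zs us' us(2) _ t that])
      then show "prv T k' \<chi>' (holds (var_arr m s \<xi>) xs)"
        unfolding xs_eq using x by (subst holds_var_arr[OF ws' ws(2) us(2) \<chi>', where r = s]) (simp_all add: s)
    qed
  qed
  show "prv T (m + p) (var_arr m s \<xi>) (arr_comp n m \<theta> \<gamma>)"
  proof (rule prv_iff_holds[OF va ac])
    fix k \<chi> xs
    assume xs: "tms_in k xs" "length xs = m + p" and h: "prv T k \<chi> (holds (var_arr m s \<xi>) xs)"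
    obtain us ws where xs_eq: "xs = us @ ws" and us: "tms_in k us" "length us = m"
      and ws: "tms_in k ws" "length ws = p"
      using split[OF xs] by blast
    have \<chi>: "fm_in \<chi> k" using prv_fm_in[OF h] by blast
    let ?zs = "map (\<lambda>j. ws ! s j) [0..<m]" and ?vs = "map (\<lambda>j. ws ! r j) [0..<n]"
    have vs: "tms_in k ?vs" "length ?vs = n" using ws r by (auto simp: tms_in_def)
    have x: "prv T k \<chi> (holds \<xi> ws)" and e: "\<forall>j<m. prv T k \<chi> (Eq (ws ! s j) (us ! j))"
      using holds_var_arr[OF ws us(2) \<chi>, where r = s] s h unfolding xs_eq by blast+
    have "prv T k \<chi> (holds (var_arr n r \<xi>) (?vs @ ws))"
      using x \<chi> ws r
      by (subst holds_var_arr[OF ws vs(2) \<chi>, where r = r]) (auto intro!: prv_Eq_refl tms_in_nth)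
    then have g: "prv T k \<chi> (holds \<gamma> (?vs @ ws))"
      by (rule prv_holds[OF \<gamma>(2), rotated]) (use vs ws in simp)
    have t: "prv T k \<chi> (holds \<theta> (us @ ?vs))"
    proof (rule prv_Eq_cong[OF _ \<theta> imp[OF ws x]])
      fix i assume i: "i < m + n"
      show "prv T k \<chi> (Eq (env (?zs @ ?vs) (\<lambda>_. Zero) i) (env (us @ ?vs) (\<lambda>_. Zero) i))"
      proof (cases "i < m")
        case True
        then show ?thesis using e us by (simp add: env_nth nth_append)
      next
        case False
        then show ?thesis using i \<chi> ws r us by (simp add: env_nth nth_append prv_Eq_refl tms_in_nth)
      qed
    qed
    show "prv T k \<chi> (holds (arr_comp n m \<theta> \<gamma>) xs)"
      unfolding xs_eq by (rule arr_comp_intro[OF \<gamma>_in \<theta> ws vs us g t])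
  qed
qed

text \<open>The fibre product of two arrows \<open>\<theta>\<close> and \<open>\<theta>'\<close> with common codomain, with variables \<open>z, y, y'\<close> and the conditions
  \<open>\<theta>(y, z)\<close> and \<open>\<theta>'(y', z)\<close>. Keeping \<open>z\<close> as a variable avoids a quantifier.\<close>

definition pullback_fm :: "nat \<Rightarrow> nat \<Rightarrow> 'i fm \<Rightarrow> 'i fm \<Rightarrow> 'i fm" where
  "pullback_fm m n \<theta> \<theta>' = And \<theta> (fm_rename (\<lambda>j. if j < m then j else j + n) \<theta>')"

lemma fm_in_pullback_fm:
  "\<lbrakk>fm_in \<theta> (m + n); fm_in \<theta>' (m + n')\<rbrakk> \<Longrightarrow> fm_in (pullback_fm m n \<theta> \<theta>') (m + n + n')"
  by (auto simp: pullback_fm_def intro: fm_in_rename fm_in_mono)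

lemma holds_pullback_fm:
  assumes \<theta>: "fm_in \<theta> (m + n)" and zs: "tms_in k zs" "length zs = m"
    and ys: "tms_in k ys" "length ys = n" and ys': "tms_in k ys'" "length ys' = n'"
  shows "prv T k \<chi> (holds (pullback_fm m n \<theta> \<theta>') (zs @ ys @ ys')) \<longleftrightarrow>
    prv T k \<chi> (holds \<theta> (zs @ ys)) \<and> prv T k \<chi> (holds \<theta>' (zs @ ys'))"
proof -
  have "(\<lambda>j. env (zs @ ys @ ys') (\<lambda>_. Zero) (if j < m then j else j + n)) = env (zs @ ys') (\<lambda>_. Zero)"
    using zs(2) ys(2) by (auto simp: env_append fun_eq_iff) (auto simp: env_def)
  moreover have "prv T k \<chi> (holds \<theta> (zs @ ys @ ys')) \<longleftrightarrow> prv T k \<chi> (holds \<theta> (zs @ ys))"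
  proof
    assume "prv T k \<chi> (holds \<theta> (zs @ ys @ ys'))"
    then show "prv T k \<chi> (holds \<theta> (zs @ ys))"
      using \<theta> by (rule prv_cong) (use zs ys in \<open>auto simp: env_nth nth_append tms_in_nth\<close>)
  next
    assume "prv T k \<chi> (holds \<theta> (zs @ ys))"
    then show "prv T k \<chi> (holds \<theta> (zs @ ys @ ys'))"
      using \<theta> by (rule prv_cong) (use zs ys in \<open>auto simp: env_nth nth_append tms_in_nth\<close>)
  qed
  ultimately show ?thesis by (simp add: pullback_fm_def prv_And_iff fm_subst_rename)
qed

lemma append3_obtain:
  assumes "length ws = m + n + n'"
  obtains zs ys ys' where "ws = zs @ ys @ ys'" "length zs = m" "length ys = n" "length ys' = n'"
proof
  show "ws = take m ws @ take n (drop m ws) @ drop n (drop m ws)" by (simp only: append_take_drop_id)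
qed (use assms in auto)

lemma nth_append3:
  "map ((!) (zs @ ys @ ys')) [0..<length zs] = zs"
  "map (\<lambda>j. (zs @ ys @ ys') ! (length zs + j)) [0..<length ys] = ys"
  "map (\<lambda>j. (zs @ ys @ ys') ! (length zs + length ys + j)) [0..<length ys'] = ys'"
  by (auto intro!: nth_equalityI simp: nth_append)

context
  fixes T :: "'i geom_theory" and n n' m :: nat and \<phi> \<phi>' \<psi> \<theta> \<theta>' :: "'i fm"
  assumes \<phi>: "fm_in \<phi> n" and \<phi>': "fm_in \<phi>' n'" and \<psi>: "fm_in \<psi> m"
    and f: "functional T (n, \<phi>) (m, \<psi>) \<theta>" and f': "functional T (n', \<phi>') (m, \<psi>) \<theta>'"
begin

abbreviation (input) "pb \<equiv> pullback_fm m n \<theta> \<theta>'"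
abbreviation (input) "proj \<equiv> var_arr n (\<lambda>j. m + j) pb"
abbreviation (input) "proj' \<equiv> var_arr n' (\<lambda>j. m + n + j) pb"

lemma fm_in_legs: "fm_in \<theta> (m + n)" "fm_in \<theta>' (m + n')"
  using f f' by (auto simp: functional_def)

lemma pullback_legs_holds:
  assumes ws: "tms_in k ws" "length ws = m + n + n'" and h: "prv T k \<chi> (holds pb ws)"
  shows "prv T k \<chi> (holds \<theta> (map (\<lambda>j. ws ! j) [0..<m] @ map (\<lambda>j. ws ! (m + j)) [0..<n]))"
    and "prv T k \<chi> (holds \<theta>' (map (\<lambda>j. ws ! j) [0..<m] @ map (\<lambda>j. ws ! (m + n + j)) [0..<n']))"
proof -
  obtain zs ys ys' where ws_eq: "ws = zs @ ys @ ys'" and len: "length zs = m" "length ys = n" "length ys' = n'"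
    using append3_obtain[OF ws(2)] .
  have t: "tms_in k zs" "tms_in k ys" "tms_in k ys'" using ws(1) ws_eq by simp_all
  have "prv T k \<chi> (holds \<theta> (zs @ ys))" "prv T k \<chi> (holds \<theta>' (zs @ ys'))"
    using h holds_pullback_fm[OF fm_in_legs(1) t(1) len(1) t(2) len(2) t(3) len(3)] ws_eq by auto
  then show "prv T k \<chi> (holds \<theta> (map (\<lambda>j. ws ! j) [0..<m] @ map (\<lambda>j. ws ! (m + j)) [0..<n]))"
    and "prv T k \<chi> (holds \<theta>' (map (\<lambda>j. ws ! j) [0..<m] @ map (\<lambda>j. ws ! (m + n + j)) [0..<n']))"
    using nth_append3[of zs ys ys'] ws_eq len by simp_all
qed

lemma functional_pullback_projections:
  "functional T (m + n + n', pb) (n, \<phi>) proj"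
  "functional T (m + n + n', pb) (n', \<phi>') proj'"
proof -
  have pb: "fm_in pb (m + n + n')" by (intro fm_in_pullback_fm fm_in_legs)
  {
    fix k \<chi> ws
    assume ws: "tms_in k ws" "length ws = m + n + n'" and h: "prv T k \<chi> (holds pb ws)"
    have ins: "tms_in k (map (\<lambda>j. ws ! j) [0..<m])" "tms_in k (map (\<lambda>j. ws ! (m + j)) [0..<n])"
      "tms_in k (map (\<lambda>j. ws ! (m + n + j)) [0..<n'])"
      using ws by (auto simp: tms_in_def)
    note legs = pullback_legs_holds[OF ws h]
    have "prv T k \<chi> (holds \<phi> (map (\<lambda>j. ws ! (m + j)) [0..<n]))"
      and "prv T k \<chi> (holds \<phi>' (map (\<lambda>j. ws ! (m + n + j)) [0..<n']))"
      using functional_typed(1)[OF f \<psi> ins(2) _ ins(1) _ legs(1)]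
        functional_typed(1)[OF f' \<psi> ins(3) _ ins(1) _ legs(2)] by simp_all
  }
  then show "functional T (m + n + n', pb) (n, \<phi>) proj"
    and "functional T (m + n + n', pb) (n', \<phi>') proj'"
    using pb \<phi> \<phi>' by (auto intro!: functional_var_arr)
qed

text \<open>Both composites equal the projection to \<open>z\<close>. Composition in the syntactic category works with arbitrary
  representatives of the classes, hence \<open>\<gamma>\<close> and \<open>\<gamma>'\<close> in place of the two projections.\<close>

lemma pullback_square:
  assumes "prv T (n + (m + n + n')) \<gamma> proj" "prv T (n + (m + n + n')) proj \<gamma>"
    and "prv T (n' + (m + n + n')) \<gamma>' proj'" "prv T (n' + (m + n + n')) proj' \<gamma>'"
  shows "prv T (m + (m + n + n')) (arr_comp n m \<theta> \<gamma>) (arr_comp n' m \<theta>' \<gamma>')"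
    and "prv T (m + (m + n + n')) (arr_comp n' m \<theta>' \<gamma>') (arr_comp n m \<theta> \<gamma>)"
proof -
  have pb: "fm_in pb (m + n + n')" by (intro fm_in_pullback_fm fm_in_legs)
  note 1 = prv_comp_var_arr[OF \<psi> f pb _ _ assms(1,2) pullback_legs_holds(1), simplified]
  note 2 = prv_comp_var_arr[OF \<psi> f' pb _ _ assms(3,4) pullback_legs_holds(2), simplified]
  show "prv T (m + (m + n + n')) (arr_comp n m \<theta> \<gamma>) (arr_comp n' m \<theta>' \<gamma>')"
    by (rule prv.Cut[OF 1(1) 2(2)])
  show "prv T (m + (m + n + n')) (arr_comp n' m \<theta>' \<gamma>') (arr_comp n m \<theta> \<gamma>)"
    by (rule prv.Cut[OF 2(1) 1(2)])
qed

end

text \<open>The alternatives \<open>t = 0\<close>, \<open>0 t = 1\<close>, \<open>1 t = 1\<close>, \<open>2 t = 1\<close>, and so on, of the axiom of simple MV-algebras at \<open>t\<close>, arranged in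
  a single sequence. The case \<open>t = 0\<close> is kept apart from the others, because the argument needs to know
  which of the two kinds of alternatives holds.\<close>

definition simple_case :: "tm \<Rightarrow> nat \<Rightarrow> 'i fm" where
  "simple_case t j = (case j of 0 \<Rightarrow> Eq t Zero | Suc n \<Rightarrow> Eq (nmult n t) One)"

lemma tm_in_nmult: "tm_in k t \<Longrightarrow> tm_in k (nmult n t)"
  by (induction n) simp_all

lemma fm_in_simple_case: "tm_in k t \<Longrightarrow> fm_in (simple_case t j) k"
  by (auto simp: simple_case_def One_def tm_in_nmult split: nat.split)

lemma prv_simple_cases:
  assumes t: "tm_in k t" and \<rho>: "fm_in \<rho> k"
    and cases: "\<And>j. prv (Simple :: 'i::infinite geom_theory) k (simple_case t j) \<rho>"
  shows "prv (Simple :: 'i geom_theory) k Top \<rho>"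
proof -
  let ?T = "Simple :: 'i geom_theory"
  let ?ax = "nDisj UNIV (\<lambda>n. Or (Eq (Var 0) Zero) (Eq (nmult n (Var 0)) One)) :: 'i fm"
  have nm: "tm_subst (\<lambda>_. t) (nmult n (Var 0)) = nmult n t" for n by (induction n) simp_all
  have "fm_in ?ax 1"
    by (auto simp: nDisj_def Or_def One_def tm_in_nmult)
  then have "prv ?T 1 Top ?ax"
    by (intro prv.Axiom) (simp_all add: Simple_def)
  then have "prv ?T k (fm_subst Top (\<lambda>_. t)) (fm_subst ?ax (\<lambda>_. t))"
    by (rule prv.Subst) (simp add: t)
  moreover have "prv ?T k (fm_subst ?ax (\<lambda>_. t)) \<rho>"
    using cases[of 0] cases[of "Suc _"] \<rho>
    by (auto simp: nDisj_def Or_def nm One_def simple_case_def intro!: prv.DisjE)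
  ultimately show ?thesis by (auto intro: prv.Cut)
qed

section \<open>The point of the classifying topos given by the model\<close>

abbreviation msat :: "'i fm \<Rightarrow> real list \<Rightarrow> bool" where
  "msat \<phi> xs \<equiv> sat \<phi> (env xs (\<lambda>_. 0))"

lemma env_unit_surds: "xs \<in> lists unit_surds \<Longrightarrow> env xs (\<lambda>_. 0) k \<in> unit_surds"
  by (auto simp: env_def in_lists_conv_set)

text \<open>The interpretation of a formula-in-context in the model, which is the stalk of the corresponding
  representable sheaf at the point of the classifying topos given by the model.\<close>

definition points :: "nat \<times> 'i fm \<Rightarrow> real list set" where
  "points A = {xs \<in> lists unit_surds. length xs = fst A \<and> msat (snd A) xs}"

lemma soundness_list:
  "\<lbrakk>prv Simple n \<phi> \<psi>; xs \<in> lists unit_surds; msat \<phi> xs\<rbrakk> \<Longrightarrow> msat \<psi> xs"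
  by (erule soundness) (auto intro: env_unit_surds)

lemma functional_sat_total:
  assumes f: "functional Simple A B \<theta>" and xs: "xs \<in> points A"
  shows "\<exists>ys\<in>lists unit_surds. length ys = fst B \<and> msat \<theta> (ys @ xs)"
proof -
  have "prv Simple (fst A) (snd A) (Exs (fst B) \<theta>)"
    using f by (auto simp: functional_def split: prod.splits)
  then have "msat (Exs (fst B) \<theta>) xs"
    by (rule soundness_list) (use xs in \<open>auto simp: points_def\<close>)
  then show ?thesis by (simp add: sat_Exs env_append)
qed

lemma functional_sat_typed:
  assumes f: "functional Simple A B \<theta>" and B: "fm_in (snd B) (fst B)"
    and xs: "xs \<in> lists unit_surds" "length xs = fst A"
    and ys: "ys \<in> lists unit_surds" "length ys = fst B" and \<theta>: "msat \<theta> (ys @ xs)"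
  shows "xs \<in> points A" "ys \<in> points B"
proof -
  have "prv Simple (fst B + fst A) \<theta> (And (fm_rename (\<lambda>j. fst B + j) (snd A)) (snd B))"
    using f by (auto simp: functional_def split: prod.splits)
  then have "msat (And (fm_rename (\<lambda>j. fst B + j) (snd A)) (snd B)) (ys @ xs)"
    by (rule soundness_list) (use xs ys \<theta> in auto)
  then have *: "sat (snd A) (\<lambda>j. env (ys @ xs) (\<lambda>_. 0) (length ys + j))" "msat (snd B) (ys @ xs)"
    using ys by simp_all
  then show "xs \<in> points A" using xs by (simp add: points_def env_add)
  have "msat (snd B) ys \<longleftrightarrow> msat (snd B) (ys @ xs)"
    using B by (rule sat_cong) (use ys in \<open>simp add: env_nth nth_append\<close>)
  then show "ys \<in> points B" using * ys by (simp add: points_def)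
qed

lemma functional_sat_unique:
  fixes \<theta> :: "'i::infinite fm"
  assumes f: "functional Simple A B \<theta>"
    and xs: "xs \<in> lists unit_surds" "length xs = fst A"
    and ys: "ys \<in> lists unit_surds" "length ys = fst B" and zs: "zs \<in> lists unit_surds" "length zs = fst B"
    and \<theta>: "msat \<theta> (ys @ xs)" "msat \<theta> (zs @ xs)"
  shows "ys = zs"
proof -
  let ?m = "fst B" and ?n = "fst A" and ?e = "env (ys @ zs @ xs) (\<lambda>_. 0)"
  have p: "prv Simple (?m + ?m + ?n)
       (And (fm_rename (\<lambda>j. if j < ?m then j else ?m + j) \<theta>) (fm_rename (\<lambda>j. ?m + j) \<theta>))
       (Conj (map (\<lambda>j. Eq (Var j) (Var (?m + j))) [0..<?m]))"
    using f by (cases A; cases B) (simp add: functional_def cong: if_cong)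
  have e1: "(\<lambda>j. ?e (if j < ?m then j else ?m + j)) = env (ys @ xs) (\<lambda>_. 0)"
    using ys(2) zs(2) by (auto simp: env_append fun_eq_iff) (auto simp: env_def)
  have e2: "(\<lambda>j. ?e (?m + j)) = env (zs @ xs) (\<lambda>_. 0)"
    by (simp add: env_add flip: ys(2))
  have eqs: "msat (Conj (map (\<lambda>j. Eq (Var j) (Var (?m + j))) [0..<?m]) :: 'i fm) (ys @ zs @ xs)"
    by (rule soundness_list[OF p]) (use xs ys zs \<theta> e1 e2 in auto)
  have "ys ! j = zs ! j" if "j < ?m" for j
    using eqs that ys zs env_add[of ys "zs @ xs" _ j] by (simp add: env_nth nth_append)
  then show ?thesis using ys zs by (intro nth_equalityI) simp_all
qed

abbreviation syn :: "(nat \<times> 'i::infinite fm, 'i fm set) cat" where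
  "syn \<equiv> syn_cat Simple"

lemma syn_Ob: "A \<in> Ob syn \<longleftrightarrow> fm_in (snd A) (fst A)"
  by (auto simp: syn_cat_def split: prod.splits)

lemma syn_HomI: "functional Simple A B \<theta> \<Longrightarrow> arr_class Simple A B \<theta> \<in> Hom syn A B"
  by (auto simp: syn_cat_def)

lemma functional_prv_refl: "functional T A B \<theta> \<Longrightarrow> prv T (fst B + fst A) \<theta> \<theta>"
  by (auto simp: functional_def intro: prv.Ident split: prod.splits)

lemma arr_class_self: "functional T A B \<theta> \<Longrightarrow> \<theta> \<in> arr_class T A B \<theta>"
  by (simp add: arr_class_def functional_prv_refl)

lemma arr_class_eqI:
  assumes "prv T (fst B + fst A) \<theta> \<theta>'" "prv T (fst B + fst A) \<theta>' \<theta>"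
  shows "arr_class T A B \<theta> = arr_class T A B \<theta>'"
  using assms by (auto simp: arr_class_def intro: prv.Cut)

lemma syn_Hom_some:
  assumes "f \<in> Hom syn A B"
  shows "(SOME \<theta>. \<theta> \<in> f) \<in> f"
proof -
  obtain \<theta> where "f = arr_class Simple A B \<theta>" "functional Simple A B \<theta>"
    using assms by (auto simp: syn_cat_def)
  then have "\<theta> \<in> f" by (simp add: arr_class_self)
  then show ?thesis by (rule someI)
qed

lemma syn_Hom_functional: "\<lbrakk>f \<in> Hom syn A B; \<theta> \<in> f\<rbrakk> \<Longrightarrow> functional Simple A B \<theta>"
  by (auto simp: syn_cat_def arr_class_def)

lemma syn_Hom_sat_iff:
  assumes "f \<in> Hom syn A B" "\<theta> \<in> f" "\<theta>' \<in> f" "zs \<in> lists unit_surds"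
  shows "msat \<theta> zs \<longleftrightarrow> msat \<theta>' zs"
proof -
  have "prv Simple (fst B + fst A) \<theta> \<theta>'" "prv Simple (fst B + fst A) \<theta>' \<theta>"
    using assms(1-3) by (auto simp: syn_cat_def arr_class_def intro: prv.Cut)
  then show ?thesis using soundness_list[OF _ assms(4)] by blast
qed

text \<open>The function on points defined by an arrow. The codomain is an argument because it determines
  the length of the result.\<close>

definition arr_map :: "nat \<times> 'i fm \<Rightarrow> 'i fm set \<Rightarrow> real list \<Rightarrow> real list" where
  "arr_map B f xs = (THE ys. ys \<in> lists unit_surds \<and> length ys = fst B \<and> (\<exists>\<theta>\<in>f. msat \<theta> (ys @ xs)))"

lemma arr_map_eqI:
  assumes f: "f \<in> Hom syn A B" "\<theta> \<in> f" and xs: "xs \<in> lists unit_surds" "length xs = fst A"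
    and ys: "ys \<in> lists unit_surds" "length ys = fst B" and s: "msat \<theta> (ys @ xs)"
  shows "arr_map B f xs = ys"
  unfolding arr_map_def
proof (rule the_equality)
  fix zs assume "zs \<in> lists unit_surds \<and> length zs = fst B \<and> (\<exists>\<theta>\<in>f. msat \<theta> (zs @ xs))"
  then obtain \<theta>' where zs: "zs \<in> lists unit_surds" "length zs = fst B" and "\<theta>' \<in> f" "msat \<theta>' (zs @ xs)"
    by blast
  then have "msat \<theta> (zs @ xs)" using syn_Hom_sat_iff[OF f] xs by simp
  then show "zs = ys" using functional_sat_unique[OF syn_Hom_functional[OF f] xs zs ys] s by simp
qed (use f s ys in blast)

lemma arr_map_sat:
  assumes B: "B \<in> Ob syn" and f: "f \<in> Hom syn A B" "\<theta> \<in> f" and xs: "xs \<in> points A"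
  shows "arr_map B f xs \<in> points B" "msat \<theta> (arr_map B f xs @ xs)"
proof -
  have xs': "xs \<in> lists unit_surds" "length xs = fst A" using xs by (auto simp: points_def)
  obtain ys where ys: "ys \<in> lists unit_surds" "length ys = fst B" "msat \<theta> (ys @ xs)"
    using functional_sat_total[OF syn_Hom_functional[OF f] xs] by blast
  then have "arr_map B f xs = ys" using arr_map_eqI[OF f xs'] by blast
  moreover have "ys \<in> points B"
    using functional_sat_typed(2)[OF syn_Hom_functional[OF f] _ xs' ys] B by (simp add: syn_Ob)
  ultimately show "arr_map B f xs \<in> points B" "msat \<theta> (arr_map B f xs @ xs)" using ys by simp_all
qed

lemma arr_map_points:
  "\<lbrakk>B \<in> Ob syn; f \<in> Hom syn A B; xs \<in> points A\<rbrakk> \<Longrightarrow> arr_map B f xs \<in> points B"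
  by (rule arr_map_sat(1)[OF _ _ syn_Hom_some])

lemma syn_idn:
  assumes A: "A \<in> Ob (syn :: (nat \<times> 'i::infinite fm, 'i fm set) cat)"
  shows "Idn syn A \<in> Hom syn A A" "xs \<in> points A \<Longrightarrow> arr_map A (Idn syn A) xs = xs"
proof -
  obtain n \<phi> where A_eq: "A = (n, \<phi>)" and \<phi>: "fm_in \<phi> n" using A by (cases A) (simp add: syn_Ob)
  have f: "functional Simple A A (arr_id A)"
    unfolding A_eq by (intro functional_arr_id \<phi> prv.Ident)
  have idn: "Idn syn A = arr_class Simple A A (arr_id A)" by (simp add: syn_cat_def)
  show hom: "Idn syn A \<in> Hom syn A A" unfolding idn by (rule syn_HomI[OF f])
  assume "xs \<in> points A"
  then have xs: "xs \<in> lists unit_surds" "length xs = n" "msat \<phi> xs" by (auto simp: points_def A_eq)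
  have "msat (arr_id A) (xs @ xs)"
    using xs env_add[of xs xs "\<lambda>_. 0 :: real"] by (auto simp: arr_id_def A_eq env_nth nth_append)
  moreover have "arr_id A \<in> Idn syn A" unfolding idn by (rule arr_class_self[OF f])
  ultimately show "arr_map A (Idn syn A) xs = xs"
    by (intro arr_map_eqI[OF hom]) (use xs in \<open>auto simp: A_eq\<close>)
qed

lemma syn_Cmp:
  "Cmp syn A B C g f =
    arr_class Simple A C (arr_comp (fst B) (fst C) (SOME \<gamma>. \<gamma> \<in> g) (SOME \<theta>. \<theta> \<in> f))"
  by (simp add: syn_cat_def)

lemma syn_comp_functional:
  assumes A: "A \<in> Ob syn" and B: "B \<in> Ob syn" and C: "C \<in> Ob syn"
    and f: "f \<in> Hom syn A B" and g: "g \<in> Hom syn B C"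
  shows "functional Simple A C (arr_comp (fst B) (fst C) (SOME \<gamma>. \<gamma> \<in> g) (SOME \<theta>. \<theta> \<in> f))"
  using functional_arr_comp[of "snd A" "fst A" "snd B" "fst B" "snd C" "fst C" Simple]
    syn_Hom_functional[OF f syn_Hom_some[OF f]] syn_Hom_functional[OF g syn_Hom_some[OF g]] A B C
  by (simp add: syn_Ob)

lemma syn_comp:
  assumes A: "A \<in> Ob syn" and B: "B \<in> Ob syn" and C: "C \<in> Ob syn"
    and f: "f \<in> Hom syn A B" and g: "g \<in> Hom syn B C"
  shows "Cmp syn A B C g f \<in> Hom syn A C"
    and "xs \<in> points A \<Longrightarrow> arr_map C (Cmp syn A B C g f) xs = arr_map C g (arr_map B f xs)"
proof -
  let ?\<gamma> = "SOME \<gamma>. \<gamma> \<in> g" and ?\<theta> = "SOME \<theta>. \<theta> \<in> f"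
  note fc = syn_comp_functional[OF assms]
  show hom: "Cmp syn A B C g f \<in> Hom syn A C" unfolding syn_Cmp by (rule syn_HomI[OF fc])
  assume xs: "xs \<in> points A"
  let ?ys = "arr_map B f xs" and ?zs = "arr_map C g (arr_map B f xs)"
  have ys: "?ys \<in> points B" "msat ?\<theta> (?ys @ xs)"
    using arr_map_sat[OF B f syn_Hom_some[OF f] xs] by auto
  have zs: "?zs \<in> points C" "msat ?\<gamma> (?zs @ ?ys)"
    using arr_map_sat[OF C g syn_Hom_some[OF g] ys(1)] by auto
  have l: "length xs = fst A" "length ?ys = fst B" "length ?zs = fst C" "xs \<in> lists unit_surds"
     "?ys \<in> lists unit_surds" "?zs \<in> lists unit_surds"
    using xs ys zs by (auto simp: points_def)
  let ?e = "env ?ys (env (?zs @ xs) (\<lambda>_. 0))"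
  have "(\<lambda>j. ?e (if j < fst B then j else j + fst C)) = env (?ys @ xs) (\<lambda>_. 0)"
    using l by (auto simp: env_append fun_eq_iff) (auto simp: env_def)
  moreover have "sat ?\<gamma> (\<lambda>j. ?e (if j < fst C then fst B + j else j - fst C)) \<longleftrightarrow> msat ?\<gamma> (?zs @ ?ys)"
  proof (rule sat_cong)
    show "fm_in ?\<gamma> (fst C + fst B)"
      using syn_Hom_functional[OF g syn_Hom_some[OF g]] by (auto simp: functional_def split: prod.splits)
  qed (use l in \<open>auto simp: env_append env_def\<close>)
  ultimately have "msat (arr_comp (fst B) (fst C) ?\<gamma> ?\<theta>) (?zs @ xs)"
    using ys zs l unfolding arr_comp_def sat_Exs by (intro bexI[of _ ?ys]) auto
  then show "arr_map C (Cmp syn A B C g f) xs = arr_map C g (arr_map B f xs)"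
    by (intro arr_map_eqI[OF hom]) (use l arr_class_self[OF fc] in \<open>auto simp: syn_Cmp\<close>)
qed

text \<open>The graph of \<open>arr_map\<close> is defined by a geometric formula, and these are preserved by shearing.\<close>

lemma arr_map_shear:
  assumes A: "A \<in> Ob syn" and B: "B \<in> Ob syn" and f: "f \<in> Hom syn A B" and xs: "xs \<in> points A"
  shows "\<forall>\<^sub>F n in sequentially. map (shear n) xs \<in> points A \<and>
    arr_map B f (map (shear n) xs) = map (shear n) (arr_map B f xs)"
proof -
  let ?\<theta> = "SOME \<theta>. \<theta> \<in> f" and ?ys = "arr_map B f xs"
  have ys: "?ys \<in> points B" and \<theta>: "msat ?\<theta> (?ys @ xs)"
    using arr_map_sat[OF B f syn_Hom_some[OF f] xs] by auto
  have l: "length xs = fst A" "length ?ys = fst B" "xs \<in> lists unit_surds" "?ys \<in> lists unit_surds"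
    using xs ys by (auto simp: points_def)
  have ev: "\<forall>\<^sub>F n in sequentially. map (shear n) zs \<in> lists unit_surds" if "zs \<in> lists unit_surds" for zs
    using that
  proof (induction zs)
    case (Cons z zs)
    then have "\<forall>\<^sub>F n in sequentially. shear n z \<in> unit_surds"
      "\<forall>\<^sub>F n in sequentially. map (shear n) zs \<in> lists unit_surds"
      by (auto intro: eventually_shear_unit_surds)
    then show ?case by eventually_elim simp
  qed simp
  have env_map: "(\<lambda>k. shear n (env zs (\<lambda>_. 0) k)) = env (map (shear n) zs) (\<lambda>_. 0)" for n zs
    by (auto simp: env_def fun_eq_iff)
  have "\<forall>\<^sub>F n in sequentially. sat ?\<theta> (\<lambda>k. shear n (env (?ys @ xs) (\<lambda>_. 0) k))"
    using \<theta> by (rule eventually_sat_shear, intro env_unit_surds) (use l in auto)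
  then have "\<forall>\<^sub>F n in sequentially. msat ?\<theta> (map (shear n) ?ys @ map (shear n) xs)"
    by (simp add: env_map)
  with ev[OF l(3)] ev[OF l(4)] show ?thesis
  proof eventually_elim
    case (elim n)
    have "map (shear n) xs \<in> points A"
      using functional_sat_typed(1)[OF syn_Hom_functional[OF f syn_Hom_some[OF f]] _ elim(1) _ elim(2) _ elim(3)]
        B l by (simp add: syn_Ob)
    moreover have "arr_map B f (map (shear n) xs) = map (shear n) ?ys"
      by (rule arr_map_eqI[OF f syn_Hom_some[OF f] elim(1) _ elim(2) _ elim(3)]) (use l in simp_all)
    ultimately show ?case by simp
  qed
qed

lemma points_shear:
  assumes A: "A \<in> Ob syn" and xs: "xs \<in> points A"
  shows "\<forall>\<^sub>F n in sequentially. map (shear n) xs \<in> points A"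
  using arr_map_shear[OF A A syn_idn(1)[OF A] xs] by (rule eventually_mono) simp

lemma cover_sieve:
  assumes "S \<in> syn_cov Simple X" "(Y, f) \<in> S"
  shows "Y \<in> Ob syn" "f \<in> Hom syn Y X"
    "\<And>Z g. \<lbrakk>Z \<in> Ob syn; g \<in> Hom syn Z Y\<rbrakk> \<Longrightarrow> (Z, Cmp syn Z Y X f g) \<in> S"
  using assms by (auto simp: syn_cov_def is_sieve_def)

text \<open>A cover is a provable disjunction, which is true in the model by soundness.\<close>

lemma cover_jointly_surjective:
  assumes S: "S \<in> syn_cov Simple X" and X: "X \<in> Ob syn" and xs: "xs \<in> points X"
  shows "\<exists>Y f ys. (Y, f) \<in> S \<and> ys \<in> points Y \<and> arr_map X f ys = xs"
proof -
  obtain I A \<theta> where fam: "\<forall>i\<in>I. A i \<in> Ob syn \<and> functional Simple (A i) X (\<theta> i) \<and>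
      (A i, arr_class Simple (A i) X (\<theta> i)) \<in> S"
    and cov: "prv Simple (fst X) (snd X) (Disj I (\<lambda>i. arr_image (fst (A i)) (fst X) (\<theta> i)))"
    using S by (auto simp: syn_cov_def)
  have xs': "xs \<in> lists unit_surds" "length xs = fst X" "msat (snd X) xs"
    using xs by (auto simp: points_def)
  then have "msat (Disj I (\<lambda>i. arr_image (fst (A i)) (fst X) (\<theta> i))) xs"
    using soundness_list[OF cov] by blast
  then obtain i where i: "i \<in> I" and im: "msat (arr_image (fst (A i)) (fst X) (\<theta> i)) xs" by auto
  have f: "functional Simple (A i) X (\<theta> i)" and S_i: "(A i, arr_class Simple (A i) X (\<theta> i)) \<in> S"
    using fam i by auto
  obtain ys where ys: "ys \<in> lists unit_surds" "length ys = fst (A i)"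
    and s: "sat (\<theta> i) (\<lambda>j. env ys (env xs (\<lambda>_. 0)) (if j < fst X then fst (A i) + j else j - fst X))"
    using im by (auto simp: arr_image_def sat_Exs)
  have "fm_in (\<theta> i) (fst X + fst (A i))"
    using f by (auto simp: functional_def split: prod.splits)
  then have "msat (\<theta> i) (xs @ ys) \<longleftrightarrow>
      sat (\<theta> i) (\<lambda>j. env ys (env xs (\<lambda>_. 0)) (if j < fst X then fst (A i) + j else j - fst X))"
    by (rule sat_cong) (use xs' ys in \<open>auto simp: env_def nth_append\<close>)
  then have \<theta>: "msat (\<theta> i) (xs @ ys)" using s by simp
  have "ys \<in> points (A i)"
    using functional_sat_typed(1)[OF f _ ys xs'(1,2) \<theta>] X by (simp add: syn_Ob)
  moreover have "arr_map X (arr_class Simple (A i) X (\<theta> i)) ys = xs"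
    by (rule arr_map_eqI[OF syn_HomI[OF f] arr_class_self[OF f] ys xs'(1,2) \<theta>])
  ultimately show ?thesis using S_i by blast
qed

text \<open>Two points of members of a cover that lie over the same point come from a point of a common
  refinement. The gluing of functions depends on this.\<close>

lemma syn_pullback:
  fixes X :: "nat \<times> 'i::infinite fm"
  assumes X: "X \<in> Ob syn" and Y: "Y \<in> Ob syn" and Y': "Y' \<in> Ob syn"
    and f: "f \<in> Hom syn Y X" and f': "f' \<in> Hom syn Y' X"
    and ys: "ys \<in> points Y" and ys': "ys' \<in> points Y'" and eq: "arr_map X f ys = arr_map X f' ys'"
  obtains Z g g' ws where "Z \<in> Ob syn" "g \<in> Hom syn Z Y" "g' \<in> Hom syn Z Y'"
    "Cmp syn Z Y X f g = Cmp syn Z Y' X f' g'" "ws \<in> points Z"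
    "arr_map Y g ws = ys" "arr_map Y' g' ws = ys'"
proof -
  let ?T = "Simple :: 'i geom_theory"
  obtain m \<psi> n \<phi> n' \<phi>' where XY: "X = (m, \<psi>)" "Y = (n, \<phi>)" "Y' = (n', \<phi>')"
    by (metis surj_pair)
  have ins: "fm_in \<phi> n" "fm_in \<phi>' n'" "fm_in \<psi> m" using X Y Y' by (simp_all add: XY syn_Ob)
  define \<theta> \<theta>' where "\<theta> = (SOME \<theta>. \<theta> \<in> f)" and "\<theta>' = (SOME \<theta>. \<theta> \<in> f')"
  have \<theta>f: "\<theta> \<in> f" "\<theta>' \<in> f'" unfolding \<theta>_def \<theta>'_def using f f' syn_Hom_some by blast+
  have fn: "functional ?T (n, \<phi>) (m, \<psi>) \<theta>" "functional ?T (n', \<phi>') (m, \<psi>) \<theta>'"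
    using syn_Hom_functional[OF f \<theta>f(1)] syn_Hom_functional[OF f' \<theta>f(2)] by (simp_all add: XY)
  let ?pb = "pullback_fm m n \<theta> \<theta>'"
  let ?Z = "(m + n + n', ?pb)" and ?p = "var_arr n (\<lambda>j. m + j) ?pb"
    and ?p' = "var_arr n' (\<lambda>j. m + n + j) ?pb"
  note proj = functional_pullback_projections[OF ins fn]
  let ?g = "arr_class ?T ?Z Y ?p" and ?g' = "arr_class ?T ?Z Y' ?p'"
  have Z: "?Z \<in> Ob syn"
    using fm_in_pullback_fm[OF fm_in_legs[OF ins fn]] by (simp add: syn_Ob)
  have g: "?g \<in> Hom syn ?Z Y" "?g' \<in> Hom syn ?Z Y'"
    using proj by (auto simp: XY intro: syn_HomI)
  have some: "(SOME \<gamma>. \<gamma> \<in> ?g) \<in> ?g" "(SOME \<gamma>. \<gamma> \<in> ?g') \<in> ?g'"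
    using g syn_Hom_some by blast+
  have "Cmp syn ?Z Y X f ?g = Cmp syn ?Z Y' X f' ?g'"
    unfolding syn_Cmp \<theta>_def[symmetric] \<theta>'_def[symmetric]
    using pullback_square[OF ins fn, of "SOME \<gamma>. \<gamma> \<in> ?g" "SOME \<gamma>. \<gamma> \<in> ?g'"] some
    by (intro arr_class_eqI) (auto simp: XY arr_class_def)
  moreover
  let ?xs = "arr_map X f ys"
  let ?ws = "?xs @ ys @ ys'"
  have s: "msat \<theta> (?xs @ ys)" "msat \<theta>' (?xs @ ys')" and xs: "?xs \<in> points X"
    using arr_map_sat[OF X f \<theta>f(1) ys] arr_map_sat[OF X f' \<theta>f(2) ys'] eq by auto
  have l: "length ?xs = m" "length ys = n" "length ys' = n'" "?ws \<in> lists unit_surds"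
     "ys \<in> lists unit_surds" "ys' \<in> lists unit_surds"
    using xs ys ys' by (auto simp: points_def XY)
  have pb: "msat ?pb ?ws"
  proof -
    have "msat \<theta> ?ws \<longleftrightarrow> msat \<theta> (?xs @ ys)"
      by (rule sat_cong[OF fm_in_legs(1)[OF ins fn]]) (use l in \<open>auto simp: env_def nth_append\<close>)
    moreover have "(\<lambda>j. env ?ws (\<lambda>_. 0) (if j < m then j else j + n)) = env (?xs @ ys') (\<lambda>_. 0)"
      using l by (auto simp: env_append fun_eq_iff) (auto simp: env_def)
    ultimately show ?thesis using s by (simp add: pullback_fm_def)
  qed
  then have ws: "?ws \<in> points ?Z" using l by (simp add: points_def)
  have "msat ?p (ys @ ?ws)" "msat ?p' (ys' @ ?ws)"
    using pb l env_add[of ys ?ws "\<lambda>_. 0 :: real"] env_add[of ys' ?ws "\<lambda>_. 0 :: real"]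
    by (auto simp: var_arr_def env_nth nth_append)
  then have "arr_map Y ?g ?ws = ys" "arr_map Y' ?g' ?ws = ys'"
    using arr_map_eqI[OF g(1) arr_class_self[OF proj(1)[folded XY]]]
      arr_map_eqI[OF g(2) arr_class_self[OF proj(2)[folded XY]]] l by (auto simp: XY)
  ultimately show ?thesis using that Z g ws by blast
qed

section \<open>Sheaves of functions on points\<close>

text \<open>Extensional functions take the value \<open>undefined\<close> outside of their domain; admitting this value
  yields one set that contains the sections over every object.\<close>

definition surd_functions :: "(real list \<Rightarrow> real) set" where
  "surd_functions = lists unit_surds \<rightarrow>\<^sub>E insert undefined unit_surds"

definition sections :: "nat \<times> 'i fm \<Rightarrow> (real list \<Rightarrow> real) set" where
  "sections A = points A \<rightarrow>\<^sub>E unit_surds"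

lemma sections_subset: "sections A \<subseteq> surd_functions"
  by (fastforce simp: sections_def surd_functions_def points_def PiE_iff extensional_def)

text \<open>A function between countable sets is given by a set of natural numbers, and sets of natural numbers
  are encoded by the index sets of disjunctions.\<close>

lemma surd_functions_lepoll: "surd_functions \<lesssim> (UNIV :: 'i::infinite fm set)"
proof -
  let ?D = "lists unit_surds \<times> insert undefined unit_surds"
  have D: "countable ?D"
    using countable_unit_surds by (intro countable_SIGMA countable_insert countable_lists) auto
  define g where "g k = (nat_idx :: nat \<Rightarrow> 'i) ` to_nat_on ?D ` {(xs, k xs) | xs. xs \<in> lists unit_surds}"
    for k :: "real list \<Rightarrow> real"
  have "inj_on (\<lambda>k. Disj (g k) (\<lambda>_. Top)) surd_functions"
  proof (rule inj_onI)
    fix k k' assume k: "k \<in> surd_functions" and k': "k' \<in> surd_functions"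
      and "Disj (g k) (\<lambda>_. Top) = Disj (g k') (\<lambda>_. Top)"
    then have "g k = g k'" by simp
    then have img: "to_nat_on ?D ` {(xs, k xs) | xs. xs \<in> lists unit_surds} =
        to_nat_on ?D ` {(xs, k' xs) | xs. xs \<in> lists unit_surds}"
      unfolding g_def inj_image_eq_iff[OF inj_nat_idx] .
    have sub: "{(xs, k xs) | xs. xs \<in> lists unit_surds} \<subseteq> ?D"
      "{(xs, k' xs) | xs. xs \<in> lists unit_surds} \<subseteq> ?D"
      using k k' by (auto simp: surd_functions_def PiE_iff)
    have eq: "{(xs, k xs) | xs. xs \<in> lists unit_surds} = {(xs, k' xs) | xs. xs \<in> lists unit_surds}"
      using img unfolding inj_on_image_eq_iff[OF inj_on_to_nat_on[OF D] sub] .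
    show "k = k'"
    proof (rule PiE_ext)
      show "k \<in> lists unit_surds \<rightarrow>\<^sub>E insert undefined unit_surds"
        "k' \<in> lists unit_surds \<rightarrow>\<^sub>E insert undefined unit_surds"
        using k k' by (simp_all add: surd_functions_def)
      fix xs :: "real list" assume "xs \<in> lists unit_surds"
      then have "(xs, k xs) \<in> {(xs, k xs) | xs. xs \<in> lists unit_surds}" by blast
      then show "k xs = k' xs" unfolding eq by simp
    qed
  qed
  then show ?thesis unfolding lepoll_def by blast
qed

definition pull :: "nat \<times> 'i fm \<Rightarrow> nat \<times> 'i fm \<Rightarrow> 'i fm set \<Rightarrow> (real list \<Rightarrow> real) \<Rightarrow> real list \<Rightarrow> real" where
  "pull X Y f k = (\<lambda>xs\<in>points Y. k (arr_map X f xs))"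

lemma pull_sections:
  "\<lbrakk>X \<in> Ob syn; f \<in> Hom syn Y X; k \<in> sections X\<rbrakk> \<Longrightarrow> pull X Y f k \<in> sections Y"
  by (auto simp: pull_def sections_def dest: arr_map_points)

lemma pull_idn: "\<lbrakk>X \<in> Ob syn; k \<in> sections X\<rbrakk> \<Longrightarrow> pull X X (Idn syn X) k = k"
  by (auto simp: pull_def sections_def fun_eq_iff syn_idn PiE_iff extensional_def restrict_def)

lemma pull_comp:
  "\<lbrakk>X \<in> Ob syn; Y \<in> Ob syn; Z \<in> Ob syn; f \<in> Hom syn Y X; g \<in> Hom syn Z Y\<rbrakk>
    \<Longrightarrow> pull X Z (Cmp syn Z Y X f g) k = pull Y Z g (pull X Y f k)"
  by (auto simp: pull_def fun_eq_iff restrict_def syn_comp(2) dest: arr_map_points)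

lemma sections_eqI:
  assumes X: "X \<in> Ob syn" and S: "S \<in> syn_cov Simple X"
    and k: "k \<in> sections X" "k' \<in> sections X"
    and eq: "\<And>Y f. (Y, f) \<in> S \<Longrightarrow> pull X Y f k = pull X Y f k'"
  shows "k = k'"
proof (rule PiE_ext)
  show "k \<in> points X \<rightarrow>\<^sub>E unit_surds" "k' \<in> points X \<rightarrow>\<^sub>E unit_surds"
    using k by (simp_all add: sections_def)
  fix xs assume "xs \<in> points X"
  then obtain Y f ys where Y: "(Y, f) \<in> S" and ys: "ys \<in> points Y" "arr_map X f ys = xs"
    using cover_jointly_surjective[OF S X] by blast
  from fun_cong[OF eq[OF Y], of ys] ys show "k xs = k' xs" by (simp add: pull_def)
qed

text \<open>The value of the glued function at a point is read off from any member of the cover and any point above;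
  by \<open>syn_pullback\<close> it does not depend on this choice.\<close>

lemma sections_glue:
  fixes X :: "nat \<times> 'i::infinite fm"
  assumes X: "X \<in> Ob syn" and S: "S \<in> syn_cov Simple X"
    and l: "\<And>Y f. (Y, f) \<in> S \<Longrightarrow> l Y f \<in> sections Y"
    and match: "\<And>Y f Z g. \<lbrakk>(Y, f) \<in> S; Z \<in> Ob syn; g \<in> Hom syn Z Y\<rbrakk> \<Longrightarrow>
      pull Y Z g (l Y f) = l Z (Cmp syn Z Y X f g)"
  shows "\<exists>k\<in>sections X. \<forall>Y f. (Y, f) \<in> S \<longrightarrow> pull X Y f k = l Y f"
proof -
  have uniq: "l Y f ys = l Y' f' ys'"
    if Y: "(Y, f) \<in> S" and Y': "(Y', f') \<in> S" and ys: "ys \<in> points Y" "ys' \<in> points Y'"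
      and eq: "arr_map X f ys = arr_map X f' ys'" for Y f Y' f' ys ys'
  proof -
    from syn_pullback[OF X cover_sieve(1)[OF S Y] cover_sieve(1)[OF S Y'] cover_sieve(2)[OF S Y]
        cover_sieve(2)[OF S Y'] ys eq]
    obtain Z g g' ws where Z: "Z \<in> Ob syn" and g: "g \<in> Hom syn Z Y" "g' \<in> Hom syn Z Y'"
      and sq: "Cmp syn Z Y X f g = Cmp syn Z Y' X f' g'" and ws: "ws \<in> points Z"
      and ws_eq: "arr_map Y g ws = ys" "arr_map Y' g' ws = ys'" .
    have "pull Y Z g (l Y f) = pull Y' Z g' (l Y' f')"
      using match[OF Y Z g(1)] match[OF Y' Z g(2)] sq by simp
    from fun_cong[OF this, of ws] show ?thesis using ws ws_eq by (simp add: pull_def)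
  qed
  have "\<forall>xs\<in>points X. \<exists>a. \<forall>Y f ys. (Y, f) \<in> S \<and> ys \<in> points Y \<and> arr_map X f ys = xs \<longrightarrow> a = l Y f ys"
  proof
    fix xs assume "xs \<in> points X"
    then obtain Y f ys where Y: "(Y, f) \<in> S" and ys: "ys \<in> points Y" "arr_map X f ys = xs"
      using cover_jointly_surjective[OF S X] by blast
    then show "\<exists>a. \<forall>Y f ys. (Y, f) \<in> S \<and> ys \<in> points Y \<and> arr_map X f ys = xs \<longrightarrow> a = l Y f ys"
      using uniq by (intro exI[of _ "l Y f ys"]) blast
  qed
  then obtain k0 where k0: "\<And>xs Y f ys. \<lbrakk>xs \<in> points X; (Y, f) \<in> S; ys \<in> points Y; arr_map X f ys = xs\<rbrakk>
      \<Longrightarrow> k0 xs = l Y f ys"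
    by metis
  let ?k = "\<lambda>xs\<in>points X. k0 xs"
  have ap: "arr_map X f ys \<in> points X" if "(Y, f) \<in> S" "ys \<in> points Y" for Y f ys
    using arr_map_points[OF X cover_sieve(2)[OF S that(1)] that(2)] .
  have "k0 xs \<in> unit_surds" if "xs \<in> points X" for xs
    using cover_jointly_surjective[OF S X that] k0[OF that] l that
    by (force simp: sections_def)
  then have "?k \<in> sections X" by (simp add: sections_def)
  moreover have "pull X Y f ?k = l Y f" if "(Y, f) \<in> S" for Y f
  proof (rule PiE_ext)
    show "l Y f \<in> points Y \<rightarrow>\<^sub>E unit_surds" using l[OF that] by (simp add: sections_def)
    show "pull X Y f ?k \<in> points Y \<rightarrow>\<^sub>E unit_surds"
      using pull_sections[OF X cover_sieve(2)[OF S that] \<open>?k \<in> sections X\<close>] by (simp add: sections_def)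
  qed (use that ap k0 in \<open>simp add: pull_def\<close>)
  ultimately show ?thesis by blast
qed

text \<open>The predicates that define subsheaves of the sheaf of functions on points.\<close>

definition local_property :: "(nat \<times> 'i::infinite fm \<Rightarrow> (real list \<Rightarrow> real) \<Rightarrow> bool) \<Rightarrow> bool" where
  "local_property R \<longleftrightarrow>
     (\<forall>X Y f k. X \<in> Ob syn \<longrightarrow> Y \<in> Ob syn \<longrightarrow> f \<in> Hom syn Y X \<longrightarrow> k \<in> sections X \<longrightarrow> R X k \<longrightarrow>
        R Y (pull X Y f k)) \<and>
     (\<forall>X S k. X \<in> Ob syn \<longrightarrow> S \<in> syn_cov Simple X \<longrightarrow> k \<in> sections X \<longrightarrow>
        (\<forall>(Y, f)\<in>S. R Y (pull X Y f k)) \<longrightarrow> R X k)"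

text \<open>The subsheaf generated by the identity function of the model, that is, the image of the generic
  algebra in the sheaf of functions.\<close>

inductive generated :: "nat \<times> 'i::infinite fm \<Rightarrow> (real list \<Rightarrow> real) \<Rightarrow> bool" where
  generator: "generated (1, Top) (\<lambda>xs\<in>points (1, Top :: 'i fm). xs ! 0)"
| restriction: "\<lbrakk>X \<in> Ob syn; Y \<in> Ob syn; f \<in> Hom syn Y X; generated X k\<rbrakk> \<Longrightarrow> generated Y (pull X Y f k)"
| gluing: "\<lbrakk>X \<in> Ob syn; S \<in> syn_cov Simple X; k \<in> sections X;
    \<And>Y f. (Y, f) \<in> S \<Longrightarrow> generated Y (pull X Y f k)\<rbrakk> \<Longrightarrow> generated X k"

lemma generator_object: "(1, Top) \<in> Ob syn"
  by (simp add: syn_Ob)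

lemma points_generator:
  "points (1, Top) = {[a] | a. a \<in> unit_surds}" "points (Suc 0, Top) = {[a] | a. a \<in> unit_surds}"
  by (auto simp: points_def length_Suc_conv)

lemma generated_section: "generated X k \<Longrightarrow> X \<in> Ob syn \<and> k \<in> sections X"
proof (induction rule: generated.induct)
  case generator
  have "(\<lambda>xs\<in>points (1, Top :: 'a fm). xs ! 0) \<in> sections (1, Top :: 'a fm)"
    unfolding sections_def restrict_PiE_iff by (auto simp: points_generator)
  then show ?case using generator_object by blast
qed (auto intro: pull_sections)

text \<open>Functions in the generated subsheaf commute with shearing near each point: this is clear for the identity,
  inherited by restrictions because arrows commute with shearing, and local on covers.\<close>

lemma generated_shear:
  "\<lbrakk>generated X k; xs \<in> points X\<rbrakk> \<Longrightarrow>
    \<forall>\<^sub>F n in sequentially. map (shear n) xs \<in> points X \<and> k (map (shear n) xs) = shear n (k xs)"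
proof (induction arbitrary: xs rule: generated.induct)
  case generator
  from points_shear[OF generator_object generator] show ?case
    by eventually_elim (use generator in \<open>auto simp: points_generator\<close>)
next
  case (restriction X Y f k)
  have "arr_map X f xs \<in> points X"
    using restriction by (intro arr_map_points) auto
  from restriction.IH[OF this] arr_map_shear[OF restriction(2,1,3) restriction.prems] show ?case
    by eventually_elim (use restriction.prems in \<open>simp add: pull_def\<close>)
next
  case (gluing X S k)
  then obtain Y f ys where Y: "(Y, f) \<in> S" and ys: "ys \<in> points Y" "arr_map X f ys = xs"
    using cover_jointly_surjective by blast
  note obs = cover_sieve(1,2)[OF gluing(2) Y]
  from gluing.IH[OF Y ys(1)] arr_map_shear[OF obs(1) gluing(1) obs(2) ys(1)]
    points_shear[OF gluing(1) gluing.prems]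
  show ?case
    by eventually_elim (use ys in \<open>simp add: pull_def\<close>)
qed

definition case_sections :: "tm \<Rightarrow> nat \<Rightarrow> nat \<times> 'i::infinite fm \<Rightarrow> (real list \<Rightarrow> real) \<Rightarrow> bool" where
  "case_sections t j X k \<longleftrightarrow>
     generated X k \<and> (\<forall>xs\<in>points X. sat (simple_case t j :: 'i fm) (\<lambda>_. k xs))"

lemma local_property_generated: "local_property generated"
  unfolding local_property_def by (blast intro: generated.intros)

lemma local_property_case_sections: "local_property (case_sections t j)"
  unfolding local_property_def
proof (intro conjI allI impI)
  fix X Y :: "nat \<times> 'a fm" and f k
  assume X: "X \<in> Ob syn" "Y \<in> Ob syn" "f \<in> Hom syn Y X" and k: "case_sections t j X k"
  have "generated Y (pull X Y f k)"
    using X k by (intro generated.restriction) (auto simp: case_sections_def)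
  moreover have "sat (simple_case t j :: 'a fm) (\<lambda>_. pull X Y f k ys)" if "ys \<in> points Y" for ys
    using k arr_map_points[OF X(1,3) that] that by (simp add: case_sections_def pull_def)
  ultimately show "case_sections t j Y (pull X Y f k)" by (simp add: case_sections_def)
next
  fix X :: "nat \<times> 'a fm" and S k
  assume X: "X \<in> Ob syn" and S: "S \<in> syn_cov Simple X" and k: "k \<in> sections X"
    and loc: "\<forall>(Y, f)\<in>S. case_sections t j Y (pull X Y f k)"
  have "generated X k"
    using X S k by (rule generated.gluing) (use loc in \<open>auto simp: case_sections_def\<close>)
  moreover have "sat (simple_case t j :: 'a fm) (\<lambda>_. k xs)" if "xs \<in> points X" for xs
  proof -
    obtain Y f ys where Y: "(Y, f) \<in> S" and ys: "ys \<in> points Y" "arr_map X f ys = xs"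
      using cover_jointly_surjective[OF S X \<open>xs \<in> points X\<close>] by blast
    then have "sat (simple_case t j :: 'a fm) (\<lambda>_. pull X Y f k ys)"
      using loc by (auto simp: case_sections_def)
    then show ?thesis using ys by (simp add: pull_def)
  qed
  ultimately show "case_sections t j X k" by (simp add: case_sections_def)
qed

lemma local_property_True: "local_property (\<lambda>X k. True)"
  by (simp add: local_property_def)

text \<open>The axiom of simple MV-algebras at \<open>t(x)\<close> says that the inclusions of the subobjects \<open>{x. simple_case t j}\<close> cover
  \<open>{x. Top}\<close>.\<close>

lemma simple_cover:
  assumes t: "tm_in 1 t"
  shows "{(B, f). B \<in> Ob (syn :: (nat \<times> 'i::infinite fm, _) cat) \<and> f \<in> Hom syn B (1, Top) \<and>
      (\<exists>j. \<forall>b\<in>points B. sat (simple_case t j :: 'i fm) (\<lambda>_. arr_map (1, Top) f b ! 0))}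
    \<in> syn_cov Simple (1, Top)" (is "?S \<in> _")
proof -
  let ?U = "(1, Top) :: nat \<times> 'i fm"
  have U: "?U \<in> Ob syn" by (rule generator_object)
  have sieve: "is_sieve syn ?U ?S"
    unfolding is_sieve_def
  proof (rule ballI)
    fix Bf :: "(nat \<times> 'i fm) \<times> 'i fm set" assume "Bf \<in> ?S"
    then obtain B f j where Bf: "Bf = (B, f)" and B: "B \<in> Ob syn" and f: "f \<in> Hom syn B ?U"
      and j: "\<forall>b\<in>points B. sat (simple_case t j :: 'i fm) (\<lambda>_. arr_map ?U f b ! 0)"
      by blast
    have "(C, Cmp syn C B ?U f g) \<in> ?S" if C: "C \<in> Ob syn" and g: "g \<in> Hom syn C B" for C g
    proof -
      have "\<forall>c\<in>points C. sat (simple_case t j :: 'i fm) (\<lambda>_. arr_map ?U (Cmp syn C B ?U f g) c ! 0)"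
        using j syn_comp(2)[OF C B U g f] arr_map_points[OF B g] by simp
      then show ?thesis using C syn_comp(1)[OF C B U g f] by blast
    qed
    then show "case Bf of (Y, f) \<Rightarrow> Y \<in> Ob syn \<and> f \<in> Hom syn Y ?U \<and>
        (\<forall>Z\<in>Ob syn. \<forall>g\<in>Hom syn Z Y. (Z, Cmp syn Z Y ?U f g) \<in> ?S)"
      unfolding Bf split using B f by blast
  qed
  define A :: "'i \<Rightarrow> nat \<times> 'i fm" where "A i = (1, simple_case t (inv nat_idx i))" for i
  have A_in: "fm_in (simple_case t j :: 'i fm) 1" for j by (rule fm_in_simple_case[OF t])
  have A: "A i \<in> Ob syn" for i using A_in by (simp add: syn_Ob A_def)
  have f: "functional Simple (A i) ?U (arr_id (A i))" for i
    unfolding A_def using A_in by (intro functional_arr_id prv.TopI) simp_all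
  have inS: "(A i, arr_class Simple (A i) ?U (arr_id (A i))) \<in> ?S" for i
  proof -
    have "sat (simple_case t (inv nat_idx i) :: 'i fm)
        (\<lambda>_. arr_map ?U (arr_class Simple (A i) ?U (arr_id (A i))) b ! 0)" if b: "b \<in> points (A i)" for b
    proof -
      obtain a where ba: "b = [a]" and a: "a \<in> unit_surds" and s: "msat (simple_case t (inv nat_idx i) :: 'i fm) b"
        using b by (auto simp: points_def A_def length_Suc_conv)
      have "sat (simple_case t (inv nat_idx i) :: 'i fm) (\<lambda>_. a)"
        using s sat_cong[OF A_in, of "env b (\<lambda>_. 0)" "\<lambda>_. a"] by (simp add: ba env_def)
      moreover have "msat (arr_id (A i)) (b @ b)"
        using s env_add[of "[a]" "[a]" "\<lambda>_. 0 :: real"] by (simp add: arr_id_def A_def ba env_nth)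
      then have "arr_map ?U (arr_class Simple (A i) ?U (arr_id (A i))) b = b"
        using a by (intro arr_map_eqI[OF syn_HomI[OF f] arr_class_self[OF f]]) (simp_all add: ba A_def)
      ultimately show ?thesis by (simp add: ba)
    qed
    then show ?thesis using A syn_HomI[OF f] by blast
  qed
  have "prv Simple 1 Top (Disj (range nat_idx) (\<lambda>i. arr_image (fst (A i)) 1 (arr_id (A i))))"
    (is "prv _ _ _ ?D")
  proof (rule prv_simple_cases[OF t])
    have img: "prv Simple 1 (simple_case t (inv nat_idx i)) (arr_image (fst (A i)) 1 (arr_id (A i)))" for i
      unfolding A_def fst_conv by (rule prv_arr_image_inclusion[OF A_in])
    show D: "fm_in ?D 1" using prv_fm_in[OF img] by simp
    show "prv Simple 1 (simple_case t j) ?D" for j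
    proof -
      have "prv Simple 1 (arr_image (fst (A (nat_idx j))) 1 (arr_id (A (nat_idx j)))) ?D"
        using D by (rule prv.DisjI) simp
      then show ?thesis using img[of "nat_idx j"] by (simp add: inv_f_f[OF inj_nat_idx] prv.Cut)
    qed
  qed
  then show ?thesis
    unfolding syn_cov_def using sieve A f inS
    by (auto intro!: exI[of _ "range (nat_idx :: nat \<Rightarrow> 'i)"] exI[of _ A] exI[of _ "\<lambda>i. arr_id (A i)"])
qed

lemma sheaf_separated:
  assumes Z: "Z \<in> Ob (sheaf_cat C J)" and X: "X \<in> Ob C" and S: "S \<in> J X" and sieve: "is_sieve C X S"
    and a: "a \<in> fob Z X" "b \<in> fob Z X"
    and eq: "\<And>Y f. (Y, f) \<in> S \<Longrightarrow> fmap Z X Y f a = fmap Z X Y f b"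
  shows "a = b"
proof -
  have P: "Z \<in> Ob (presheaf_cat C)" and sh: "is_sheaf C J Z"
    using Z by (simp_all add: sheaf_cat_simps)
  have S': "Y \<in> Ob C \<and> f \<in> Hom C Y X" if "(Y, f) \<in> S" for Y f
    using sieve that by (auto simp: is_sieve_def)
  have "matching_family C Z X S (\<lambda>Y f. fmap Z X Y f a)"
    unfolding matching_family_def
  proof (clarify, intro conjI ballI)
    fix Y f assume Y: "(Y, f) \<in> S"
    note YO = S'[OF Y, THEN conjunct1] and f = S'[OF Y, THEN conjunct2]
    show "fmap Z X Y f a \<in> fob Z Y" by (rule presheaf_restr[OF P X YO f a(1)])
    fix W g assume "W \<in> Ob C" "g \<in> Hom C W Y"
    then show "fmap Z Y W g (fmap Z X Y f a) = fmap Z X W (Cmp C W Y X f g) a"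
      using presheaf_comp[OF P X YO _ f _ a(1)] by simp
  qed
  then have "\<exists>!y. y \<in> fob Z X \<and> (\<forall>(Y, f)\<in>S. fmap Z X Y f y = fmap Z X Y f a)"
    using sh X S by (auto simp: is_sheaf_def)
  moreover have "a \<in> fob Z X \<and> (\<forall>(Y, f)\<in>S. fmap Z X Y f a = fmap Z X Y f a)"
    and "b \<in> fob Z X \<and> (\<forall>(Y, f)\<in>S. fmap Z X Y f b = fmap Z X Y f a)"
    using a eq by auto
  ultimately show ?thesis by blast
qed

section \<open>The classifying topos is not separated by irreducible objects\<close>

text \<open>The sections of a presheaf in the classifying topos are elements of \<open>'u\<close>, so functions are represented by codes. The
  parameter \<open>index_type\<close> serves to fix the type \<open>'i\<close>.\<close>

locale sheaf_coding =
  fixes code :: "(real list \<Rightarrow> real) \<Rightarrow> 'u" and index_type :: "'i::infinite itself"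
  assumes inj_code: "inj_on code surd_functions"
    and small_code: "small (code ` surd_functions) TYPE('u)"
begin

abbreviation topos ::
  "((nat \<times> 'i fm, 'i fm set, 'u) presheaf, nat \<times> 'i fm \<Rightarrow> 'u \<Rightarrow> 'u) cat" where
  "topos \<equiv> classifying_topos Simple"

definition decode :: "'u \<Rightarrow> real list \<Rightarrow> real" where
  "decode = inv_into surd_functions code"

lemma decode_code: "k \<in> sections X \<Longrightarrow> decode (code k) = k"
  unfolding decode_def using sections_subset[of X] by (intro inv_into_f_f[OF inj_code]) blast

lemma code_inject: "\<lbrakk>code k = code k'; k \<in> sections X; k' \<in> sections X\<rbrakk> \<Longrightarrow> k = k'"
  using decode_code by metis

definition function_sheaf ::
  "(nat \<times> 'i fm \<Rightarrow> (real list \<Rightarrow> real) \<Rightarrow> bool) \<Rightarrow> (nat \<times> 'i fm, 'i fm set, 'u) presheaf" where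
  "function_sheaf R = \<lparr>fob = (\<lambda>X. code ` {k \<in> sections X. R X k}),
     fmap = (\<lambda>X Y f. \<lambda>u\<in>code ` {k \<in> sections X. R X k}. code (pull X Y f (decode u)))\<rparr>"

lemma function_sheaf_memI: "\<lbrakk>k \<in> sections X; R X k\<rbrakk> \<Longrightarrow> code k \<in> fob (function_sheaf R) X"
  by (simp add: function_sheaf_def)

lemma function_sheaf_memE:
  assumes "u \<in> fob (function_sheaf R) X"
  obtains k where "u = code k" "k \<in> sections X" "R X k"
  using assms by (auto simp: function_sheaf_def)

lemma function_sheaf_restr:
  "\<lbrakk>k \<in> sections X; R X k\<rbrakk> \<Longrightarrow> fmap (function_sheaf R) X Y f (code k) = code (pull X Y f k)"
  by (simp add: function_sheaf_def decode_code)

lemma function_presheaf: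
  assumes R: "local_property R"
  shows "function_sheaf R \<in> Ob (presheaf_cat syn)"
proof (rule presheafI)
  fix X :: "nat \<times> 'i fm" assume X: "X \<in> Ob syn"
  show "small (fob (function_sheaf R) X) TYPE('u)"
    using sections_subset[of X] by (intro small_subset[OF small_code]) (auto simp: function_sheaf_def)
  show "fmap (function_sheaf R) X X (Idn syn X) u = u" if "u \<in> fob (function_sheaf R) X" for u
    using that X by (auto elim!: function_sheaf_memE simp: function_sheaf_restr pull_idn)
  show "Idn syn X \<in> Hom syn X X" by (rule syn_idn(1)[OF X])
  fix Y f assume Y: "Y \<in> Ob syn" and f: "f \<in> Hom syn Y X"
  have loc: "R Y (pull X Y f k)" if "k \<in> sections X" "R X k" for k
    using R X Y f that unfolding local_property_def by blast
  have "fmap (function_sheaf R) X Y f u \<in> fob (function_sheaf R) Y"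
    if "u \<in> fob (function_sheaf R) X" for u
    using that by (rule function_sheaf_memE)
      (simp add: function_sheaf_restr function_sheaf_memI pull_sections[OF X f] loc)
  then show "fmap (function_sheaf R) X Y f \<in> fob (function_sheaf R) X \<rightarrow>\<^sub>E fob (function_sheaf R) Y"
    by (auto simp: PiE_iff) (simp add: function_sheaf_def)
  fix Z g assume Z: "Z \<in> Ob syn" and g: "g \<in> Hom syn Z Y"
  show "Cmp syn Z Y X f g \<in> Hom syn Z X" by (rule syn_comp(1)[OF Z Y X g f])
  show "fmap (function_sheaf R) X Z (Cmp syn Z Y X f g) u =
      fmap (function_sheaf R) Y Z g (fmap (function_sheaf R) X Y f u)"
    if "u \<in> fob (function_sheaf R) X" for u
    using that by (rule function_sheaf_memE)
      (simp add: function_sheaf_restr pull_sections[OF X f] loc pull_comp[OF X Y Z f g])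
qed

lemma function_sheaf_in_topos:
  assumes R: "local_property R"
  shows "function_sheaf R \<in> Ob topos"
proof -
  have "is_sheaf syn (syn_cov Simple) (function_sheaf R)"
    unfolding is_sheaf_def
  proof (intro ballI allI impI)
    fix X :: "nat \<times> 'i fm" and S x
    assume X: "X \<in> Ob syn" and S: "S \<in> syn_cov Simple X"
      and x: "matching_family syn (function_sheaf R) X S x"
    define l where "l Y f = decode (x Y f)" for Y f
    have l: "x Y f = code (l Y f) \<and> l Y f \<in> sections Y \<and> R Y (l Y f)" if "(Y, f) \<in> S" for Y f
    proof -
      have "x Y f \<in> fob (function_sheaf R) Y" using x that by (auto simp: matching_family_def)
      then show ?thesis unfolding l_def by (rule function_sheaf_memE) (simp add: decode_code)
    qed
    have match: "pull Y Z g (l Y f) = l Z (Cmp syn Z Y X f g)"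
      if Y: "(Y, f) \<in> S" and Z: "Z \<in> Ob syn" and g: "g \<in> Hom syn Z Y" for Y f Z g
    proof -
      have "code (pull Y Z g (l Y f)) = x Z (Cmp syn Z Y X f g)"
        using x Y Z g l[OF Y] by (fastforce simp: matching_family_def function_sheaf_restr)
      then show ?thesis
        using l[OF Y] l[OF cover_sieve(3)[OF S Y Z g]] pull_sections[OF cover_sieve(1)[OF S Y] g] code_inject
        by metis
    qed
    have ls: "l Y f \<in> sections Y" if "(Y, f) \<in> S" for Y f using l[OF that] by blast
    have "\<exists>k\<in>sections X. \<forall>Y f. (Y, f) \<in> S \<longrightarrow> pull X Y f k = l Y f"
      using X S ls match by (rule sections_glue)
    then obtain k where k: "k \<in> sections X" and kl: "\<And>Y f. (Y, f) \<in> S \<Longrightarrow> pull X Y f k = l Y f"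
      by blast
    have "R X k"
    proof -
      have "\<forall>(Y, f)\<in>S. R Y (pull X Y f k)" using kl l by auto
      then show ?thesis using R X S k unfolding local_property_def by blast
    qed
    show "\<exists>!y. y \<in> fob (function_sheaf R) X \<and> (\<forall>(Y, f)\<in>S. fmap (function_sheaf R) X Y f y = x Y f)"
    proof (rule ex1I)
      show "code k \<in> fob (function_sheaf R) X \<and>
          (\<forall>(Y, f)\<in>S. fmap (function_sheaf R) X Y f (code k) = x Y f)"
        using k \<open>R X k\<close> kl l by (auto simp: function_sheaf_memI function_sheaf_restr)
      fix y assume y: "y \<in> fob (function_sheaf R) X \<and> (\<forall>(Y, f)\<in>S. fmap (function_sheaf R) X Y f y = x Y f)"
      then obtain k' where y_eq: "y = code k'" and k': "k' \<in> sections X" "R X k'"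
        using function_sheaf_memE by blast
      have "k' = k"
      proof (rule sections_eqI[OF X S k'(1) k])
        fix Y f assume Y: "(Y, f) \<in> S"
        then have "code (pull X Y f k') = code (l Y f)"
          using y k' l[OF Y] by (auto simp: y_eq function_sheaf_restr)
        then show "pull X Y f k' = pull X Y f k"
          using code_inject pull_sections[OF X cover_sieve(2)[OF S Y] k'(1)] l[OF Y] kl[OF Y] by metis
      qed
      then show "y = code k" by (simp add: y_eq)
    qed
  qed
  then show ?thesis
    using function_presheaf[OF R] by (simp add: classifying_topos_def sheaf_cat_simps)
qed

definition function_map ::
  "(nat \<times> 'i fm \<Rightarrow> (real list \<Rightarrow> real) \<Rightarrow> bool) \<Rightarrow> (nat \<times> 'i fm \<Rightarrow> (real list \<Rightarrow> real) \<Rightarrow> real list \<Rightarrow> real)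
    \<Rightarrow> nat \<times> 'i fm \<Rightarrow> 'u \<Rightarrow> 'u" where
  "function_map R h = (\<lambda>X\<in>Ob syn. \<lambda>u\<in>fob (function_sheaf R) X. code (h X (decode u)))"

lemma function_map_code:
  "\<lbrakk>X \<in> Ob syn; k \<in> sections X; R X k\<rbrakk> \<Longrightarrow> function_map R h X (code k) = code (h X k)"
  by (simp add: function_map_def function_sheaf_memI decode_code)

lemma topos_simps:
  "Hom topos = Hom (presheaf_cat syn)" "Cmp topos = Cmp (presheaf_cat syn)"
  "P \<in> Ob topos \<Longrightarrow> P \<in> Ob (presheaf_cat syn)"
  by (simp_all add: classifying_topos_def sheaf_cat_simps)

lemma category_topos: "category topos"
  unfolding classifying_topos_def by (rule category_sheaf_cat)

lemma function_map_hom: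
  assumes R: "local_property R" "local_property R'"
    and h: "\<And>X k. \<lbrakk>X \<in> Ob syn; k \<in> sections X; R X k\<rbrakk> \<Longrightarrow> h X k \<in> sections X \<and> R' X (h X k)"
    and nat: "\<And>X Y f k. \<lbrakk>X \<in> Ob syn; Y \<in> Ob syn; f \<in> Hom syn Y X; k \<in> sections X; R X k\<rbrakk>
      \<Longrightarrow> h Y (pull X Y f k) = pull X Y f (h X k)"
  shows "function_map R h \<in> Hom topos (function_sheaf R) (function_sheaf R')"
  unfolding topos_simps(1) using function_presheaf[OF R(1)] function_presheaf[OF R(2)]
proof (rule presheaf_homI)
  show "function_map R h \<in> extensional (Ob syn)" by (simp add: function_map_def)
  fix X :: "nat \<times> 'i fm" assume X: "X \<in> Ob syn"
  have "function_map R h X u \<in> fob (function_sheaf R') X" if "u \<in> fob (function_sheaf R) X" for u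
    using that by (rule function_sheaf_memE) (use h X in \<open>simp add: function_map_code function_sheaf_memI\<close>)
  then show "function_map R h X \<in> fob (function_sheaf R) X \<rightarrow>\<^sub>E fob (function_sheaf R') X"
    using X by (auto simp: PiE_iff) (simp add: function_map_def)
  fix Y f u
  assume Y: "Y \<in> Ob syn" and f: "f \<in> Hom syn Y X" and "u \<in> fob (function_sheaf R) X"
  then obtain k where u: "u = code k" and k: "k \<in> sections X" "R X k" using function_sheaf_memE by blast
  have "R Y (pull X Y f k)" using R(1) X Y f k unfolding local_property_def by blast
  then show "function_map R h Y (fmap (function_sheaf R) X Y f u) =
      fmap (function_sheaf R') X Y f (function_map R h X u)"
    using X Y f k h[OF X k] nat[OF X Y f k] pull_sections[OF X f k(1)]
    by (simp add: u function_sheaf_restr function_map_code)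
qed

lemma case_inclusion_hom:
  "function_map (case_sections t j) (\<lambda>X k. k) \<in>
    Hom topos (function_sheaf (case_sections t j)) (function_sheaf generated)"
  by (intro function_map_hom local_property_case_sections local_property_generated)
    (auto simp: case_sections_def)

text \<open>Two maps that agree on all alternatives agree on the generator, because its restrictions to the members
  of \<open>simple_cover\<close> fall under an alternative; and the functions on which two maps agree are closed
  under restriction and gluing.\<close>

lemma cases_jointly_epic:
  assumes t: "tm_in 1 t"
  shows "jointly_epic topos (function_sheaf generated) (\<lambda>j. function_sheaf (case_sections t j))
    (\<lambda>j. function_map (case_sections t j) (\<lambda>X k. k))"
  unfolding jointly_epic_def
proof (intro conjI allI ballI impI)
  let ?V = "function_sheaf generated" and ?W = "\<lambda>j. function_sheaf (case_sections t j)"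
    and ?i = "\<lambda>j. function_map (case_sections t j) (\<lambda>X k. k)"
  show "?V \<in> Ob topos" by (intro function_sheaf_in_topos local_property_generated)
  show "?W j \<in> Ob topos" for j by (intro function_sheaf_in_topos local_property_case_sections)
  show "?i j \<in> Hom topos (?W j) ?V" for j by (rule case_inclusion_hom)
  fix Z p q
  assume Z: "Z \<in> Ob topos" and p: "p \<in> Hom topos ?V Z" and q: "q \<in> Hom topos ?V Z"
    and eq: "\<forall>j. Cmp topos (?W j) ?V Z p (?i j) = Cmp topos (?W j) ?V Z q (?i j)"
  note Z' = Z[unfolded classifying_topos_def]
  note p' = p[unfolded topos_simps(1)] and q' = q[unfolded topos_simps(1)]
  have on_cases: "p X (code k) = q X (code k)" if k: "case_sections t j X k" for X j k
  proof -
    have X: "X \<in> Ob syn" and ks: "k \<in> sections X"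
      using k generated_section[of X k] by (auto simp: case_sections_def)
    have "Cmp topos (?W j) ?V Z r (?i j) X (code k) = r X (code k)" for r
      unfolding topos_simps(2) using X ks k
      by (simp add: presheaf_cat_comp function_sheaf_memI function_map_code)
    then show ?thesis using eq by metis
  qed
  have restr: "r Y (code (pull X Y f k)) = fmap Z X Y f (r X (code k))"
    if r: "r \<in> Hom (presheaf_cat syn) ?V Z" and X: "X \<in> Ob syn" "Y \<in> Ob syn" "f \<in> Hom syn Y X"
      and k: "generated X k" for r X Y f k
    using presheaf_hom_nat[OF r X, of "code k"] generated_section[OF k] k
    by (simp add: function_sheaf_restr function_sheaf_memI)
  have mem: "r X (code k) \<in> fob Z X"
    if r: "r \<in> Hom (presheaf_cat syn) ?V Z" and k: "generated X k" for r X k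
    using presheaf_hom_mem[OF r] generated_section[OF k] k by (simp add: function_sheaf_memI)
  have glue: "p X (code k) = q X (code k)"
    if X: "X \<in> Ob syn" and S: "S \<in> syn_cov Simple X" and k: "generated X k"
      and loc: "\<And>Y f. (Y, f) \<in> S \<Longrightarrow> p Y (code (pull X Y f k)) = q Y (code (pull X Y f k))" for X S k
  proof (rule sheaf_separated[OF Z' X S])
    show "is_sieve syn X S" using S by (simp add: syn_cov_def)
    show "p X (code k) \<in> fob Z X" "q X (code k) \<in> fob Z X" using mem p' q' k by auto
    show "fmap Z X Y f (p X (code k)) = fmap Z X Y f (q X (code k))" if "(Y, f) \<in> S" for Y f
      using restr[OF p' X cover_sieve(1,2)[OF S that] k] restr[OF q' X cover_sieve(1,2)[OF S that] k]
        loc[OF that] by simp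
  qed
  have "p X (code k) = q X (code k)" if "generated X k" for X k
    using that
  proof (induction rule: generated.induct)
    case generator
    show ?case
    proof (rule glue[OF generator_object simple_cover[OF t] generated.generator])
      fix B :: "nat \<times> 'i fm" and f
      let ?k = "pull (1, Top) B f (\<lambda>xs\<in>points (1, Top :: 'i fm). xs ! 0)"
      assume "(B, f) \<in> {(B, f). B \<in> Ob syn \<and> f \<in> Hom syn B (1, Top) \<and>
        (\<exists>j. \<forall>b\<in>points B. sat (simple_case t j :: 'i fm) (\<lambda>_. arr_map (1, Top) f b ! 0))}"
      then obtain j where B: "B \<in> Ob syn" and f: "f \<in> Hom syn B (1, Top)"
        and j: "\<forall>b\<in>points B. sat (simple_case t j :: 'i fm) (\<lambda>_. arr_map (1, Top) f b ! 0)"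
        by blast
      have "generated B ?k" by (intro generated.restriction generator_object B f generated.generator)
      moreover have "sat (simple_case t j :: 'i fm) (\<lambda>_. ?k b)" if "b \<in> points B" for b
        using that j arr_map_points[OF generator_object f that] by (simp add: pull_def)
      ultimately have "case_sections t j B ?k" by (simp add: case_sections_def)
      then show "p B (code ?k) = q B (code ?k)" by (rule on_cases)
    qed
  next
    case (restriction X Y f k)
    then show ?case using restr[OF p' restriction(1-4)] restr[OF q' restriction(1-4)] by simp
  next
    case (gluing X S k)
    have "generated X k" by (rule generated.gluing[OF gluing.hyps])
    then show ?case by (rule glue[OF gluing.hyps(1,2) _ gluing.IH])
  qed
  then show "p = q"
    by (intro presheaf_hom_eqI[OF p' q']) (auto elim: function_sheaf_memE)
qed

definition indicator_map :: "real \<Rightarrow> nat \<times> 'i fm \<Rightarrow> 'u \<Rightarrow> 'u" where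
  "indicator_map c = function_map generated (\<lambda>X k. \<lambda>xs\<in>points X. if k xs = c then 1 else 0)"

lemma indicator_map_hom:
  "indicator_map c \<in> Hom topos (function_sheaf generated) (function_sheaf (\<lambda>X k. True))"
  unfolding indicator_map_def
  by (intro function_map_hom local_property_True local_property_generated)
    (auto simp: sections_def pull_def fun_eq_iff dest: arr_map_points)

text \<open>The value \<open>\<alpha> = sqrt 2 - 1\<close> is taken by the identity function, but by no function \<open>k\<close> that is the image of an
  element of an irreducible object: such a \<open>k\<close> cannot separate \<open>\<alpha>\<close> from another of its values by a term, and \<open>k\<close> does
  have another value, the shear of \<open>\<alpha>\<close>.\<close>

lemma not_separated_by_irreducibles: "\<not> separated_by_irreducibles topos"
proof
  assume sep: "separated_by_irreducibles topos"
  let ?V = "function_sheaf generated" and ?F = "function_sheaf (\<lambda>X k. True)"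
  let ?\<alpha> = "surd (-1) 1"
  have "1 \<le> sqrt 2" "sqrt 2 \<le> 2" by (simp_all add: real_le_lsqrt)
  then have \<alpha>: "?\<alpha> \<in> unit_surds" by (intro unit_surdsI) (simp_all add: surd_def)
  \<comment> \<open>The value 2 is outside of the model, so that \<open>indicator_map 2\<close> is the zero map.\<close>
  let ?u = "indicator_map ?\<alpha>" and ?v = "indicator_map 2"
  have V: "?V \<in> Ob topos" and F: "?F \<in> Ob topos"
    by (intro function_sheaf_in_topos local_property_generated local_property_True)+
  let ?ind = "\<lambda>c (X :: nat \<times> 'i fm) (k :: real list \<Rightarrow> real). \<lambda>xs\<in>points X. if k xs = c then 1 else 0 :: real"
  have ind_eq: "indicator_map c X (code k) = code (?ind c X k)"
    if "generated X k" for c X k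
    unfolding indicator_map_def using that generated_section[OF that] by (simp add: function_map_code)
  have ind_sec: "?ind c X k \<in> sections X" for c X k
    by (auto simp: sections_def)
  have ind_ne: "?u X (code k) \<noteq> ?v X (code k) \<longleftrightarrow> (\<exists>xs\<in>points X. k xs = ?\<alpha>)"
    if k: "generated X k" for X k
  proof -
    have "k xs \<noteq> 2" if "xs \<in> points X" for xs
      using generated_section[OF k] that unit_surds_bounds[of "k xs"] by (force simp: sections_def)
    then have ne: "?ind ?\<alpha> X k \<noteq> ?ind 2 X k \<longleftrightarrow> (\<exists>xs\<in>points X. k xs = ?\<alpha>)"
      by (auto simp: fun_eq_iff restrict_def)
    have eq: "code (?ind ?\<alpha> X k) = code (?ind 2 X k) \<longleftrightarrow> ?ind ?\<alpha> X k = ?ind 2 X k"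
      by (rule iffI, erule code_inject[OF _ ind_sec ind_sec], erule arg_cong)
    show ?thesis unfolding ind_eq[OF k] eq by (rule ne)
  qed
  let ?x = "\<lambda>xs\<in>points (1, Top :: 'i fm). xs ! 0"
  have "?u (1, Top) (code ?x) \<noteq> ?v (1, Top) (code ?x)"
    unfolding ind_ne[OF generated.generator] using \<alpha> by (auto simp: points_generator)
  then have "?u \<noteq> ?v" by metis
  then obtain X m where X: "irreducible_object topos X" and m: "m \<in> Hom topos X ?V"
    and ne: "Cmp topos X ?V ?F ?u m \<noteq> Cmp topos X ?V ?F ?v m"
    using sep V F indicator_map_hom unfolding separated_by_irreducibles_def by blast
  have XO: "X \<in> Ob topos" using X by (simp add: irreducible_object_def)
  note m' = m[unfolded topos_simps(1)]
  have "Cmp topos X ?V ?F w m \<in> Hom (presheaf_cat syn) X ?F" if "w \<in> Hom topos ?V ?F" for w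
    using category_compI[OF category_topos XO V F m that] by (simp add: topos_simps)
  then obtain A s where A: "A \<in> Ob syn" and s: "s \<in> fob X A"
    and ne': "Cmp topos X ?V ?F ?u m A s \<noteq> Cmp topos X ?V ?F ?v m A s"
    using presheaf_hom_eqI ne indicator_map_hom by meson
  have "m A s \<in> fob ?V A" by (rule presheaf_hom_mem[OF m' A s])
  then obtain k where mk: "m A s = code k" and k: "k \<in> sections A" "generated A k"
    by (rule function_sheaf_memE)
  have "?u A (code k) \<noteq> ?v A (code k)"
    using ne' A s by (simp add: topos_simps presheaf_cat_comp mk)
  then obtain xs where xs: "xs \<in> points A" and kxs: "k xs = ?\<alpha>" using ind_ne[OF k(2)] by blast
  obtain n where n: "map (shear n) xs \<in> points A" "k (map (shear n) xs) = shear n ?\<alpha>"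
    using eventually_happens[OF generated_shear[OF k(2) xs]] kxs by auto
  have "k (map (shear n) xs) \<in> unit_surds" using k(1) n(1) unfolding sections_def by (rule PiE_mem)
  then have \<beta>: "shear n ?\<alpha> \<in> unit_surds" by (simp only: n(2))
  have "?\<alpha> < shear n ?\<alpha>" by (simp add: shear_def)
  then obtain t where t: "tm_in 1 t" and t\<alpha>: "tm_val (\<lambda>_. ?\<alpha>) t = 0"
    and t\<beta>: "tm_val (\<lambda>_. shear n ?\<alpha>) t > 0"
    using separating_term[of ?\<alpha> "shear n ?\<alpha>"] unit_surds_bounds[OF \<alpha>] unit_surds_bounds[OF \<beta>] by blast
  let ?W = "\<lambda>j. function_sheaf (case_sections t j)" and ?i = "\<lambda>j. function_map (case_sections t j) (\<lambda>X k. k)"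
  \<comment> \<open>As \<open>X\<close> is irreducible, \<open>k\<close> falls under one alternative for \<open>t\<close>. It would have to be \<open>t = 0\<close> because of the value
    \<open>\<alpha>\<close>, and one of the others because of the value \<open>shear n \<alpha>\<close>.\<close>
  obtain j g where g: "g \<in> Hom topos X (?W j)" and gm: "Cmp topos X (?W j) ?V (?i j) g = m"
    using X cases_jointly_epic[OF t] m unfolding irreducible_object_def by blast
  have "g A s \<in> fob (?W j) A" using presheaf_hom_mem[OF g[unfolded topos_simps(1)] A s] .
  then obtain k' where gk: "g A s = code k'" and k': "k' \<in> sections A" "case_sections t j A k'"
    by (rule function_sheaf_memE)
  have "m A s = ?i j A (g A s)" using A s by (simp add: gm[symmetric] topos_simps presheaf_cat_comp)
  then have "code k = code k'" using A k' by (simp add: mk gk function_map_code)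
  then have "case_sections t j A k" using code_inject k(1) k' by metis
  then have sat: "sat (simple_case t j :: 'i fm) (\<lambda>_. k ys)" if "ys \<in> points A" for ys
    using that by (simp add: case_sections_def)
  show False
  proof (cases j)
    case 0
    then show False using sat[OF n(1)] t\<beta> by (simp add: n simple_case_def)
  next
    case (Suc l)
    have "tm_val (\<lambda>_. ?\<alpha>) (nmult l t) = 0" using t\<alpha> by (simp add: tm_val_nmult)
    then show False using sat[OF xs] Suc by (simp add: kxs simple_case_def One_def)
  qed
qed

end

theorem theorem9p1:
  assumes "small (UNIV :: 'i::infinite fm set) TYPE('u)"
  shows "\<not> presheaf_type TYPE('u) (Simple :: 'i geom_theory)"
proof
  assume "presheaf_type TYPE('u) (Simple :: 'i geom_theory)"
  then obtain C :: "('u, 'u) cat" where C: "small_category C" and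
    eqv: "equivalent_cats (classifying_topos (Simple :: 'i geom_theory) :: (_, nat \<times> 'i fm \<Rightarrow> 'u \<Rightarrow> 'u) cat)
      (presheaf_cat C :: (('u, 'u, 'u) presheaf, _) cat)"
    by (auto simp: presheaf_type_def)
  have less: "(UNIV :: 'i fm set) \<prec> (UNIV :: 'u set)" using assms by (simp add: small_def)
  have sf: "surd_functions \<prec> (UNIV :: 'u set)"
    using surd_functions_lepoll less by (rule lesspoll_trans1)
  then obtain code :: "(real list \<Rightarrow> real) \<Rightarrow> 'u" where code: "inj_on code surd_functions"
    using lesspoll_imp_lepoll[OF sf] unfolding lepoll_def by blast
  interpret sheaf_coding code "TYPE('i)"
  proof
    show "small (code ` surd_functions) TYPE('u)"
      using sf by (intro small_image) (simp add: small_def)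
  qed (rule code)
  have "infinite (UNIV :: 'u set)"
  proof
    assume "finite (UNIV :: 'u set)"
    moreover obtain h :: "'i fm \<Rightarrow> 'u" where "inj h"
      using lesspoll_imp_lepoll[OF less] unfolding lepoll_def by blast
    ultimately have "finite (UNIV :: 'i fm set)" using finite_imageD finite_subset subset_UNIV by metis
    then have "finite (range (\<lambda>i :: 'i. Disj {i} (\<lambda>_. Top :: 'i fm)))" by (rule finite_subset[rotated]) simp
    then have "finite (UNIV :: 'i set)" by (rule finite_imageD) (simp add: inj_def)
    then show False using infinite_UNIV by blast
  qed
  then have "separated_by_irreducibles topos"
    using separated_by_irreducibles_equivalent[OF eqv] category_topos category_presheaf_cat
      presheaf_cat_separated_by_irreducibles[OF C] by blast
  then show False using not_separated_by_irreducibles by blast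
qed

end
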